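(* Let $1<k\le n$ be integers. Every interval $[\sigma,\tau]=\{\pi : \sigma\le\pi\le\tau\}$ (with $\sigma\le\tau$) in the poset $\mathrm{Poset}(\mathrm{PF}_{n,k})$ is isomorphic, as a poset, either to $\mathrm{Poset}(\mathrm{PF}_{r,r})\times\prod_{i=1}^{j}\mathrm{NC}_{m_i}$ for some integers $r\ge 2$, $j\ge 1$ and $m_1,\dots,m_j\ge 1$, or to $\prod_{i=1}^{j}\mathrm{NC}_{m_i}$ for some integers $j\ge 1$ and $m_1,\dots,m_j\ge 1$.
   Context: Write $[n]=\{1,\dots,n\}$. A parking function of length $n$ is an $n$-tuple $(a_1,\dots,a_n)$ of positive integers whose weakly increasing rearrangement $b_1\le\dots\le b_n$ satisfies $b_i\le i$ for all $i$; $\mathrm{PF}_n$ is the set of these. For $1<k\le n$, $\mathrm{PF}_{n,k}$ is the set of $a\in\mathrm{PF}_n$ such that $k$ is not an entry of $a$ but each of $k+1,\dots,n$ is an entry of $a$. $\mathrm{NC}_m$ is the lattice of noncrossing partitions of $[m]$ (partitions for which, placing $1,\dots,m$ in clockwise order on a circle, the convex hulls of the blocks are pairwise disjoint), ordered by refinement, with the finer partition being smaller. Each covering relation $\sigma<\tau$ in $\mathrm{NC}_{n+1}$ merges two blocks $B_1,B_2$ of $\sigma$ into one block $B=B_1\cup B_2$ of $\tau$; name them so that $\min B\in B_1$, and label the covering relation by the largest element of $B_1$ that is less than every element of $B_2$. Reading the labels of a maximal chain of $\mathrm{NC}_{n+1}$ from bottom to top gives a parking function of length $n$, and this is a (known)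 bijection from maximal chains of $\mathrm{NC}_{n+1}$ to $\mathrm{PF}_n$. $\mathrm{Poset}(\mathrm{PF}_{n,k})$ is the poset whose Hasse diagram is the union of the maximal chains of $\mathrm{NC}_{n+1}$ corresponding to elements of $\mathrm{PF}_{n,k}$: its elements are the noncrossing partitions lying on at least one of these chains, and its order is the reflexive-transitive closure of the covering relations occurring in these chains (it need not be an induced subposet of $\mathrm{NC}_{n+1}$). *)

theory Defs
  imports "HOL-Analysis.Analysis"
begin

definition parking_functions :: "nat \<Rightarrow> nat list set" where
  "parking_functions n =
     {a. length a = n \<and> (\<forall>x\<in>set a. 1 \<le> x) \<and> (\<forall>i<n. sort a ! i \<le> Suc i)}"

definition parking_functions_k :: "nat \<Rightarrow> nat \<Rightarrow> nat list set" where
  "parking_functions_k n k =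
     {a \<in> parking_functions n. k \<notin> set a \<and> {Suc k..n} \<subseteq> set a}"

(* A poset is given by its reflexive order relation; its carrier is the Field of that relation. *)

definition poset_isomorphic :: "'a rel \<Rightarrow> 'b rel \<Rightarrow> bool" where
  "poset_isomorphic r s \<longleftrightarrow>
     (\<exists>f. bij_betw f (Field r) (Field s) \<and>
          (\<forall>x\<in>Field r. \<forall>y\<in>Field r. (x, y) \<in> r \<longleftrightarrow> (f x, f y) \<in> s))"

definition interval_poset :: "'a rel \<Rightarrow> 'a \<Rightarrow> 'a \<Rightarrow> 'a rel" where
  "interval_poset r a b = Restr r {x. (a, x) \<in> r \<and> (x, b) \<in> r}"

definition prod_poset :: "'a rel \<Rightarrow> 'b rel \<Rightarrow> ('a \<times> 'b) rel" where
  "prod_poset r s = {((a, b), (a', b')). (a, a') \<in> r \<and> (b, b') \<in> s}"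

definition PiE_poset :: "'i set \<Rightarrow> ('i \<Rightarrow> 'a rel) \<Rightarrow> ('i \<Rightarrow> 'a) rel" where
  "PiE_poset I r =
     {(f, g). f \<in> (\<Pi>\<^sub>E i\<in>I. Field (r i)) \<and> g \<in> (\<Pi>\<^sub>E i\<in>I. Field (r i)) \<and>
              (\<forall>i\<in>I. (f i, g i) \<in> r i)}"

(* The points 1, ..., m in clockwise order on the unit circle. *)
definition circle_point :: "nat \<Rightarrow> nat \<Rightarrow> complex" where
  "circle_point m i = cis (- (2 * pi * real i / real m))"

definition noncrossing_partitions :: "nat \<Rightarrow> nat set set set" where
  "noncrossing_partitions m =
     {P. partition_on {1..m} P \<and>
         pairwise (\<lambda>B C. disjnt (convex hull (circle_point m ` B)) (convex hull (circle_point m ` C))) P}"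

definition NC_poset :: "nat \<Rightarrow> nat set set rel" where
  "NC_poset m =
     {(P, Q). P \<in> noncrossing_partitions m \<and> Q \<in> noncrossing_partitions m \<and> refines {1..m} P Q}"

(* Maximal chains, listed from bottom to top. *)
definition NC_maximal_chains :: "nat \<Rightarrow> nat set set list set" where
  "NC_maximal_chains m =
     {c. sorted_wrt (\<lambda>P Q. (P, Q) \<in> NC_poset m \<and> P \<noteq> Q) c \<and>
         pred_on.maxchain (noncrossing_partitions m) (\<lambda>P Q. (P, Q) \<in> NC_poset m \<and> P \<noteq> Q) (set c)}"

(* Only meaningful when Q covers P among the noncrossing partitions: then Q has exactly one
   block that is a union of two distinct blocks of P, and B1, B2 are determined. *)
definition cover_label :: "nat set set \<Rightarrow> nat set set \<Rightarrow> nat" where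
  "cover_label P Q =
     (THE l. \<exists>B1 B2. B1 \<in> P \<and> B2 \<in> P \<and> B1 \<noteq> B2 \<and> B1 \<union> B2 \<in> Q \<and>
                     Min (B1 \<union> B2) \<in> B1 \<and> l = Max {x \<in> B1. \<forall>y\<in>B2. x < y})"

definition chain_labels :: "nat set set list \<Rightarrow> nat list" where
  "chain_labels c = map (\<lambda>(P, Q). cover_label P Q) (zip c (tl c))"

definition PF_chains :: "nat \<Rightarrow> nat \<Rightarrow> nat set set list set" where
  "PF_chains n k = {c \<in> NC_maximal_chains (n + 1). chain_labels c \<in> parking_functions_k n k}"

(* zip c (tl c) lists the consecutive pairs of a maximal chain, i.e. its covering relations. *)
definition PF_poset :: "nat \<Rightarrow> nat \<Rightarrow> nat set set rel" where
  "PF_poset n k =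
     Restr ((\<Union>c\<in>PF_chains n k. set (zip c (tl c)))\<^sup>*) (\<Union>c\<in>PF_chains n k. set c)"

end

theory Submission
  imports Defs
begin

text \<open>
  A cover of noncrossing partitions makes one block minimum \<open>b\<close> disappear, and its label is the predecessor
  of \<open>b\<close> in the merged block. Counting labels from the top, the chain belongs to \<open>PF_chains n k\<close> iff each
  \<open>b \<ge> k + 2\<close> is merged with label \<open>b - 1\<close> and \<open>k + 1\<close> is not merged with label \<open>k\<close>. Thus every
  \<open>x > k + 1\<close> that is not minimal in its block is in the block of \<open>x - 1\<close>, and paths avoiding the label \<open>k\<close>
  are obstructed by a single condition (\<open>blocked\<close>) on the block of \<open>k + 1\<close>. An interval of noncrossing
  partitions is the product of the noncrossing partition lattices of the blocks of the relative Kreweras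
  complement. The obstruction is visible only in the block containing \<open>k\<close> and \<open>k + 1\<close>: there it is the
  condition that defines \<open>PF_poset r r\<close>, and when it is vacuous the whole interval is a product of
  noncrossing partition lattices.
\<close>

section \<open>Noncrossing equivalence relations and pockets\<close>

text \<open>The order of \<open>PF_poset n k\<close> is a closure of covers, so it has to be decided
  pair by pair: inclusion of two vertices is not enough, and \<open>blocked\<close> takes both ends.
  In an interval from \<open>s\<close> to \<open>t\<close> it occurs three times: \<open>s\<close>
  against a vertex, a vertex against \<open>t\<close>, and two vertices against each other.
  Identifying the special factor with \<open>PF_poset r r\<close> means matching these with the
  conditions there for bottom, top and the order itself; this works because on the pocket
  \<open>s\<close> is discrete and \<open>t\<close> is full. The difficulty is that
  \<open>blocked\<close> speaks of the minimum of the final block of \<open>k + 1\<close>, which may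
  lie outside the pocket. It is replaced by the largest element of its class in \<open>s\<close>:
  that element lies in the pocket, is the minimum of the block of \<open>k + 1\<close> there, and is
  equivalent to the original minimum in every relation above \<open>s\<close>. The bound
  \<open>2 \<le> r\<close> has the same source: since the pair of ends is not blocked, this element
  differs from \<open>k\<close>, so that the pocket has at least three elements.\<close>

text \<open>\<open>nsep f f' x y\<close>: the gaps just after \<open>x\<close> and just after \<open>y\<close> lie on the same side of the
  chord \<open>f f'\<close>. Formulated by parity, it does not depend on the cyclic arrangement of the four points,
  and it is transitive both in the gaps and in the chord.\<close>

definition nsep :: "nat \<Rightarrow> nat \<Rightarrow> nat \<Rightarrow> nat \<Rightarrow> bool" where
  "nsep f f' x y \<longleftrightarrow> ((x < f) = (y < f)) = ((x < f') = (y < f'))"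

text \<open>A point and the gap after it lie on the same side of any chord not ending at the point,
  so for points of different classes \<open>nsep\<close> is the usual noncrossing condition, without
  a case distinction on the order of the four points.\<close>

definition nceq :: "nat set \<Rightarrow> nat rel \<Rightarrow> bool" where
  "nceq A r \<longleftrightarrow> equiv A r \<and>
     (\<forall>a b c d. (a, c) \<in> r \<longrightarrow> (b, d) \<in> r \<longrightarrow> (a, b) \<notin> r \<longrightarrow> nsep b d a c)"

definition join :: "nat rel \<Rightarrow> nat \<Rightarrow> nat \<Rightarrow> nat rel" where
  "join r x y = r \<union> r `` {x} \<times> r `` {y} \<union> r `` {y} \<times> r `` {x}"

lemma nsep_refl [simp]: "nsep f f x y" "nsep f f' x x"
  by (simp_all add: nsep_def)

lemma nsep_sym: "nsep f f' x y \<Longrightarrow> nsep f f' y x" "nsep f f' x y \<Longrightarrow> nsep f' f x y"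
  by (auto simp: nsep_def)

lemma nsep_trans:
  "nsep f f' x y \<Longrightarrow> nsep f f' y z \<Longrightarrow> nsep f f' x z"
  "nsep f f' x y \<Longrightarrow> nsep f' f'' x y \<Longrightarrow> nsep f f'' x y"
  by (auto simp: nsep_def)

lemma nsep_swap:
  "nsep f f' x y \<Longrightarrow> f \<noteq> x \<Longrightarrow> f \<noteq> y \<Longrightarrow> f' \<noteq> x \<Longrightarrow> f' \<noteq> y \<Longrightarrow> nsep x y f f'"
  unfolding nsep_def by (metis linorder_cases order_less_asym)

text \<open>The chord \<open>w w'\<close> has \<open>f f'\<close> on one side and the gaps of
  \<open>x\<close> and \<open>y\<close> on the other, so \<open>f f'\<close> cannot separate these
  gaps. The ends are kept distinct because \<open>f\<close> and \<open>f'\<close> enter the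
  hypotheses as gaps and the conclusion as points.\<close>

lemma nsep_third:
  assumes "nsep w w' f f'" "nsep w w' x y" "\<not> nsep w w' f x"
    "{w, w'} \<inter> {f, f'} = {}"
  shows "nsep f f' x y"
  using assms unfolding nsep_def by (smt (verit, best) disjoint_insert(2) insertCI linorder_neqE_nat order_less_trans not_less_iff_gr_or_eq)


lemma nceqD:
  assumes "nceq A r"
  shows nceq_refl: "x \<in> A \<Longrightarrow> (x, x) \<in> r"
    and nceq_sym: "(x, y) \<in> r \<Longrightarrow> (y, x) \<in> r"
    and nceq_trans: "(x, y) \<in> r \<Longrightarrow> (y, z) \<in> r \<Longrightarrow> (x, z) \<in> r"
    and nceq_dom: "(x, y) \<in> r \<Longrightarrow> x \<in> A" "(x, y) \<in> r \<Longrightarrow> y \<in> A"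
    and nceq_nsep: "(a, c) \<in> r \<Longrightarrow> (b, d) \<in> r \<Longrightarrow> (a, b) \<notin> r \<Longrightarrow> nsep b d a c"
proof -
  have r: "r \<subseteq> A \<times> A" "refl_on A r" "sym r" "trans r"
    using assms by (auto simp: nceq_def equiv_def)
  show "x \<in> A \<Longrightarrow> (x, x) \<in> r" using r(2) by (rule refl_onD)
  show "(x, y) \<in> r \<Longrightarrow> (y, x) \<in> r" using r(3) by (rule symD)
  show "(x, y) \<in> r \<Longrightarrow> (y, z) \<in> r \<Longrightarrow> (x, z) \<in> r" using r(4) by (rule transD)
  show "(x, y) \<in> r \<Longrightarrow> x \<in> A" "(x, y) \<in> r \<Longrightarrow> y \<in> A" using r(1) by blast+
  show "(a, c) \<in> r \<Longrightarrow> (b, d) \<in> r \<Longrightarrow> (a, b) \<notin> r \<Longrightarrow> nsep b d a c"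
    using assms unfolding nceq_def by blast
qed

lemma nceqI:
  assumes "\<And>x. x \<in> A \<Longrightarrow> (x, x) \<in> r"
    and "\<And>x y. (x, y) \<in> r \<Longrightarrow> (y, x) \<in> r"
    and "\<And>x y z. (x, y) \<in> r \<Longrightarrow> (y, z) \<in> r \<Longrightarrow> (x, z) \<in> r"
    and "\<And>x y. (x, y) \<in> r \<Longrightarrow> x \<in> A"
    and "\<And>a b c d. (a, c) \<in> r \<Longrightarrow> (b, d) \<in> r \<Longrightarrow> (a, b) \<notin> r \<Longrightarrow> nsep b d a c"
  shows "nceq A r"
proof -
  have "r \<subseteq> A \<times> A" using assms(2,4) by auto
  then have "equiv A r"
    using assms(1-3) by (intro equivI refl_onI symI transI) (assumption | blast)+
  then show ?thesis using assms(5) unfolding nceq_def by blast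
qed

lemma nceq_restrict:
  assumes "nceq A r" "K \<subseteq> A"
  shows "nceq K (r \<inter> K \<times> K)"
proof (rule nceqI)
  fix a b c d assume "(a, c) \<in> r \<inter> K \<times> K" "(b, d) \<in> r \<inter> K \<times> K" "(a, b) \<notin> r \<inter> K \<times> K"
  then show "nsep b d a c" using nceq_nsep[OF assms(1), of a c b d] by blast
qed (use assms in \<open>auto dest: nceq_refl nceq_sym nceq_trans\<close>)

lemma join_iff:
  assumes "nceq A r"
  shows "(u, v) \<in> join r x y \<longleftrightarrow>
    (u, v) \<in> r \<or> (u, x) \<in> r \<and> (y, v) \<in> r \<or> (u, y) \<in> r \<and> (x, v) \<in> r"
  using nceq_sym[OF assms] unfolding join_def by blast

lemma join_subset:
  assumes "nceq A r" "nceq A s" "r \<subseteq> s" "(x, y) \<in> s"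
  shows "join r x y \<subseteq> s"
proof (rule subrelI)
  fix u v assume "(u, v) \<in> join r x y"
  then show "(u, v) \<in> s"
    using assms(3,4) nceq_sym[OF assms(2)] nceq_trans[OF assms(2)]
    unfolding join_iff[OF assms(1)] by (meson subsetD)
qed

lemma subset_join: "r \<subseteq> join r x y"
  by (auto simp: join_def)

lemma join_self: "nceq A r \<Longrightarrow> x \<in> A \<Longrightarrow> y \<in> A \<Longrightarrow> (x, y) \<in> join r x y"
  by (auto simp: join_iff dest: nceq_refl)

text \<open>Each of the two old classes lies on one side of any third class, so the merged class can
  cross the third one only if that one separates the gaps of \<open>x\<close> and \<open>y\<close>;
  \<open>sep\<close> excludes this.\<close>

lemma nceq_join:
  assumes r: "nceq A r" and xy: "x \<in> A" "y \<in> A"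
    and sep: "\<And>f f'. (f, f') \<in> r \<Longrightarrow> (f, x) \<notin> r \<Longrightarrow> (f, y) \<notin> r \<Longrightarrow> nsep f f' x y"
  shows "nceq A (join r x y)"
proof (rule nceqI)
  note J = join_iff[OF r] and S = nceq_sym[OF r] and T = nceq_trans[OF r]
  note R = nceq_refl[OF r xy(1)] nceq_refl[OF r xy(2)]
  show "\<And>u. u \<in> A \<Longrightarrow> (u, u) \<in> join r x y" unfolding J using nceq_refl[OF r] by blast
  show "\<And>u v. (u, v) \<in> join r x y \<Longrightarrow> (v, u) \<in> join r x y" unfolding J using S by blast
  show "(u, w) \<in> join r x y" if "(u, v) \<in> join r x y" "(v, w) \<in> join r x y" for u v w
    using that unfolding J using S T by meson
  show "\<And>u v. (u, v) \<in> join r x y \<Longrightarrow> u \<in> A" unfolding J using nceq_dom[OF r] by blast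
  have side: "nsep b d u v"
    if "(b, d) \<in> r" "(u, b) \<notin> join r x y" "(u, v) \<in> join r x y" "(u, v) \<notin> r" for b d u v
  proof -
    have bxy: "(b, x) \<notin> r" "(b, y) \<notin> r" 
      using that R S T unfolding J by meson+
    have "nsep b d x y" using sep that bxy by blast
    from that(3,4) consider "(u, x) \<in> r" "(y, v) \<in> r" | "(u, y) \<in> r" "(x, v) \<in> r"
      unfolding J by blast
    then show ?thesis
    proof cases
      case 1
      have "nsep b d u x" "nsep b d y v"
        using nceq_nsep[OF r 1(1) that(1)] nceq_nsep[OF r 1(2) that(1)] bxy S T 1 by meson+
      then show ?thesis using \<open>nsep b d x y\<close> nsep_trans by blast
    next
      case 2
      have "nsep b d u y" "nsep b d x v"
        using nceq_nsep[OF r 2(1) that(1)] nceq_nsep[OF r 2(2) that(1)] bxy S T 2 by meson+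
      then show ?thesis using \<open>nsep b d x y\<close> unfolding nsep_def by blast
    qed
  qed
  show "nsep b d a c"
    if ac: "(a, c) \<in> join r x y" and bd: "(b, d) \<in> join r x y" and ab: "(a, b) \<notin> join r x y" for a b c d
  proof (cases "(b, d) \<in> r")
    case True
    show ?thesis
    proof (cases "(a, c) \<in> r")
      case True
      then show ?thesis using nceq_nsep[OF r True \<open>(b, d) \<in> r\<close>] ab subset_join by blast
    next
      case False
      then show ?thesis using side True ab ac by blast
    qed
  next
    case False
    then have bxy: "(b, x) \<in> r \<or> (b, y) \<in> r" using bd unfolding J by blast
    then have "(a, x) \<notin> r" "(a, y) \<notin> r" using ab S T R unfolding J by meson+
    then have "(a, c) \<in> r" using ac unfolding J by blast
    \<comment> \<open>Here the new pair plays the chord: \<open>side\<close> is applied with the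
      roles exchanged, and \<open>nsep_swap\<close> turns its result around.\<close>
    have "(b, a) \<notin> join r x y" using ab S unfolding J by blast
    then have "nsep a c b d" using side \<open>(a, c) \<in> r\<close> bd False by blast
    moreover have "a \<noteq> b" "a \<noteq> d" "c \<noteq> b" "c \<noteq> d"
      using \<open>(a, c) \<in> r\<close> \<open>(a, x) \<notin> r\<close> \<open>(a, y) \<notin> r\<close> bxy bd False S T unfolding J by meson+
    ultimately show ?thesis using nsep_swap by blast
  qed
qed

text \<open>A class outside the block of \<open>y\<close> in \<open>s\<close> cannot separate
  \<open>x\<close> from \<open>y\<close>, because \<open>s\<close> itself is noncrossing; only
  classes inside that block remain to be checked.\<close>

lemma nceq_join_within:
  assumes r: "nceq A r" and s: "nceq A s" and rs: "r \<subseteq> s" and xy: "(x, y) \<in> s"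
    and sep: "\<And>f f'. (f, f') \<in> r \<Longrightarrow> (f, y) \<in> s \<Longrightarrow> (f, x) \<notin> r \<Longrightarrow> (f, y) \<notin> r \<Longrightarrow> nsep f f' x y"
  shows "nceq A (join r x y)"
proof (rule nceq_join[OF r])
  show "x \<in> A" "y \<in> A" using xy s nceq_dom by blast+
  fix f f' assume f: "(f, f') \<in> r" "(f, x) \<notin> r" "(f, y) \<notin> r"
  show "nsep f f' x y"
  proof (cases "(f, y) \<in> s")
    case False
    then have "(x, f) \<notin> s" using xy nceq_sym[OF s] nceq_trans[OF s] by blast
    then show ?thesis using nceq_nsep[OF s xy, of f f'] f rs by blast
  qed (use f sep in blast)
qed

text \<open>A class minimum \<open>x\<close> of \<open>r\<close> that is not minimal in
  \<open>s\<close> is joined to its predecessor \<open>p\<close> in its block of \<open>s\<close>.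
  No element of the block lies between the two, so no class of \<open>r\<close> inside the block
  separates them.\<close>

lemma ex_join_within:
  assumes r: "nceq A r" and s: "nceq A s" and rs: "r \<subset> s"
  shows "\<exists>x y. (x, y) \<in> s \<and> (x, y) \<notin> r \<and> nceq A (join r x y)"
proof -
  obtain u v where uv: "(u, v) \<in> s" "(u, v) \<notin> r" using rs by auto
  define least where "least u = (LEAST w. (w, u) \<in> r)" for u
  have least: "(least u, u) \<in> r \<and> (\<forall>w<least u. (w, least u) \<notin> r)" if "u \<in> A" for u
    using LeastI[of "\<lambda>w. (w, u) \<in> r" u] not_less_Least[of _ "\<lambda>w. (w, u) \<in> r"]
      nceq_refl[OF r that] nceq_trans[OF r] unfolding least_def by blast
  have A: "u \<in> A" "v \<in> A" using uv(1) nceq_dom[OF s] by blast+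
  have ls: "(least u, least v) \<in> s"
    using least[OF A(1)] least[OF A(2)] rs uv nceq_sym[OF s] nceq_trans[OF s] by (meson psubsetD)
  have lr: "(least u, least v) \<notin> r"
    using least[OF A(1)] least[OF A(2)] uv nceq_sym[OF r] nceq_trans[OF r] by meson
  \<comment> \<open>Two distinct class minima of \<open>r\<close> lie in one block of
    \<open>s\<close>; the larger one serves as \<open>x\<close>.\<close>
  obtain x where x: "\<exists>w<x. (w, x) \<in> s" "\<forall>w<x. (w, x) \<notin> r"
    using least[OF A(1)] least[OF A(2)] ls lr nceq_sym[OF s] nceq_sym[OF r] 
      nceq_refl[OF r] nceq_dom[OF s] by (metis linorder_neqE_nat)
  define p where "p = Max {w. w < x \<and> (w, x) \<in> s}"
  have fin: "finite {w. w < x \<and> (w, x) \<in> s}" by auto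
  have p: "p < x" "(p, x) \<in> s" using Max_in[OF fin] x(1) unfolding p_def by blast+
  have pmax: "w \<le> p" if "w < x" "(w, x) \<in> s" for w
    using Max_ge[OF fin] that unfolding p_def by blast
  have "nceq A (join r p x)"
  proof (rule nceq_join_within[OF r s _ p(2)])
    show "r \<subseteq> s" using rs by blast
    fix f f' assume f: "(f, f') \<in> r" "(f, x) \<in> s" "(f, p) \<notin> r" "(f, x) \<notin> r"
    have A': "p \<in> A" "x \<in> A" using p(2) nceq_dom[OF s] by blast+
    have "(f', x) \<in> s" using f rs nceq_sym[OF s] nceq_trans[OF s] by blast
    moreover have "f \<noteq> p" "f \<noteq> x" "f' \<noteq> p" "f' \<noteq> x"
      using f nceq_refl[OF r A'(1)] nceq_refl[OF r A'(2)] nceq_sym[OF r] by blast+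
    ultimately have "(p < f) = (x < f)" "(p < f') = (x < f')"
      using pmax[of f] pmax[of f'] f(2) p(1) by linarith+
    then show "nsep f f' p x" by (simp add: nsep_def)
  qed
  then show ?thesis using p x(2) by blast
qed

text \<open>In cyclic order \<open>g\<close> is the last element of \<open>F\<close> before the gap
  of \<open>y\<close>: the largest one up to \<open>y\<close>, or the maximum of \<open>F\<close> if
  all of \<open>F\<close> lies beyond \<open>y\<close>.\<close>

lemma ex_facing:
  assumes "finite F" "F \<noteq> {}"
  obtains g where "g \<in> F" "\<And>f f'. f \<in> F \<Longrightarrow> f' \<in> F \<Longrightarrow> nsep f f' g y"
proof (cases "{f \<in> F. f \<le> y} = {}")
  case True
  have "Max F \<in> F" using assms by simp
  moreover have "nsep f f' (Max F) y" if "f \<in> F" "f' \<in> F" for f f'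
  proof -
    have "y < f" "y < f'" using True that by auto
    moreover have "f \<le> Max F" "f' \<le> Max F" using assms that by auto
    ultimately show ?thesis by (auto simp: nsep_def)
  qed
  ultimately show ?thesis using that by blast
next
  case False
  define g where "g = Max {f \<in> F. f \<le> y}"
  have fin: "finite {f \<in> F. f \<le> y}" using assms by simp
  have g: "g \<in> F" "g \<le> y" using Max_in[OF fin False] unfolding g_def by blast+
  have "(g < f) = (y < f)" if "f \<in> F" for f
  proof -
    have "f \<le> y \<Longrightarrow> f \<le> g" using Max_ge[OF fin, of f] that unfolding g_def by blast
    then show ?thesis using g(2) by linarith
  qed
  then show ?thesis using that g unfolding nsep_def by blast
qed

text \<open>The classes of \<open>pocket r s\<close> are the blocks of the Kreweras complement of \<open>r\<close> relative to \<open>s\<close>, an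
  element standing for the gap after it. Each pocket contains at most one element of each block
  of \<open>r\<close>, so \<open>p \<mapsto> p \<inter> K \<times> K\<close> is a bijection from the interval \<open>[r, s]\<close> to the product, over all
  pockets \<open>K\<close>, of the noncrossing partitions of \<open>K\<close>.\<close>

definition pocket :: "nat rel \<Rightarrow> nat rel \<Rightarrow> nat rel" where
  "pocket r s = {(x, y). (x, y) \<in> s \<and> (\<forall>w w'. (w, w') \<in> r \<longrightarrow> nsep w w' x y)}"

lemma pocketD: "(x, y) \<in> pocket r s \<Longrightarrow> (x, y) \<in> s"
  "(x, y) \<in> pocket r s \<Longrightarrow> (w, w') \<in> r \<Longrightarrow> nsep w w' x y"
  by (auto simp: pocket_def)

lemma equiv_pocket:
  assumes "nceq A s"
  shows "equiv A (pocket r s)"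
proof (intro equivI refl_onI symI transI)
  show "pocket r s \<subseteq> A \<times> A" using nceq_dom[OF assms] unfolding pocket_def by blast
  show "\<And>x. x \<in> A \<Longrightarrow> (x, x) \<in> pocket r s"
    using nceq_refl[OF assms] by (simp add: pocket_def)
  show "\<And>x y. (x, y) \<in> pocket r s \<Longrightarrow> (y, x) \<in> pocket r s"
    using nceq_sym[OF assms] nsep_sym(1) by (simp add: pocket_def)
  show "(x, z) \<in> pocket r s" if "(x, y) \<in> pocket r s" "(y, z) \<in> pocket r s" for x y z
    using nceq_trans[OF assms, of x y z] nsep_trans(1)[of _ _ x y z] that by (simp add: pocket_def)
qed

lemma pocket_sym: "nceq A s \<Longrightarrow> (x, y) \<in> pocket r s \<Longrightarrow> (y, x) \<in> pocket r s"
  using equiv_pocket[of A s r] by (auto simp: equiv_def dest: symD)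

lemma pocket_trans:
  "nceq A s \<Longrightarrow> (x, y) \<in> pocket r s \<Longrightarrow> (y, z) \<in> pocket r s \<Longrightarrow> (x, z) \<in> pocket r s"
  using equiv_pocket[of A s r] by (auto simp: equiv_def dest: transD)

text \<open>A chord of \<open>r\<close> separates the gaps after its own two ends.\<close>

lemma pocket_bottom:
  assumes "nceq A r" "(x, y) \<in> pocket r s" "(x, y) \<in> r"
  shows "x = y"
  using pocketD(2)[OF assms(2,3)] pocketD(2)[OF assms(2) nceq_sym[OF assms(1,3)]]
  by (auto simp: nsep_def)

lemma pocket_mono: "s \<subseteq> s' \<Longrightarrow> pocket r s \<subseteq> pocket r s'"
  by (auto simp: pocket_def)

text \<open>Injectivity of the restriction to pockets. Each \<open>v\<close> is connected to the
  minimum of its block of \<open>p\<close> by descending moves, each of which is a pair of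
  \<open>r\<close> or a pair of \<open>r\<close> followed by a pocket pair of \<open>p\<close>; all
  of these lie in \<open>q\<close>.\<close>

lemma subset_if_pocket_subset:
  assumes A: "finite A" and r: "nceq A r" and p: "nceq A p" and q: "nceq A q"
    and rp: "r \<subseteq> p" and rq: "r \<subseteq> q" and ps: "p \<subseteq> s" and sub: "p \<inter> pocket r s \<subseteq> q"
  shows "p \<subseteq> q"
proof -
  have down: "(v, LEAST w. (w, v) \<in> p) \<in> q" if "v \<in> A" for v
    using that
  proof (induction v rule: less_induct)
    case (less y)
    define M where "M v = (LEAST w. (w, v) \<in> p)" for v
    have M: "(M v, v) \<in> p" "\<And>w. (w, v) \<in> p \<Longrightarrow> M v \<le> w" if "v \<in> A" for v
      unfolding M_def using nceq_refl[OF p that] by (auto intro: LeastI Least_le)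
    have M_eq: "M u = M v" if "(u, v) \<in> p" for u v
    proof -
      have "(w, u) \<in> p \<longleftrightarrow> (w, v) \<in> p" for w using that nceq_sym[OF p] nceq_trans[OF p] by blast
      then show ?thesis unfolding M_def by simp
    qed
    have IH: "(u, M y) \<in> q" if "u < y" "(u, y) \<in> p" for u
      using less.IH[OF that(1)] nceq_dom[OF p that(2)] M_eq[OF that(2)] unfolding M_def by simp
    show ?case
    proof (cases "\<exists>u<y. (u, y) \<in> r")
      case True
      then obtain u where "u < y" "(u, y) \<in> r" by blast
      then show ?thesis
        using IH[of u] rp rq nceq_sym[OF q] nceq_trans[OF q] unfolding M_def by blast
    next
      case False
      show ?thesis
      proof (cases "M y = y")
        case True
        then show ?thesis using nceq_refl[OF q less.prems] unfolding M_def by simp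
      next
        case notmin: False
        \<comment> \<open>In this case \<open>y\<close> is the first and \<open>z\<close> the last
          element of a class of \<open>r\<close>, and \<open>x\<close> is the element just before
          \<open>y\<close> in its block of \<open>p\<close>. The gaps after \<open>x\<close> and
          \<open>z\<close> lie just before and just after the class, on the same side of every chord
          of \<open>r\<close>, so \<open>x\<close> and \<open>z\<close> share a pocket.\<close>
        define x where "x = Max {u. u < y \<and> (u, y) \<in> p}"
        define z where "z = Max (r `` {y})"
        have fin: "finite {u. u < y \<and> (u, y) \<in> p}" by auto
        have "M y < y" using notmin M(2)[OF less.prems nceq_refl[OF p less.prems]] by simp
        then have "{u. u < y \<and> (u, y) \<in> p} \<noteq> {}" using M(1)[OF less.prems] by blast
        then have x: "x < y" "(x, y) \<in> p" using Max_in[OF fin] unfolding x_def by blast+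
        have xmax: "u \<le> x" if "u < y" "(u, y) \<in> p" for u
          using Max_ge[OF fin] that unfolding x_def by blast
        have finr: "finite (r `` {y})" using A nceq_dom[OF r] by (meson Image_singleton_iff finite_subset subsetI)
        have z: "(y, z) \<in> r" using Max_in[OF finr] nceq_refl[OF r less.prems] unfolding z_def by blast
        have zmax: "u \<le> z" if "(y, u) \<in> r" for u
          using Max_ge[OF finr] that unfolding z_def by blast
        have xz: "(x, z) \<in> p" using x z rp nceq_trans[OF p] by blast
        have "nsep w w' x z" if w: "(w, w') \<in> r" for w w'
        proof -
          consider "(y, w) \<in> r" | "(y, w) \<notin> r" "(y, w) \<in> p" | "(y, w) \<notin> p" by blast
          then show ?thesis
          proof cases
            case 1
            then have "(y, w') \<in> r" using w nceq_trans[OF r] by blast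
            then have "y \<le> w" "y \<le> w'" "w \<le> z" "w' \<le> z" using 1 zmax False nceq_sym[OF r] not_le by blast+
            then show ?thesis using x(1) by (auto simp: nsep_def)
          next
            case 2
            have w': "(y, w') \<notin> r" "(y, w') \<in> p"
              using 2 w rp nceq_sym[OF r] nceq_trans[OF r] nceq_trans[OF p] by blast+
            have "(x < u) = (y < u)" if "(y, u) \<notin> r" "(y, u) \<in> p" for u
              using xmax[of u] that x(1) nceq_sym[OF p] nceq_refl[OF r less.prems]
              by (metis leD le_less_trans linorder_neqE_nat order_less_trans)
            moreover have "nsep w w' y z" using nceq_nsep[OF r z w] 2 by blast
            ultimately show ?thesis using 2 w' unfolding nsep_def by blast
          next
            case 3
            then have "(x, w) \<notin> p" using x nceq_sym[OF p] nceq_trans[OF p] by blast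
            then show ?thesis using nceq_nsep[OF p xz, of w w'] w rp by blast
          qed
        qed
        then have "(x, z) \<in> pocket r s" using xz ps by (auto simp: pocket_def)
        then have "(x, z) \<in> q" using xz sub by blast
        then have "(y, x) \<in> q" using z rq nceq_sym[OF q] nceq_trans[OF q] by blast
        then show ?thesis using IH[OF x] nceq_trans[OF q] unfolding M_def by blast
      qed
    qed
  qed
  show ?thesis
  proof (rule subrelI)
    fix u v assume uv: "(u, v) \<in> p"
    have "(w, u) \<in> p \<longleftrightarrow> (w, v) \<in> p" for w using uv nceq_sym[OF p] nceq_trans[OF p] by blast
    then show "(u, v) \<in> q"
      using down[OF nceq_dom(1)[OF p uv]] nceq_sym[OF q down[OF nceq_dom(2)[OF p uv]]] nceq_trans[OF q]
      by presburger
  qed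
qed

text \<open>If the block of \<open>g\<close> separates \<open>x\<close> from \<open>y\<close>, its element facing \<open>y\<close> lies in the pocket of \<open>y\<close>. Hence a
  crossing produced by joining \<open>x\<close> and \<open>y\<close> is already visible inside the pocket.\<close>

lemma pocket_facing:
  assumes s: "nceq A s" and p: "nceq A p" and rp: "r \<subseteq> p" and ps: "p \<subseteq> s"
    and xy: "(x, y) \<in> pocket r s"
    and ff': "(g, f) \<in> p" "(g, f') \<in> p" "\<not> nsep f f' x y"
    and facing: "\<And>f f'. (g, f) \<in> p \<Longrightarrow> (g, f') \<in> p \<Longrightarrow> nsep f f' g y"
  shows "(g, y) \<in> pocket r s"
proof -
  note Sp = nceq_sym[OF p] and Tp = nceq_trans[OF p]
  note Ss = nceq_sym[OF s] and Ts = nceq_trans[OF s]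
  have fps: "(f, f') \<in> s" using ff' Sp Tp ps by blast
  have "(x, f) \<in> s" using nceq_nsep[OF s pocketD(1)[OF xy] fps] ff'(3) by blast
  then have "(g, y) \<in> s" using ff'(1) ps pocketD(1)[OF xy] Ss Ts by (meson subsetD)
  moreover have "nsep w w' g y" if w: "(w, w') \<in> r" for w w'
  proof (cases "(g, w) \<in> p")
    case True
    then show ?thesis using facing w rp Tp by blast
  next
    case False
    have ww': "(w, w') \<in> p" using w rp by blast
    have out: "nsep w w' u v" if "(g, u) \<in> p" "(g, v) \<in> p" for u v
      using nceq_nsep[OF p _ ww', of u v] that False Sp Tp by blast
    have xy': "nsep w w' x y" using pocketD(2)[OF xy w] .
    show ?thesis
    proof (rule ccontr)
      assume "\<not> nsep w w' g y"
      moreover have "nsep w w' g f" using out nceq_refl[OF p nceq_dom(1)[OF p ff'(1)]] ff'(1) by blast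
      ultimately have "\<not> nsep w w' f x" using xy' nsep_trans(1) by blast
      moreover have "{w, w'} \<inter> {f, f'} = {}" using False ff' ww' Sp Tp by blast
      ultimately show False using nsep_third[OF out[OF ff'(1,2)] xy'] ff'(3) by blast
    qed
  qed
  ultimately show ?thesis by (auto simp: pocket_def)
qed

text \<open>The hypotheses put the gaps of \<open>g\<close> and \<open>g'\<close> on the same side
  of the chord \<open>g g'\<close>, which is possible only for \<open>g = g'\<close>; this common
  element faces both \<open>x\<close> and \<open>y\<close>.\<close>

lemma facing_both:
  assumes "\<And>f f'. f \<in> F \<Longrightarrow> f' \<in> F \<Longrightarrow> nsep f f' g y" 
    and "\<And>f f'. f \<in> F \<Longrightarrow> f' \<in> F \<Longrightarrow> nsep f f' g' x"
    and "g \<in> F" "g' \<in> F" "nsep g g' x y" "f \<in> F" "f' \<in> F"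
  shows "nsep f f' x y"
proof -
  have a: "nsep f f' g y" "nsep f f' g' x" "nsep g g' g y" "nsep g g' g' x"
    using assms by blast+
  have "g = g'" using a(3,4) assms(5) unfolding nsep_def by (metis linorder_less_linear order_less_irrefl order_less_asym)
  then show ?thesis using a nsep_sym nsep_trans(1) by blast
qed

text \<open>For the first conclusion, the members of a separating class that face \<open>x\<close>
  and \<open>y\<close> both lie in \<open>K\<close>, so the join inside \<open>K\<close> would
  already be crossing. The second makes the pockets independent: a join in one of them creates no
  pair inside another.\<close>

lemma nceq_join_pocket:
  assumes A: "finite A" and s: "nceq A s" and p: "nceq A p" and rp: "r \<subseteq> p" and ps: "p \<subseteq> s"
    and xy: "(x, y) \<in> pocket r s" "(x, y) \<notin> p"
    and K: "K = pocket r s `` {x}" and J: "nceq K (join (p \<inter> K \<times> K) x y)"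
  shows "nceq A (join p x y)"
    and "join p x y \<inter> pocket r s \<subseteq> join (p \<inter> pocket r s) x y"
proof -
  note Sp = nceq_sym[OF p] and Tp = nceq_trans[OF p] and Dp = nceq_dom[OF p] and Rp = nceq_refl[OF p]
  note SK = pocket_sym[OF s, of _ _ r] and TK = pocket_trans[OF s, of _ _ r]
  have xA: "x \<in> A" "y \<in> A" using xy(1) pocketD(1) nceq_dom[OF s] by blast+
  have xx: "(x, x) \<in> pocket r s" using xy(1) SK TK by blast
  have KA: "K \<subseteq> A" unfolding K using pocketD(1) nceq_dom[OF s] by blast
  have xK: "x \<in> K" "y \<in> K" using xx xy K by blast+
  have fin: "finite (p `` {u})" for u
    using A Dp by (meson Image_singleton_iff finite_subset subsetI)
  have facing: "\<exists>g. (u, g) \<in> p \<and> (\<forall>f f'. (u, f) \<in> p \<longrightarrow> (u, f') \<in> p \<longrightarrow> nsep f f' g v)"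
    if u: "u \<in> A" for u v
  proof -
    have ne: "p `` {u} \<noteq> {}" using Rp u by blast
    obtain g where "g \<in> p `` {u}" "\<And>f f'. f \<in> p `` {u} \<Longrightarrow> f' \<in> p `` {u} \<Longrightarrow> nsep f f' g v"
      using ex_facing[OF fin ne, where y = v] by metis
    then show ?thesis by blast
  qed
  show "nceq A (join p x y)"
  proof (rule nceq_join[OF p xA])
    fix f f' assume f: "(f, f') \<in> p" "(f, x) \<notin> p" "(f, y) \<notin> p"
    show "nsep f f' x y"
    proof (rule ccontr)
      assume sep: "\<not> nsep f f' x y"
      have fA: "f \<in> A" "(f, f) \<in> p" using f Dp Rp by blast+
      obtain g where g: "(f, g) \<in> p" 
        "\<And>h h'. (f, h) \<in> p \<Longrightarrow> (f, h') \<in> p \<Longrightarrow> nsep h h' g y" using facing[OF fA(1)] by blast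
      obtain g' where g': "(f, g') \<in> p" 
        "\<And>h h'. (f, h) \<in> p \<Longrightarrow> (f, h') \<in> p \<Longrightarrow> nsep h h' g' x" using facing[OF fA(1)] by blast
      have gy: "(g, y) \<in> pocket r s"
      proof (rule pocket_facing[OF s p rp ps xy(1) _ _ sep])
        show "(g, f) \<in> p" "(g, f') \<in> p" using g(1) f Sp Tp by blast+
        show "nsep h h' g y" if "(g, h) \<in> p" "(g, h') \<in> p" for h h'
          using g that Tp by blast
      qed
      have g'x: "(g', x) \<in> pocket r s"
      proof (rule pocket_facing[OF s p rp ps SK[OF xy(1)]])
        show "(g', f) \<in> p" "(g', f') \<in> p" using g'(1) f Sp Tp by blast+
        show "\<not> nsep f f' y x" using sep nsep_sym by blast
        show "nsep h h' g' x" if "(g', h) \<in> p" "(g', h') \<in> p" for h h'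
          using g' that Tp by blast
      qed
      have gK: "g \<in> K" "g' \<in> K" using gy g'x xy(1) SK TK K by blast+
      have pK: "nceq K (p \<inter> K \<times> K)" using nceq_restrict[OF p KA] .
      have xg: "(x, g) \<notin> p" "(g, g') \<in> p" "(y, g) \<notin> p"
        using g(1) g'(1) f Sp Tp by blast+
      have "(x, g) \<notin> join (p \<inter> K \<times> K) x y"
        unfolding join_iff[OF pK] using xg xy(2) by blast
      moreover have "(g, g') \<in> join (p \<inter> K \<times> K) x y"
        using xg gK subset_join[of "p \<inter> K \<times> K" x y] by blast
      ultimately have "nsep g g' x y"
        using nceq_nsep[OF J join_self[OF pK xK]] by blast
      then have "nsep f f' x y"
        using facing_both[of "p `` {f}" g y g' x f f'] g g' f fA by blast
      then show False using sep by blast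
    qed
  qed
  \<comment> \<open>The element \<open>g\<close> of the class of \<open>x\<close> facing
    \<open>y\<close> shares a pocket with \<open>y\<close>, and by the same argument with
    \<open>v\<close>; hence \<open>v\<close> lies in the pocket of \<open>y\<close>, and
    \<open>u\<close> with it.\<close>
  have key: "(u, x) \<in> pocket r s \<and> (v, y) \<in> pocket r s"
    if uv: "(u, v) \<in> pocket r s" "(u, x) \<in> p" "(v, y) \<in> p" for u v
  proof -
    obtain g where g: "(x, g) \<in> p" 
        "\<And>h h'. (x, h) \<in> p \<Longrightarrow> (x, h') \<in> p \<Longrightarrow> nsep h h' g y" using facing[OF xA(1)] by blast
    have face: "(g, w) \<in> pocket r s" if z: "(z, w) \<in> pocket r s" "(x, z) \<in> p" and w: "(y, w) \<in> p" for z w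
    proof -
      have xyw: "(y, x) \<notin> p" using xy(2) Sp by blast
      have gw: "nsep h h' g w" if h: "(x, h) \<in> p" "(x, h') \<in> p" for h h'
      proof -
        have "nsep h h' y w" using nceq_nsep[OF p w, of h h'] h xyw Sp Tp by blast
        then show ?thesis using g(2)[OF h] nsep_trans(1) by blast
      qed
      show ?thesis
      proof (cases "\<exists>h h'. (x, h) \<in> p \<and> (x, h') \<in> p \<and> \<not> nsep h h' z w")
        case True
        then obtain h h' where h: "(x, h) \<in> p" "(x, h') \<in> p" "\<not> nsep h h' z w" by blast
        have "(g, h) \<in> p" "(g, h') \<in> p" using h g(1) Sp Tp by blast+
        then show ?thesis using pocket_facing[OF s p rp ps z(1) _ _ h(3)] gw g(1) Tp by blast
      next
        case False
        then have "nsep g z z w" "nsep g z g w" using g(1) z(2) gw by blast+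
        then have "nsep g z z g" using nsep_sym nsep_trans(1) by blast
        then have "g = z" by (auto simp: nsep_def)
        then show ?thesis using z(1) by simp
      qed
    qed
    have gy: "(g, y) \<in> pocket r s" using face[of x y] xy(1) Rp[OF xA(1)] Rp[OF xA(2)] by blast
    have gv: "(g, v) \<in> pocket r s" using face[of u v] uv Sp by blast
    have "(v, y) \<in> pocket r s" using gy gv SK TK by blast
    then show ?thesis using uv(1) xy(1) SK TK by blast
  qed
  show "join p x y \<inter> pocket r s \<subseteq> join (p \<inter> pocket r s) x y"
  proof (rule subrelI)
    fix u v assume "(u, v) \<in> join p x y \<inter> pocket r s"
    then have uv: "(u, v) \<in> pocket r s" and J: "(u, v) \<in> join p x y" by blast+
    have "(u, v) \<in> p \<or> (u, x) \<in> p \<and> (v, y) \<in> p \<or> (u, y) \<in> p \<and> (v, x) \<in> p"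
      using J Sp unfolding join_iff[OF p] by blast
    then show "(u, v) \<in> join (p \<inter> pocket r s) x y"
      using key[OF uv] key[OF SK[OF uv]] uv SK Sp unfolding join_def by blast
  qed
qed
text \<open>Surjectivity of the restriction to pockets. A maximal \<open>p\<close> whose pocket
  pairs lie in \<open>\<rho>\<close> attains all of \<open>\<rho>\<close>: otherwise a noncrossing
  join inside one pocket, provided by \<open>ex_join_within\<close>, would enlarge it.\<close>

lemma ex_nceq_pocket:
  assumes A: "finite A" and r: "nceq A r" and s: "nceq A s" and rs: "r \<subseteq> s"
    and e: "equiv A \<rho>" and sub: "\<rho> \<subseteq> pocket r s"
    and nc: "\<And>K. K \<in> A // pocket r s \<Longrightarrow> nceq K (\<rho> \<inter> K \<times> K)"
  obtains p where "nceq A p" "r \<subseteq> p" "p \<subseteq> s" "p \<inter> pocket r s = \<rho>"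
proof -
  define S where "S = {p. nceq A p \<and> r \<subseteq> p \<and> p \<subseteq> s \<and> p \<inter> pocket r s \<subseteq> \<rho>}"
  have refl\<rho>: "(x, x) \<in> \<rho>" if "x \<in> A" for x using e that by (auto simp: equiv_def refl_on_def)
  have "r \<inter> pocket r s \<subseteq> \<rho>"
  proof (rule subrelI)
    fix x y assume "(x, y) \<in> r \<inter> pocket r s"
    then have "x = y" "x \<in> A" using pocket_bottom[OF r] nceq_dom[OF r] by blast+
    then show "(x, y) \<in> \<rho>" using refl\<rho> by simp
  qed
  then have "r \<in> S" using r rs by (simp add: S_def)
  moreover have "finite S"
  proof (rule finite_subset)
    show "S \<subseteq> Pow (A \<times> A)"
      unfolding S_def nceq_def equiv_def by blast
    show "finite (Pow (A \<times> A))" using A by simp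
  qed
  ultimately obtain p where pS: "p \<in> S" and pmax: "\<And>q. q \<in> S \<Longrightarrow> p \<subseteq> q \<Longrightarrow> q = p"
    using finite_has_maximal[of S] by blast
  then have p: "nceq A p" "r \<subseteq> p" "p \<subseteq> s" "p \<inter> pocket r s \<subseteq> \<rho>" by (auto simp: S_def)
  have "\<rho> \<subseteq> p"
  proof (rule ccontr)
    assume "\<not> \<rho> \<subseteq> p"
    then obtain u v where uv: "(u, v) \<in> \<rho>" "(u, v) \<notin> p" by auto
    define K where "K = pocket r s `` {u}"
    have u: "u \<in> A" using uv e by (auto simp: equiv_def)
    have K: "K \<in> A // pocket r s" using u unfolding K_def by (rule quotientI)
    have KA: "K \<subseteq> A" using K equiv_pocket[OF s] by (meson in_quotient_imp_subset)
    have uK: "u \<in> K" "v \<in> K"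
      using u equiv_class_self[OF equiv_pocket[OF s]] uv sub unfolding K_def by blast+
    have KK: "(a, b) \<in> pocket r s" if "a \<in> K" "b \<in> K" for a b
      using that pocket_sym[OF s] pocket_trans[OF s] unfolding K_def by blast
    have "p \<inter> K \<times> K \<subset> \<rho> \<inter> K \<times> K" using uv uK p(4) KK by blast
    then obtain x y where xy: "(x, y) \<in> \<rho> \<inter> K \<times> K" "(x, y) \<notin> p \<inter> K \<times> K"
        "nceq K (join (p \<inter> K \<times> K) x y)"
      using ex_join_within[OF nceq_restrict[OF p(1) KA] nc[OF K]] by blast
    have xy': "(x, y) \<in> pocket r s" "(x, y) \<notin> p" using xy KK by blast+
    have K': "K = pocket r s `` {x}" 
      using xy(1) pocket_sym[OF s] pocket_trans[OF s] unfolding K_def by blast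
    note J = nceq_join_pocket[OF A s p(1-3) xy' K' xy(3)]
    have "join p x y \<inter> pocket r s \<subseteq> \<rho>"
    proof (rule order_trans[OF J(2)], rule subrelI)
      fix a b assume "(a, b) \<in> join (p \<inter> pocket r s) x y"
      then have "(a, b) \<in> \<rho> \<or> (x, a) \<in> \<rho> \<and> (y, b) \<in> \<rho> \<or> (y, a) \<in> \<rho> \<and> (x, b) \<in> \<rho>"
        using p(4) unfolding join_def by blast
      then show "(a, b) \<in> \<rho>" using xy(1) e unfolding equiv_def
        by (meson IntD1 symD transD)
    qed
    moreover have "join p x y \<subseteq> s" using join_subset[OF p(1) s p(3)] xy' pocketD(1) by blast
    ultimately have "join p x y \<in> S" using J(1) p(2) subset_join unfolding S_def by blast
    then have "join p x y = p" using pmax subset_join by blast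
    then show False using join_self[OF p(1), of x y] xy KA xy'(2) by blast
  qed
  then show ?thesis using that p sub by blast
qed

section \<open>Convex hulls and partitions\<close>

lemma pi_mult_divide_le:
  fixes x y m :: real
  assumes "m > 0"
  shows "pi * x / m < pi * y / m \<longleftrightarrow> x < y" "pi * x / m \<le> pi * y / m \<longleftrightarrow> x \<le> y"
    "pi * x / m \<le> pi \<longleftrightarrow> x \<le> m" "0 \<le> pi * x / m \<longleftrightarrow> 0 \<le> x"
  proof -
  show le: "pi * x / m \<le> pi * y / m \<longleftrightarrow> x \<le> y" for x y
    using assms by (simp add: divide_le_cancel)
  show "pi * x / m < pi * y / m \<longleftrightarrow> x < y" "pi * x / m \<le> pi \<longleftrightarrow> x \<le> m" "0 \<le> pi * x / m \<longleftrightarrow> 0 \<le> x"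
    using le[of y x] le[of x m] le[of 0 x] assms by (simp_all add: not_le[symmetric])
qed

lemma cos_pi_div_less:
  fixes d e m :: real
  assumes "0 \<le> e" "e < d" "d < 2 * m - e" "e \<le> m"
  shows "cos (pi * d / m) < cos (pi * e / m)"
proof (cases "d \<le> m")
  case True
  then show ?thesis using assms
    by (intro cos_monotone_0_pi) (auto simp: pi_mult_divide_le)
next
  case False
  have m: "m > 0" using assms by linarith
  have "cos (pi * d / m) = cos (2 * pi - pi * d / m)" by (simp add: cos_diff)
  also have "2 * pi - pi * d / m = pi * (2 * m - d) / m" using m by (simp add: field_simps)
  also have "cos (pi * (2 * m - d) / m) < cos (pi * e / m)"
    using assms m False by (intro cos_monotone_0_pi) (auto simp: pi_mult_divide_le)
  finally show ?thesis .
qed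

text \<open>The chord from \<open>a\<close> to \<open>c\<close> is the line \<open>chord_normal m a c \<bullet> z = cos (pi * (c - a) / m)\<close>; for \<open>a = c\<close> it
  is the tangent.\<close>

definition chord_normal :: "nat \<Rightarrow> nat \<Rightarrow> nat \<Rightarrow> complex" where
  "chord_normal m a c = cis (- (pi * (real a + real c) / real m))"

lemma circle_point_inner:
  assumes "m > 0"
  shows "chord_normal m a c \<bullet> circle_point m x = cos (pi * \<bar>real a + real c - 2 * real x\<bar> / real m)"
proof -
  have "chord_normal m a c \<bullet> circle_point m x
      = cos (- (pi * (real a + real c) / real m) - - (2 * pi * real x / real m))"
    unfolding chord_normal_def circle_point_def inner_complex_def cos_diff by simp
  also have "\<dots> = cos (- (pi * (real a + real c - 2 * real x) / real m))"
    by (simp add: field_simps diff_divide_distrib)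
  also have "\<dots> = cos \<bar>- (pi * (real a + real c - 2 * real x) / real m)\<bar>"
    by (rule cos_abs_real[symmetric])
  also have "\<bar>- (pi * (real a + real c - 2 * real x) / real m)\<bar>
      = pi * \<bar>real a + real c - 2 * real x\<bar> / real m"
    by (simp add: abs_mult)
  finally show ?thesis .
qed

lemma circle_point_chord:
  assumes "1 \<le> a" "a \<le> c" "c \<le> m" "1 \<le> x" "x \<le> m"
  defines "h \<equiv> cos (pi * (real c - real a) / real m)"
  shows "a \<le> x \<Longrightarrow> x \<le> c \<Longrightarrow> h \<le> chord_normal m a c \<bullet> circle_point m x"
    and "a < x \<Longrightarrow> x < c \<Longrightarrow> h < chord_normal m a c \<bullet> circle_point m x"
    and "x < a \<or> c < x \<Longrightarrow> chord_normal m a c \<bullet> circle_point m x < h"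
proof -
  let ?d = "\<bar>real a + real c - 2 * real x\<bar>"
  have m: "m > 0" using assms by linarith
  have e: "real c - real a \<le> real m" "0 \<le> real c - real a" using assms by linarith+
  note inner = circle_point_inner[OF m, of a c x]
  show "h \<le> chord_normal m a c \<bullet> circle_point m x" if "a \<le> x" "x \<le> c"
  proof -
    have "?d \<le> real c - real a" using that by linarith
    then show ?thesis unfolding inner h_def using e m
      by (intro cos_monotone_0_pi_le) (auto simp: pi_mult_divide_le)
  qed
  show "h < chord_normal m a c \<bullet> circle_point m x" if "a < x" "x < c"
  proof -
    have "?d < real c - real a" using that by linarith
    then show ?thesis unfolding inner h_def using e
      by (intro cos_pi_div_less) auto
  qed
  show "chord_normal m a c \<bullet> circle_point m x < h" if "x < a \<or> c < x"
  proof -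
    have "real c - real a < ?d" "?d < 2 * real m - (real c - real a)" using that assms by linarith+
    then show ?thesis unfolding inner h_def using e
      by (intro cos_pi_div_less) auto
  qed
qed

text \<open>The line of the chord from \<open>a\<close> to \<open>c\<close> has the points of the
  range on its closed side and all remaining points strictly beyond it.\<close>

lemma disjnt_hull_if_outside:
  assumes "1 \<le> a" "a \<le> c" "c \<le> m" "B \<subseteq> {a..c}" "C \<subseteq> {1..m}" "C \<inter> {a..c} = {}"
  shows "disjnt (convex hull (circle_point m ` B)) (convex hull (circle_point m ` C))"
proof -
  let ?u = "chord_normal m a c" and ?h = "cos (pi * (real c - real a) / real m)"
  have "convex hull (circle_point m ` B) \<subseteq> {z. ?u \<bullet> z \<ge> ?h}"
    using assms by (intro hull_minimal convex_halfspace_ge) (auto intro!: circle_point_chord(1))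
  moreover have "convex hull (circle_point m ` C) \<subseteq> {z. ?u \<bullet> z < ?h}"
  proof (intro hull_minimal convex_halfspace_lt image_subsetI)
    fix x assume "x \<in> C"
    then have "x < a \<or> c < x" "1 \<le> x" "x \<le> m" using assms by force+
    then show "circle_point m x \<in> {z. ?u \<bullet> z < ?h}" using assms circle_point_chord(3) by simp
  qed
  ultimately show ?thesis unfolding disjnt_iff by force
qed

text \<open>\<open>b\<close> and \<open>d\<close> lie on different sides of the line through
  \<open>a\<close> and \<open>c\<close>, so the segment between them meets this line in a point
  \<open>q\<close>. Being in the unit disc, \<open>q\<close> lies on the chord, which is the
  intersection of line and disc.\<close>

lemma crossing_chords_meet:
  assumes "1 \<le> a" "a < b" "b < c" "c < d" "d \<le> m"
  shows "\<exists>q. q \<in> convex hull {circle_point m a, circle_point m c} \<and>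
             q \<in> convex hull {circle_point m b, circle_point m d}"
proof -
  define u where "u = chord_normal m a c"
  define \<delta> where "\<delta> = pi * (real c - real a) / real m"
  let ?h = "cos \<delta>"
  have m: "real m > 0" "c - a < m" using assms by linarith+
  have \<delta>: "0 < \<delta>" "\<delta> < pi" unfolding \<delta>_def using assms m pi_mult_divide_le(1)[of "real m" 0 "real c - real a"]
      pi_mult_divide_le(1)[of "real m" "real c - real a" "real m"] by auto
  then have s: "sin \<delta> > 0" by (rule sin_gt_zero)
  define lb ld where "lb = u \<bullet> circle_point m b" and "ld = u \<bullet> circle_point m d"
  have lb: "lb > ?h" and ld: "ld < ?h"
    using assms circle_point_chord(2)[of a c m b] circle_point_chord(3)[of a c m d]
    unfolding lb_def ld_def u_def \<delta>_def by auto
  define t where "t = (lb - ?h) / (lb - ld)"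
  have t: "0 \<le> t" "t \<le> 1" using lb ld unfolding t_def by (auto simp: field_simps)
  have "t * (lb - ld) = lb - ?h" using lb ld unfolding t_def by simp
  then have tl: "(1 - t) * lb + t * ld = ?h" by (simp add: algebra_simps)
  define q where "q = (1 - t) *\<^sub>R circle_point m b + t *\<^sub>R circle_point m d"
  have q_bd: "q \<in> convex hull {circle_point m b, circle_point m d}"
    unfolding segment_convex_hull[symmetric] closed_segment_def q_def using t by auto
  have "circle_point m x \<in> cball 0 1" for x by (simp add: circle_point_def)
  then have "convex hull {circle_point m b, circle_point m d} \<subseteq> cball 0 1"
    by (intro hull_minimal) auto
  then have "norm q \<le> 1" using q_bd by auto
  have uq: "u \<bullet> q = ?h" using tl unfolding q_def lb_def ld_def by (simp add: inner_add_right)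
  \<comment> \<open>Rotation by the conjugate of \<open>u\<close> makes the chord vertical with ends
    \<open>cis \<delta>\<close> and \<open>cis (- \<delta>)\<close>. The real part of
    \<open>z\<close> is then fixed, and its imaginary part determines the weight
    \<open>w\<close>.\<close>
  define z where "z = q * cnj u"
  have normu: "u * cnj u = 1" unfolding u_def chord_normal_def by (simp add: cis_cnj cis_mult)
  have "norm u = 1" by (simp add: u_def chord_normal_def)
  then have "norm z \<le> 1" using \<open>norm q \<le> 1\<close> by (simp add: z_def norm_mult)
  have Rez: "Re z = ?h" using uq by (simp add: z_def inner_complex_def algebra_simps)
  have "(Re z)\<^sup>2 + (Im z)\<^sup>2 \<le> 1" using \<open>norm z \<le> 1\<close> by (simp add: cmod_def)
  then have "(Im z)\<^sup>2 \<le> (sin \<delta>)\<^sup>2" unfolding Rez using sin_cos_squared_add[of \<delta>] by linarith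
  then have im: "\<bar>Im z\<bar> \<le> sin \<delta>" using s by (simp add: abs_le_square_iff[symmetric])
  define w where "w = (1 + Im z / sin \<delta>) / 2"
  have "- 1 \<le> Im z / sin \<delta>" "Im z / sin \<delta> \<le> 1" using im s by (auto simp: field_simps)
  then have w: "0 \<le> w" "w \<le> 1" unfolding w_def by auto
  have "- (2 * pi * real a / real m) = - (pi * (real a + real c) / real m) + \<delta>"
    "- (2 * pi * real c / real m) = - (pi * (real a + real c) / real m) + - \<delta>"
    unfolding \<delta>_def by (simp_all add: distrib_left right_diff_distrib add_divide_distrib diff_divide_distrib)
  then have pa: "circle_point m a = u * cis \<delta>" and pc: "circle_point m c = u * cis (- \<delta>)"
    unfolding u_def chord_normal_def circle_point_def cis_mult by simp_all
  have "z = w *\<^sub>R cis \<delta> + (1 - w) *\<^sub>R cis (- \<delta>)"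
    using Rez s by (simp add: complex_eq_iff w_def field_simps)
  then have "q = u * (w *\<^sub>R cis \<delta> + (1 - w) *\<^sub>R cis (- \<delta>))"
    using normu unfolding z_def by (metis mult.commute mult.left_commute mult.right_neutral)
  then have "q = (1 - (1 - w)) *\<^sub>R circle_point m a + (1 - w) *\<^sub>R circle_point m c"
    unfolding pa pc by (simp add: algebra_simps)
  then have "q \<in> convex hull {circle_point m a, circle_point m c}"
    unfolding segment_convex_hull[symmetric] closed_segment_def using w
    by (auto intro!: exI[of _ "1 - w"])
  then show ?thesis using q_bd by blast
qed

definition brel :: "nat set set \<Rightarrow> nat rel" where
  "brel P = {(x, y). \<exists>B\<in>P. x \<in> B \<and> y \<in> B}"

lemma brel_block:
  assumes "partition_on A P" "B \<in> P" "x \<in> B"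
  shows "(x, y) \<in> brel P \<longleftrightarrow> y \<in> B"
  using assms unfolding brel_def partition_on_def disjoint_def by blast

text \<open>A crossing pair of chords forces two hulls to meet. Conversely, of two blocks that do
  not cross, one avoids the range between minimum and maximum of the other, and a chord line
  separates their hulls.\<close>

lemma noncrossing_partitions_iff:
  "P \<in> noncrossing_partitions m \<longleftrightarrow> partition_on {1..m} P \<and> nceq {1..m} (brel P)"
proof (cases "partition_on {1..m} P")
  case True
  note P = True
  let ?H = "\<lambda>B. convex hull (circle_point m ` B)"
  have sub: "B \<subseteq> {1..m}" "B \<noteq> {}" if "B \<in> P" for B
    using P that unfolding partition_on_def by blast+
  have disj: "B \<inter> C = {}" if "B \<in> P" "C \<in> P" "B \<noteq> C" for B C
    using P that unfolding partition_on_def disjoint_def by blast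
  have "pairwise (\<lambda>B C. disjnt (?H B) (?H C)) P \<longleftrightarrow>
    (\<forall>a b c d. (a, c) \<in> brel P \<longrightarrow> (b, d) \<in> brel P \<longrightarrow> (a, b) \<notin> brel P \<longrightarrow> nsep b d a c)"
    (is "?L = ?R")
  proof
    assume L: ?L
    have cross: False if B: "B \<in> P" and C: "C \<in> P" and "B \<noteq> C"
      and el: "a \<in> B" "c \<in> B" "b \<in> C" "d \<in> C" and less: "a < b" "b < c" "c < d" for B C a b c d
    proof -
      have "1 \<le> a" "d \<le> m" using sub B C el by force+
      then obtain q where "q \<in> convex hull {circle_point m a, circle_point m c}"
         "q \<in> convex hull {circle_point m b, circle_point m d}"
        using crossing_chords_meet less by blast
      moreover have "convex hull {circle_point m a, circle_point m c} \<subseteq> ?H B"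
         "convex hull {circle_point m b, circle_point m d} \<subseteq> ?H C"
        using el by (auto intro!: hull_mono)
      ultimately show False using L B C \<open>B \<noteq> C\<close> unfolding pairwise_def disjnt_iff by blast
    qed
    show ?R
    proof (intro allI impI)
      fix a b c d assume "(a, c) \<in> brel P" "(b, d) \<in> brel P" "(a, b) \<notin> brel P"
      then obtain B C where BC: "B \<in> P" "C \<in> P" "B \<noteq> C" "a \<in> B" "c \<in> B" "b \<in> C" "d \<in> C"
        unfolding brel_def by blast
      have neq: "a \<noteq> b" "a \<noteq> d" "c \<noteq> b" "c \<noteq> d" using BC disj by blast+
      have C1: "\<not> (x < y \<and> y < z \<and> z < w)" if "x \<in> B" "z \<in> B" "y \<in> C" "w \<in> C" for x y z w
        using cross[of B C] BC that by blast
      have C2: "\<not> (x < y \<and> y < z \<and> z < w)" if "x \<in> C" "z \<in> C" "y \<in> B" "w \<in> B" for x y z w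
        using cross[of C B] BC that by blast
      show "nsep b d a c"
        using neq C1[of a c b d] C1[of c a b d] C1[of a c d b] C1[of c a d b]
          C2[of b d a c] C2[of b d c a] C2[of d b a c] C2[of d b c a] BC(4-7)
        unfolding nsep_def by (smt (verit) linorder_neqE_nat order_less_trans)
    qed
  next
    assume R: ?R
    show ?L
    proof (rule pairwiseI)
      have half: "disjnt (?H B) (?H C)"
        if BC: "B \<in> P" "C \<in> P" "B \<noteq> C" and out: "C \<inter> {Min B..Max B} = {}" for B C
      proof -
        have fin: "finite B" using sub BC finite_subset by blast
        have "Min B \<in> {1..m}" "Max B \<in> {1..m}" using Min_in[OF fin] Max_in[OF fin] sub BC by blast+
        moreover have "Min B \<le> Max B" using Min_in[OF fin] Max_ge[OF fin] sub BC by blast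
        moreover have "B \<subseteq> {Min B..Max B}" using fin by auto
        ultimately show ?thesis using out sub BC by (intro disjnt_hull_if_outside) auto
      qed
      fix B C assume BC: "B \<in> P" "C \<in> P" "B \<noteq> C"
      have fin: "finite B" "finite C" using sub BC finite_subset by blast+
      have mm: "Min B \<in> B" "Max B \<in> B" "Min C \<in> C" "Max C \<in> C" using Min_in[OF fin(1)] Max_in[OF fin(1)] Min_in[OF fin(2)] Max_in[OF fin(2)] sub(2) BC(1,2) by blast+
      have ns: "nsep y w x z" "nsep x z y w" if "x \<in> B" "z \<in> B" "y \<in> C" "w \<in> C" for x y z w
      proof -
        have "x \<notin> C" "y \<notin> B" using that disj[OF BC] by blast+
        then have "(x, z) \<in> brel P" "(y, w) \<in> brel P" "(x, y) \<notin> brel P" "(y, x) \<notin> brel P"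
          using brel_block[OF P BC(1) that(1)] brel_block[OF P BC(2) that(3)] that by simp_all
        then show "nsep y w x z" "nsep x z y w" using R by blast+
      qed
      have "C \<inter> {Min B..Max B} = {} \<or> B \<inter> {Min C..Max C} = {}"
      proof (rule ccontr)
        assume "\<not> ?thesis"
        then obtain y x where y: "y \<in> C" "Min B \<le> y" "y \<le> Max B" and x: "x \<in> B" "Min C \<le> x" "x \<le> Max C"
          by auto
        have neq: "u \<noteq> v" if "u \<in> B" "v \<in> C" for u v using disj[OF BC] that by blast
        have "nsep y (Min C) (Min B) (Max B)" "nsep x (Min B) (Min C) (Max C)"
          using ns mm x y by blast+
        moreover have "Min B < y" "\<not> Max B < y" "Min C < x" "\<not> Max C < x"
          using neq[OF mm(1) y(1)] neq[OF x(1) mm(3)] x y by linarith+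
        ultimately have "Min B < Min C" "Min C < Min B"
          using x y unfolding nsep_def by (metis le_trans not_le)+
        then show False by simp
      qed
      then show "disjnt (?H B) (?H C)" using half[of B C] half[of C B] BC by (auto simp: disjnt_sym)
    qed
  qed
  then show ?thesis using P equiv_partition_on[OF P]
    unfolding noncrossing_partitions_def nceq_def brel_def by simp
qed (auto simp: noncrossing_partitions_def)

lemma refines_iff_brel:
  assumes "partition_on A P" "partition_on A Q"
  shows "refines A P Q \<longleftrightarrow> brel P \<subseteq> brel Q"
proof
  assume "refines A P Q"
  then have "\<forall>X\<in>P. \<exists>Y\<in>Q. X \<subseteq> Y" by (simp add: refines_def)
  then show "brel P \<subseteq> brel Q" unfolding brel_def by (intro subrelI) (simp, meson subsetD)
next
  assume sub: "brel P \<subseteq> brel Q"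
  have "\<exists>Y\<in>Q. X \<subseteq> Y" if X: "X \<in> P" for X
  proof -
    have "X \<noteq> {}" using X assms(1) unfolding partition_on_def by blast
    then obtain x where x: "x \<in> X" by blast
    then obtain Y where Y: "Y \<in> Q" "x \<in> Y" using X assms unfolding partition_on_def by blast
    have "X \<subseteq> Y"
      using brel_block[OF assms(1) X x] brel_block[OF assms(2) Y] sub by auto
    then show ?thesis using Y by blast
  qed
  then show "refines A P Q" using assms unfolding refines_def by blast
qed

lemma NC_poset_iff:
  "(P, Q) \<in> NC_poset m \<longleftrightarrow>
     P \<in> noncrossing_partitions m \<and> Q \<in> noncrossing_partitions m \<and> brel P \<subseteq> brel Q"
  using refines_iff_brel[of "{1..m}" P Q] noncrossing_partitions_iff
  unfolding NC_poset_def by blast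

lemma brel_quotient:
  assumes "equiv A r"
  shows "brel (A // r) = r"
proof -
  have "(x, y) \<in> brel (A // r) \<longleftrightarrow> (x, y) \<in> r" for x y
    using equiv_class_eq_iff[OF assms] equiv_class_self[OF assms]
    unfolding brel_def quotient_def by (smt (verit, best) Image_singleton_iff UN_iff assms case_prodI equiv_class_eq mem_Collect_eq singletonD singletonI case_prodD)
  then show ?thesis by auto
qed

lemma quotient_brel: "partition_on A P \<Longrightarrow> A // brel P = P"
  unfolding brel_def by (rule partition_on_eq_quotient)

lemma quotient_noncrossing:
  assumes "nceq {1..m} r"
  shows "{1..m} // r \<in> noncrossing_partitions m"
  using assms partition_on_quotient brel_quotient unfolding noncrossing_partitions_iff nceq_def
  by metis

lemma noncrossing_eqI:
  assumes "P \<in> noncrossing_partitions m" "Q \<in> noncrossing_partitions m" "brel P = brel Q"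
  shows "P = Q"
  using assms quotient_brel unfolding noncrossing_partitions_iff by metis

lemma noncrossing_nceq: "P \<in> noncrossing_partitions m \<Longrightarrow> nceq {1..m} (brel P)"
  by (simp add: noncrossing_partitions_iff)

section \<open>Covers and labels\<close>

definition class_min :: "nat rel \<Rightarrow> nat \<Rightarrow> bool" where
  "class_min r b \<longleftrightarrow> (\<forall>u<b. (u, b) \<notin> r)"

lemma class_min_mono: "r \<subseteq> s \<Longrightarrow> class_min s b \<Longrightarrow> class_min r b"
  by (auto simp: class_min_def)

lemma ex_class_min:
  assumes "nceq A r" "u \<in> A"
  obtains m where "(m, u) \<in> r" "class_min r m" "m \<le> u" "\<And>w. (w, u) \<in> r \<Longrightarrow> m \<le> w"
proof -
  define m where "m = (LEAST w. (w, u) \<in> r)"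
  have m: "(m, u) \<in> r" "\<And>w. (w, u) \<in> r \<Longrightarrow> m \<le> w"
    unfolding m_def using nceq_refl[OF assms] by (auto intro: LeastI Least_le)
  have "class_min r m" unfolding class_min_def using m nceq_trans[OF assms(1)] not_le by blast
  then show ?thesis using that m nceq_refl[OF assms] by blast
qed

lemma class_min_unique:
  assumes "nceq A r" "(m, m') \<in> r" "class_min r m" "class_min r m'"
  shows "m = m'"
  using assms nceq_sym[OF assms(1,2)] unfolding class_min_def by (metis linorder_neqE_nat)

lemma class_min_le:
  assumes "nceq A r" "(m, u) \<in> r" "class_min r m"
  shows "m \<le> u"
  using assms nceq_sym[OF assms(1,2)] unfolding class_min_def by (metis not_le)

text \<open>A class of \<open>s\<close> has only one minimum, while every class of \<open>r\<close>
  inside it contributes one, so it contains just one class of \<open>r\<close>.\<close>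

lemma eq_if_class_min_eq:
  assumes r: "nceq A r" and s: "nceq A s" and rs: "r \<subseteq> s"
    and mins: "\<And>u. u \<in> A \<Longrightarrow> class_min r u \<Longrightarrow> class_min s u"
  shows "r = s"
proof (rule antisym[OF rs], rule subrelI)
  fix u v assume uv: "(u, v) \<in> s"
  obtain m where m: "(m, u) \<in> r" "class_min r m" using ex_class_min[OF r nceq_dom(1)[OF s uv]] by metis
  obtain m' where m': "(m', v) \<in> r" "class_min r m'" using ex_class_min[OF r nceq_dom(2)[OF s uv]] by metis
  have "(m, m') \<in> s" using m m' uv rs nceq_sym[OF s] nceq_trans[OF s] by blast
  moreover have "class_min s m" "class_min s m'" using mins m m' nceq_dom[OF r] by blast+
  ultimately have "m = m'" using class_min_unique[OF s] by blast
  then show "(u, v) \<in> r" using m m' nceq_sym[OF r] nceq_trans[OF r] by blast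
qed

text \<open>A cover removes exactly one class minimum \<open>b\<close>, and its label is the predecessor of \<open>b\<close> in the
  merged block.\<close>

definition cover :: "nat set \<Rightarrow> nat rel \<Rightarrow> nat rel \<Rightarrow> nat \<Rightarrow> bool" where
  "cover A r s b \<longleftrightarrow> nceq A r \<and> nceq A s \<and> r \<subseteq> s \<and> b \<in> A \<and> class_min r b \<and> \<not> class_min s b \<and>
     (\<forall>u\<in>A. u \<noteq> b \<longrightarrow> class_min r u \<longrightarrow> class_min s u)"

lemma coverD:
  assumes "cover A r s b"
  shows "nceq A r" "nceq A s" "r \<subseteq> s" "b \<in> A" "class_min r b" "\<not> class_min s b"
    "\<And>u. u \<in> A \<Longrightarrow> u \<noteq> b \<Longrightarrow> class_min r u \<Longrightarrow> class_min s u"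
  using assms by (auto simp: cover_def)

text \<open>An intermediate \<open>t\<close> either keeps \<open>b\<close> as a class minimum or
  loses it; accordingly it has the class minima of \<open>r\<close> or those of
  \<open>s\<close>.\<close>

lemma cover_between:
  assumes "cover A r s b" "nceq A t" "r \<subseteq> t" "t \<subseteq> s"
  shows "t = r \<or> t = s"
proof (cases "class_min t b")
  case True
  have "r = t"
    using True assms class_min_mono[OF assms(4)]
    by (intro eq_if_class_min_eq[OF coverD(1)[OF assms(1)]]) (auto dest: coverD(7))
  then show ?thesis by simp
next
  case False
  have "t = s"
    using False assms class_min_mono[OF assms(3)]
    by (intro eq_if_class_min_eq[OF _ coverD(2)[OF assms(1)]]) (auto dest: coverD(7))
  then show ?thesis by simp
qed

text \<open>Of the minima of the two merged classes the smaller one survives, and all other classes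
  are untouched.\<close>

lemma cover_join:
  assumes r: "nceq A r" and s: "nceq A (join r x y)" and xy: "x \<in> A" "y \<in> A" "(x, y) \<notin> r"
    and mins: "class_min r a" "class_min r b" "(a, x) \<in> r" "(b, y) \<in> r" "a < b"
  shows "cover A r (join r x y) b"
proof -
  have ab: "(a, b) \<in> join r x y" unfolding join_iff[OF r] using mins nceq_sym[OF r] by blast
  have "class_min (join r x y) u" if u: "u \<in> A" "u \<noteq> b" "class_min r u" for u
    unfolding class_min_def
  proof (intro allI impI notI)
    fix v assume v: "v < u" "(v, u) \<in> join r x y"
    have nr: "(v, u) \<notin> r" using v u by (auto simp: class_min_def)
    have "(v, y) \<notin> r" if "(x, u) \<in> r"
    proof
      assume "(v, y) \<in> r"
      have "a = u" using class_min_unique[OF r _ mins(1) u(3)] mins(3) that nceq_trans[OF r] by blast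
      moreover have "b \<le> v" using class_min_le[OF r _ mins(2)] mins(4) \<open>(v, y) \<in> r\<close> nceq_sym[OF r] nceq_trans[OF r] by blast
      ultimately show False using v mins(5) by simp
    qed
    moreover have "(y, u) \<notin> r"
      using class_min_unique[OF r _ mins(2) u(3)] mins(4) nceq_trans[OF r] u(2) by blast
    ultimately show False using v nr unfolding join_iff[OF r] by blast
  qed
  then show ?thesis unfolding cover_def
    using r s subset_join mins ab nceq_dom(1)[OF r mins(4)] by (auto simp: class_min_def)
qed

lemma join_commute: "join r x y = join r y x"
  by (auto simp: join_def)

lemma ex_cover_join:
  assumes r: "nceq A r" and s: "nceq A (join r x y)" and xy: "x \<in> A" "y \<in> A" "(x, y) \<notin> r"
  shows "\<exists>b. cover A r (join r x y) b"
proof -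
  obtain a where a: "(a, x) \<in> r" "class_min r a" using ex_class_min[OF r xy(1)] by metis
  obtain b where b: "(b, y) \<in> r" "class_min r b" using ex_class_min[OF r xy(2)] by metis
  have "a \<noteq> b" using a b xy nceq_sym[OF r] nceq_trans[OF r] by blast
  then consider "a < b" | "b < a" by linarith
  then show ?thesis
  proof cases
    case 1
    then show ?thesis using cover_join[OF r s xy] a b by blast
  next
    case 2
    have "nceq A (join r y x)" "(y, x) \<notin> r" using s xy nceq_sym[OF r] by (auto simp: join_commute)
    then have "cover A r (join r y x) a" using cover_join[OF r _ xy(2,1)] a b 2 by blast
    then show ?thesis by (auto simp: join_commute)
  qed
qed

definition class_pred :: "nat rel \<Rightarrow> nat \<Rightarrow> nat" where
  "class_pred s b = Max {x. x < b \<and> (x, b) \<in> s}"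

lemma class_pred:
  assumes "\<not> class_min s b"
  shows "class_pred s b < b" "(class_pred s b, b) \<in> s"
    and "\<And>x. x < b \<Longrightarrow> (x, b) \<in> s \<Longrightarrow> x \<le> class_pred s b"
proof -
  have fin: "finite {x. x < b \<and> (x, b) \<in> s}" by auto
  have "{x. x < b \<and> (x, b) \<in> s} \<noteq> {}" using assms by (auto simp: class_min_def)
  then show "class_pred s b < b" "(class_pred s b, b) \<in> s"
    using Max_in[OF fin] unfolding class_pred_def by blast+
  show "x \<le> class_pred s b" if "x < b" "(x, b) \<in> s" for x
    using Max_ge[OF fin] that unfolding class_pred_def by blast
qed

lemma class_pred_eq_iff:
  assumes "\<not> class_min s b" "Suc a = b"
  shows "class_pred s b = a \<longleftrightarrow> (a, b) \<in> s"
  using class_pred[OF assms(1)] assms(2) by (metis lessI less_Suc_eq_le le_antisym)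

text \<open>The removed minimum \<open>b\<close> is the minimum of \<open>B2\<close>, because every
  other class minimum survives. Lying below all of \<open>B2\<close> thus means lying below
  \<open>b\<close>, and the elements of the merged block below \<open>b\<close> all belong to
  \<open>B1\<close>.\<close>

lemma cover_label_eq:
  assumes A: "finite A" and P: "partition_on A P" and Q: "partition_on A Q"
    and cov: "cover A (brel P) (brel Q) b"
  shows "cover_label P Q = class_pred (brel Q) b"
proof -
  note C = coverD[OF cov]
  have block: "B \<noteq> {}" "B \<subseteq> A" "finite B" if "B \<in> P" for B
    using that P A finite_subset[of B A] unfolding partition_on_def by blast+
  have label: "Max {x \<in> B1. \<forall>y\<in>B2. x < y} = class_pred (brel Q) b"
    if B: "B1 \<in> P" "B2 \<in> P" "B1 \<union> B2 \<in> Q" and b: "b \<in> B2" for B1 B2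
  proof -
    have min: "b \<le> y" if "y \<in> B2" for y
      using that b brel_block[OF P B(2) b] C(5) class_min_le[OF C(1)] by simp
    have Qb: "(b, x) \<in> brel Q \<longleftrightarrow> x \<in> B1 \<union> B2" for x using brel_block[OF Q B(3)] b by simp
    have "{x \<in> B1. \<forall>y\<in>B2. x < y} = {x. x < b \<and> (x, b) \<in> brel Q}"
    proof (intro set_eqI iffI)
      fix x assume "x \<in> {x \<in> B1. \<forall>y\<in>B2. x < y}"
      then show "x \<in> {x. x < b \<and> (x, b) \<in> brel Q}" using b Qb nceq_sym[OF C(2)] by blast
    next
      fix x assume x: "x \<in> {x. x < b \<and> (x, b) \<in> brel Q}"
      then have "x \<in> B1 \<union> B2" using Qb nceq_sym[OF C(2)] by blast
      then have "x \<in> B1" using min[of x] x by auto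
      then show "x \<in> {x \<in> B1. \<forall>y\<in>B2. x < y}" using x min by force
    qed
    then show ?thesis by (simp add: class_pred_def)
  qed
  have b2: "b \<in> B2" if B: "B1 \<in> P" "B2 \<in> P" "B1 \<noteq> B2" "B1 \<union> B2 \<in> Q" "Min (B1 \<union> B2) \<in> B1" for B1 B2
  proof -
    have disj: "B1 \<inter> B2 = {}" using P B unfolding partition_on_def disjoint_def by blast
    have mb: "Min B2 \<in> B2" using block B by simp
    have "class_min (brel P) (Min B2)"
      unfolding class_min_def using brel_block[OF P B(2) mb] nceq_sym[OF C(1)] block(3)[OF B(2)]
      by (meson Min_le leD)
    moreover have "Min (B1 \<union> B2) < Min B2"
    proof -
      have "Min (B1 \<union> B2) \<le> Min B2" using block B by (intro Min_antimono) auto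
      moreover have "Min (B1 \<union> B2) \<noteq> Min B2" using B(5) mb disj by auto
      ultimately show ?thesis by simp
    qed
    moreover have "(Min (B1 \<union> B2), Min B2) \<in> brel Q"
      using brel_block[OF Q B(4), of "Min (B1 \<union> B2)"] B(5) mb by simp
    ultimately have "Min B2 = b" using C(7)[of "Min B2"] mb block(2)[OF B(2)]
      unfolding class_min_def by blast
    then show ?thesis using mb by simp
  qed
  have "\<exists>B1 B2. B1 \<in> P \<and> B2 \<in> P \<and> B1 \<noteq> B2 \<and> B1 \<union> B2 \<in> Q \<and> Min (B1 \<union> B2) \<in> B1 \<and>
         class_pred (brel Q) b = Max {x \<in> B1. \<forall>y\<in>B2. x < y}"
  proof -
    obtain m where m: "(m, b) \<in> brel Q" "class_min (brel Q) m" "\<And>w. (w, b) \<in> brel Q \<Longrightarrow> m \<le> w"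
      using ex_class_min[OF C(2) C(4)] by metis
    have mA: "m \<in> A" using m(1) nceq_dom[OF C(2)] by blast
    obtain B1 B2 T where B: "B1 \<in> P" "m \<in> B1" "B2 \<in> P" "b \<in> B2" "T \<in> Q" "b \<in> T"
      using mA C(4) P Q unfolding partition_on_def by blast
    have "m \<le> b" "m \<noteq> b" using m(3)[OF nceq_refl[OF C(2) C(4)]] m(2) C(6) by auto
    then have mb: "m < b" by simp
    have "b \<notin> B1" using brel_block[OF P B(1,2)] C(5) mb unfolding class_min_def by blast
    then have neq: "B1 \<noteq> B2" using B by blast
    have mT: "m \<in> T" using brel_block[OF Q B(5,6)] nceq_sym[OF C(2) m(1)] by simp
    have T: "B1 \<union> B2 = T"
    proof (intro set_eqI iffI)
      fix x assume "x \<in> B1 \<union> B2"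
      then have "(m, x) \<in> brel Q \<or> (b, x) \<in> brel Q"
        using brel_block[OF P B(1,2)] brel_block[OF P B(3,4)] C(3) by blast
      then show "x \<in> T" using brel_block[OF Q B(5,6)] brel_block[OF Q B(5) mT] by simp
    next
      fix x assume "x \<in> T"
      then have bx: "(b, x) \<in> brel Q" using brel_block[OF Q B(5,6)] by simp
      then obtain u where u: "(u, x) \<in> brel P" "class_min (brel P) u"
        using ex_class_min[OF C(1) nceq_dom(2)[OF C(2) bx]] by metis
      show "x \<in> B1 \<union> B2"
      proof (cases "u = b")
        case True
        then show ?thesis using brel_block[OF P B(3,4)] u by simp
      next
        case False
        have "(m, u) \<in> brel Q" using m(1) bx u(1) C(3) nceq_sym[OF C(2)] nceq_trans[OF C(2)] by blast
        moreover have "class_min (brel Q) u" using False C(7)[of u] u nceq_dom[OF C(1)] by blast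
        ultimately have "m = u" using class_min_unique[OF C(2)] m by blast
        then show ?thesis using brel_block[OF P B(1,2)] u by simp
      qed
    qed
    have finT: "finite T" using block(3)[OF B(1)] block(3)[OF B(3)] T by auto
    have "m \<le> w" if "w \<in> T" for w
      using m(3)[of w] brel_block[OF Q B(5,6)] that nceq_sym[OF C(2)] by blast
    then have "Min T = m" using finT mT by (intro Min_eqI) auto
    then show ?thesis using B neq T label[OF B(1,3) _ B(4)] by (intro exI[of _ B1] exI[of _ B2]) auto
  qed
  then show ?thesis unfolding cover_label_def
  proof (rule the_equality)
    fix l assume "\<exists>B1 B2. B1 \<in> P \<and> B2 \<in> P \<and> B1 \<noteq> B2 \<and> B1 \<union> B2 \<in> Q \<and> Min (B1 \<union> B2) \<in> B1 \<and>
      l = Max {x \<in> B1. \<forall>y\<in>B2. x < y}"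
    then show "l = class_pred (brel Q) b" using b2 label by blast
  qed
qed

section \<open>Maximal chains\<close>

definition NC_bot :: "nat \<Rightarrow> nat set set" where "NC_bot m = {1..m} // Id_on {1..m}"
definition NC_top :: "nat \<Rightarrow> nat set set" where "NC_top m = {1..m} // ({1..m} \<times> {1..m})"

lemma nceq_bot: "nceq A (Id_on A)"
  by (rule nceqI) auto

lemma nceq_top: "nceq A (A \<times> A)"
  by (rule nceqI) auto

lemma NC_bot: "NC_bot m \<in> noncrossing_partitions m" "brel (NC_bot m) = Id_on {1..m}"
  using quotient_noncrossing[OF nceq_bot] brel_quotient nceq_bot
  unfolding NC_bot_def nceq_def by blast+

lemma NC_top: "NC_top m \<in> noncrossing_partitions m" "brel (NC_top m) = {1..m} \<times> {1..m}"
  using quotient_noncrossing[OF nceq_top] brel_quotient nceq_top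
  unfolding NC_top_def nceq_def by blast+

lemma nceq_bounds: "nceq A r \<Longrightarrow> Id_on A \<subseteq> r" "nceq A r \<Longrightarrow> r \<subseteq> A \<times> A"
  using nceq_refl nceq_dom by auto

definition NC_less :: "nat \<Rightarrow> nat set set \<Rightarrow> nat set set \<Rightarrow> bool" where
  "NC_less m P Q \<longleftrightarrow> (P, Q) \<in> NC_poset m \<and> P \<noteq> Q"

lemma NC_less_iff: "NC_less m P Q \<longleftrightarrow>
  P \<in> noncrossing_partitions m \<and> Q \<in> noncrossing_partitions m \<and> brel P \<subset> brel Q"
  using noncrossing_eqI unfolding NC_less_def NC_poset_iff by blast

lemma NC_less_trans: "NC_less m P Q \<Longrightarrow> NC_less m Q R \<Longrightarrow> NC_less m P R"
  unfolding NC_less_iff by blast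

text \<open>Along the list the comparison with \<open>y\<close> starts as below and does not end so;
  it switches at some adjacent pair.\<close>

lemma ex_between_successive:
  assumes "successively R c" "c \<noteq> []" "\<And>P. P \<in> set c \<Longrightarrow> R P y \<or> R y P"
    and "R (hd c) y" "\<not> R (last c) y"
  shows "\<exists>xs P Q ys. c = xs @ P # Q # ys \<and> R P y \<and> R y Q"
  using assms
proof (induction c)
  case (Cons P c)
  show ?case
  proof (cases c)
    case Nil
    then show ?thesis using Cons.prems by simp
  next
    case c: (Cons Q d)
    show ?thesis
    proof (cases "R y Q")
      case True
      then have "P # c = [] @ P # Q # d \<and> R P y \<and> R y Q" using c Cons.prems by simp
      then show ?thesis by blast
    next
      case False
      then have "\<exists>xs P Q ys. c = xs @ P # Q # ys \<and> R P y \<and> R y Q"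
      proof -
        have "R Q y" using Cons.prems(3)[of Q] c False by simp
        then show ?thesis using Cons.IH Cons.prems c by simp
      qed
      then obtain xs P' Q' ys where "c = xs @ P' # Q' # ys" "R P' y" "R y Q'" by blast
      then have "P # c = (P # xs) @ P' # Q' # ys \<and> R P' y \<and> R y Q'" by simp
      then show ?thesis by blast
    qed
  qed
qed simp

lemma sorted_wrt_bounds:
  assumes "sorted_wrt R c" "x \<in> set c"
  shows "x = hd c \<or> R (hd c) x" "x = last c \<or> R x (last c)"
  using assms by (induction c) (auto simp: last_in_set)

definition NC_cover :: "nat \<Rightarrow> nat set set \<Rightarrow> nat set set \<Rightarrow> bool" where
  "NC_cover m P Q \<longleftrightarrow> P \<in> noncrossing_partitions m \<and> Q \<in> noncrossing_partitions m \<and>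
     (\<exists>b. cover {1..m} (brel P) (brel Q) b)"

lemma NC_cover_less:
  assumes "NC_cover m P Q"
  shows "NC_less m P Q"
proof -
  obtain b where "cover {1..m} (brel P) (brel Q) b" using assms by (auto simp: NC_cover_def)
  then have "brel P \<subseteq> brel Q" "brel P \<noteq> brel Q" by (auto simp: cover_def)
  then show ?thesis using assms unfolding NC_cover_def NC_less_iff by blast
qed

lemma NC_cover_between:
  assumes "NC_cover m P Q" "NC_less m P R" "NC_less m R Q"
  shows False
proof -
  obtain b where "cover {1..m} (brel P) (brel Q) b" using assms by (auto simp: NC_cover_def)
  then show False using cover_between[of "{1..m}" "brel P" "brel Q" b "brel R"] assms(2,3)
      noncrossing_nceq unfolding NC_less_iff by blast
qed

lemma ex_NC_cover:
  assumes "NC_less m P Q"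
  obtains R where "NC_cover m P R" "R = Q \<or> NC_less m R Q"
proof -
  have P: "nceq {1..m} (brel P)" and Q: "nceq {1..m} (brel Q)" and sub: "brel P \<subset> brel Q"
    and N: "P \<in> noncrossing_partitions m" "Q \<in> noncrossing_partitions m"
    using assms noncrossing_nceq unfolding NC_less_iff by blast+
  obtain x y where xy: "(x, y) \<in> brel Q" "(x, y) \<notin> brel P" "nceq {1..m} (join (brel P) x y)"
    using ex_join_within[OF P Q sub] by blast
  define R where "R = {1..m} // join (brel P) x y"
  have R: "R \<in> noncrossing_partitions m" unfolding R_def by (rule quotient_noncrossing[OF xy(3)])
  have bR: "brel R = join (brel P) x y"
    unfolding R_def using brel_quotient xy(3) nceq_def by blast
  have "\<exists>b. cover {1..m} (brel P) (brel R) b"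
    unfolding bR using ex_cover_join[OF P xy(3)] xy nceq_dom[OF Q xy(1)] by blast
  then have "NC_cover m P R" using N R unfolding NC_cover_def by blast
  moreover have "brel R \<subseteq> brel Q"
    unfolding bR using join_subset[OF P Q] sub xy(1) by blast
  then have "R = Q \<or> NC_less m R Q" using R N noncrossing_eqI unfolding NC_less_iff by blast
  ultimately show ?thesis using that by blast
qed

text \<open>Maximality forces both bounds into the chain and rules out any element strictly inside a
  step, so each step is a cover. Conversely, an element comparable with a saturated chain from
  bottom to top, but not on it, would fall strictly inside one of its covers.\<close>

lemma NC_maximal_chains_iff:
  "c \<in> NC_maximal_chains m \<longleftrightarrow>
     c \<noteq> [] \<and> set c \<subseteq> noncrossing_partitions m \<and> hd c = NC_bot m \<and> last c = NC_top m \<and>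
     successively (NC_cover m) c"
proof -
  interpret pred_on "noncrossing_partitions m" "NC_less m" .
  have bot: "NC_bot m = P \<or> NC_less m (NC_bot m) P" and top: "P = NC_top m \<or> NC_less m P (NC_top m)"
    if "P \<in> noncrossing_partitions m" for P
    using that nceq_bounds[OF noncrossing_nceq[OF that]] NC_bot[of m] NC_top[of m] noncrossing_eqI[of _ m P]
      noncrossing_eqI[of P m]
    unfolding NC_less_iff by (metis psubsetI)+
  have eq: "c \<in> NC_maximal_chains m \<longleftrightarrow> sorted_wrt (NC_less m) c \<and> maxchain (set c)"
    unfolding NC_maximal_chains_def NC_less_def[abs_def] by simp
  show ?thesis
  proof
    assume "c \<in> NC_maximal_chains m"
    then have s: "sorted_wrt (NC_less m) c" and ch: "chain (set c)"
      and max: "\<And>S. chain S \<Longrightarrow> set c \<subseteq> S \<Longrightarrow> S = set c"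
      unfolding eq maxchain_def by blast+
    have sub: "set c \<subseteq> noncrossing_partitions m" using ch by (simp add: chain_def)
    have mem: "x \<in> set c"
      if x: "x \<in> noncrossing_partitions m" and comp: "\<And>P. P \<in> set c \<Longrightarrow> P = x \<or> NC_less m P x \<or> NC_less m x P" for x
    proof -
      have "chain (insert x (set c))"
        using ch x comp unfolding chain_def by blast
      then show ?thesis using max by blast
    qed
    have b: "NC_bot m \<in> set c" using mem[OF NC_bot(1)] bot sub by blast
    have t: "NC_top m \<in> set c" using mem[OF NC_top(1)] top sub by blast
    have ne: "c \<noteq> []" using b by auto
    have "hd c = NC_bot m"
      using sorted_wrt_bounds(1)[OF s b] bot[of "hd c"] sub hd_in_set[OF ne] unfolding NC_less_iff by blast
    moreover have "last c = NC_top m"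
      using sorted_wrt_bounds(2)[OF s t] top[of "last c"] sub last_in_set[OF ne] unfolding NC_less_iff by blast
    moreover have "NC_cover m P Q" if c: "c = xs @ P # Q # ys" for xs P Q ys
    proof -
      have PQ: "NC_less m P Q" using s by (simp add: c sorted_wrt_append)
      obtain R where R: "NC_cover m P R" "R = Q \<or> NC_less m R Q" using ex_NC_cover[OF PQ] .
      show ?thesis
      proof (cases "R = Q")
        case False
        have PR: "NC_less m P R" using NC_cover_less[OF R(1)] .
        have RQ: "NC_less m R Q" using R False by blast
        have below: "Z = P \<or> NC_less m Z P \<or> Z = Q \<or> NC_less m Q Z" if "Z \<in> set c" for Z
          using that s by (auto simp: c sorted_wrt_append)
        have "R \<in> set c"
        proof (rule mem)
          show "R \<in> noncrossing_partitions m" using PR NC_less_iff by blast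
          show "Z = R \<or> NC_less m Z R \<or> NC_less m R Z" if "Z \<in> set c" for Z
            using below[OF that] PR RQ NC_less_trans by blast
        qed
        then have "R = P \<or> NC_less m R P \<or> R = Q \<or> NC_less m Q R" by (rule below)
        then show ?thesis using PR RQ unfolding NC_less_iff by blast
      qed (use R in simp)
    qed
    then have "successively (NC_cover m) c"
    proof (induction c rule: induct_list012)
      case (3 P Q zs)
      then show ?case
        by (metis append.left_neutral append_Cons successively.simps(3))
    qed simp_all
    ultimately show "c \<noteq> [] \<and> set c \<subseteq> noncrossing_partitions m \<and> hd c = NC_bot m \<and> last c = NC_top m \<and>
      successively (NC_cover m) c" using ne sub by blast
  next
    assume R: "c \<noteq> [] \<and> set c \<subseteq> noncrossing_partitions m \<and> hd c = NC_bot m \<and> last c = NC_top m \<and>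
      successively (NC_cover m) c"
    then have "successively (NC_cover m) c" by simp
    then have suc: "successively (NC_less m) c" by (rule successively_mono) (rule NC_cover_less)
    have tr: "transp (NC_less m)" using NC_less_trans by (auto intro: transpI)
    have s: "sorted_wrt (NC_less m) c"
      using suc successively_conv_sorted_wrt[OF tr] by blast
    have ch: "chain (set c)"
    proof (rule chainI)
      show "set c \<subseteq> noncrossing_partitions m" using R by blast
      show "(NC_less m)\<^sup>=\<^sup>= x y \<or> (NC_less m)\<^sup>=\<^sup>= y x" if "x \<in> set c" "y \<in> set c" for x y
        using s that by (induction c) auto
    qed
    have "maxchain (set c)"
      unfolding maxchain_def
    proof (intro conjI notI)
      show "chain (set c)" by fact
      assume "\<exists>S. chain S \<and> set c \<subset> S"
      then obtain S y where S: "chain S" "set c \<subset> S" "y \<in> S" "y \<notin> set c" by blast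
      have y: "y \<in> noncrossing_partitions m" using S by (auto simp: chain_def)
      have comp: "NC_less m P y \<or> NC_less m y P" if "P \<in> set c" for P
        using S that unfolding chain_def by blast
      have "NC_bot m \<noteq> y" "y \<noteq> NC_top m" using S(4) R hd_in_set last_in_set by metis+
      then have "NC_less m (hd c) y" "\<not> NC_less m (last c) y"
        using bot[OF y] top[OF y] R unfolding NC_less_iff by auto
      then obtain xs P Q ys where c: "c = xs @ P # Q # ys" "NC_less m P y" "NC_less m y Q"
        using ex_between_successive[OF suc _ comp] R by metis
      have "NC_cover m P Q" using R by (auto simp: c successively_append_iff)
      then show False using NC_cover_between c by blast
    qed
    then show "c \<in> NC_maximal_chains m" using s eq by blast
  qed
qed

section \<open>Removed class minima and parking functions\<close>

lemma cover_unique: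
  assumes "cover A r s b" "cover A r s b'"
  shows "b = b'"
  using assms unfolding cover_def by blast

lemma successively_nth:
  "successively R c \<longleftrightarrow> (\<forall>i. Suc i < length c \<longrightarrow> R (c ! i) (c ! Suc i))"
proof (induction c rule: induct_list012)
  case (3 x y zs)
  show ?case
  proof
    assume "successively R (x # y # zs)"
    then have "R x y" "\<forall>i. Suc i < length (y # zs) \<longrightarrow> R ((y # zs) ! i) ((y # zs) ! Suc i)"
      using 3 by auto
    then show "\<forall>i. Suc i < length (x # y # zs) \<longrightarrow> R ((x # y # zs) ! i) ((x # y # zs) ! Suc i)"
      by (intro allI impI, case_tac i) auto
  next
    assume R: "\<forall>i. Suc i < length (x # y # zs) \<longrightarrow> R ((x # y # zs) ! i) ((x # y # zs) ! Suc i)"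
    have "R x y" using R[rule_format, of 0] by simp
    moreover have "R ((y # zs) ! i) ((y # zs) ! Suc i)" if "Suc i < length (y # zs)" for i
      using R[rule_format, of "Suc i"] that by simp
    ultimately show "successively R (x # y # zs)" using 3 by simp
  qed
qed simp_all

text \<open>A lost class minimum never becomes one again as the relations grow, and on the way from
  the discrete to the full relation every element except \<open>1\<close> has to be lost.\<close>

lemma chain_class_mins:
  assumes "c \<noteq> []" "hd c = NC_bot m" "last c = NC_top m"
    and cov: "\<And>i. Suc i < length c \<Longrightarrow> cover {1..m} (brel (c ! i)) (brel (c ! Suc i)) (b i)"
  shows "bij_betw b {..<length c - 1} {2..m}"
proof -
  have mono: "brel (c ! i) \<subseteq> brel (c ! j)" if "i \<le> j" "j < length c" for i j
    using that
  proof (induction j rule: dec_induct)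
    case (step j)
    then show ?case using coverD(3)[OF cov[of j]] by simp
  qed simp
  have hd: "brel (c ! 0) = Id_on {1..m}" using assms NC_bot(2) by (simp add: hd_conv_nth[symmetric])
  have last: "brel (c ! (length c - 1)) = {1..m} \<times> {1..m}" 
    using assms(3) last_conv_nth[OF assms(1)] NC_top(2)[of m] by simp
  have less: "b i \<noteq> b j" if "i < j" "Suc j < length c" for i j
  proof -
    have "\<not> class_min (brel (c ! Suc i)) (b i)" using coverD(6)[OF cov[of i]] that by simp
    moreover have "brel (c ! Suc i) \<subseteq> brel (c ! j)" using mono that by simp
    moreover have "class_min (brel (c ! j)) (b j)" using coverD(5)[OF cov[of j]] that by simp
    ultimately show ?thesis using class_min_mono by metis
  qed
  have "inj_on b {..<length c - 1}"
    unfolding inj_on_def by (metis less less_diff_conv lessThan_iff linorder_neqE_nat plus_1_eq_Suc add.commute)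
  moreover have "b ` {..<length c - 1} = {2..m}"
  proof (intro set_eqI iffI)
    fix x assume "x \<in> b ` {..<length c - 1}"
    then obtain i where "i < length c - 1" and x: "x = b i" by blast
    then have i: "Suc i < length c" "x = b i" by linarith+
    note C = coverD[OF cov[OF i(1)]]
    obtain u where u: "u < x" "(u, x) \<in> brel (c ! Suc i)" using C(6) i(2) unfolding class_min_def by blast
    then show "x \<in> {2..m}" using nceq_dom[OF C(2) u(2)] by simp
  next
    fix x assume x: "x \<in> {2..m}"
    \<comment> \<open>The first position at which \<open>x\<close> is no longer minimal; the cover
      leading to it removes \<open>x\<close>.\<close>
    define j where "j = (LEAST j. j < length c \<and> \<not> class_min (brel (c ! j)) x)"
    have "(1, x) \<in> brel (c ! (length c - 1))" using last x by auto
    then have "length c - 1 < length c \<and> \<not> class_min (brel (c ! (length c - 1))) x"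
      using assms(1) x unfolding class_min_def by (auto intro!: exI[of _ "Suc 0"])
    then have j: "j < length c" "\<not> class_min (brel (c ! j)) x"
      unfolding j_def by (metis (mono_tags, lifting) LeastI)+
    have "class_min (brel (c ! 0)) x" using hd unfolding class_min_def by auto
    then obtain i where i: "j = Suc i" using j by (cases j) auto
    have "class_min (brel (c ! i)) x"
      using not_less_Least[of i "\<lambda>j. j < length c \<and> \<not> class_min (brel (c ! j)) x"] i j(1)
      unfolding j_def[symmetric] by simp
    then have "x = b i" using coverD(7)[OF cov[of i], of x] j i x by auto
    then show "x \<in> b ` {..<length c - 1}" using i j(1) by auto
  qed
  ultimately show ?thesis by (simp add: bij_betw_def)
qed

text \<open>A label of at least \<open>i + 2\<close> needs \<open>b j\<close> to be at least
  \<open>i + 3\<close>, which happens for at most \<open>n - i - 1\<close> indices; a violation at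
  position \<open>i\<close> of the sorted list would require \<open>n - i\<close> such
  labels.\<close>

lemma parking_function_if_less:
  assumes b: "bij_betw b {..<n} {2..n + 1}" and l: "\<And>i. i < n \<Longrightarrow> 1 \<le> l i \<and> l i < b i"
  shows "map l [0..<n] \<in> parking_functions n"
proof -
  let ?a = "map l [0..<n]"
  have "sort ?a ! i \<le> Suc i" if i: "i < n" for i
  proof (rule ccontr)
    assume neg: "\<not> ?thesis"
    let ?P = "\<lambda>x. i + 2 \<le> x"
    have len: "length (sort ?a) = n" by simp
    have big: "?P (sort ?a ! j)" if "i \<le> j" "j < n" for j
    proof -
      have "sort ?a ! i \<le> sort ?a ! j" using that len by (intro sorted_nth_mono) auto
      then show ?thesis using neg by simp
    qed
    have "n - i = card {i..<n}" by simp
    also have "\<dots> \<le> card {j. j < length (sort ?a) \<and> ?P (sort ?a ! j)}"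
      using big len by (intro card_mono) auto
    also have "\<dots> = length (filter ?P (sort ?a))" by (rule length_filter_conv_card[symmetric])
    also have "\<dots> = length (filter ?P ?a)" by (simp add: filter_sort)
    also have "\<dots> = card {j. j < n \<and> ?P (l j)}"
      unfolding length_filter_conv_card by (intro arg_cong[where f = card]) auto
    also have "\<dots> \<le> card {i + 3..n + 1}"
    proof (rule card_inj_on_le)
      show "inj_on b {j. j < n \<and> ?P (l j)}"
        using b by (auto simp: bij_betw_def intro: inj_on_subset)
      show "b ` {j. j < n \<and> ?P (l j)} \<subseteq> {i + 3..n + 1}"
      proof (rule image_subsetI)
        fix j assume j: "j \<in> {j. j < n \<and> ?P (l j)}"
        then have "b j \<in> {2..n + 1}" using b by (auto simp: bij_betw_def)
        then show "b j \<in> {i + 3..n + 1}" using j l[of j] by simp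
      qed
    qed simp
    also have "\<dots> = n - i - 1" by simp
    finally show False using i by simp
  qed
  then show ?thesis using l by (auto simp: parking_functions_def)
qed

text \<open>\<open>l i\<close> is the label and \<open>b i\<close> the class minimum removed at step \<open>i\<close>. Since \<open>l i < b i\<close>, the labels
  \<open>n, n - 1, \<dots>, k + 1\<close> can only be attained, in this order, at \<open>b i = n + 1, n, \<dots>, k + 2\<close>.\<close>

lemma parking_function_k_iff:
  assumes b: "bij_betw b {..<n} {2..n + 1}" and l: "\<And>i. i < n \<Longrightarrow> 1 \<le> l i \<and> l i < b i"
    and k: "1 \<le> k" "k \<le> n"
  shows "map l [0..<n] \<in> parking_functions_k n k \<longleftrightarrow>
    (\<forall>i<n. (k + 2 \<le> b i \<longrightarrow> Suc (l i) = b i) \<and> (b i = k + 1 \<longrightarrow> l i \<noteq> k))"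
    (is "?L \<longleftrightarrow> ?R")
proof -
  have L: "?L \<longleftrightarrow> (\<forall>i<n. l i \<noteq> k) \<and> (\<forall>a\<in>{Suc k..n}. \<exists>i<n. l i = a)"
  proof -
    have "map l [0..<n] \<in> parking_functions n" by (rule parking_function_if_less[OF b l])
    moreover have "k \<notin> set (map l [0..<n]) \<longleftrightarrow> (\<forall>i<n. l i \<noteq> k)" by auto
    moreover have "a \<in> set (map l [0..<n]) \<longleftrightarrow> (\<exists>i<n. l i = a)" for a by auto
    ultimately show ?thesis unfolding parking_functions_k_def by blast
  qed
  have range: "b i \<in> {2..n + 1}" if "i < n" for i using b that by (auto simp: bij_betw_def)
  have inj: "i = j" if "i < n" "j < n" "b i = b j" for i j
    using b that by (auto simp: bij_betw_def inj_on_def)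
  show ?thesis
  proof
    assume ?L
    then have nk: "\<And>i. i < n \<Longrightarrow> l i \<noteq> k" and ex: "\<And>a. k < a \<Longrightarrow> a \<le> n \<Longrightarrow> \<exists>i<n. l i = a"
      unfolding L by auto
    \<comment> \<open>Downward induction on \<open>a\<close>: if the label \<open>a\<close> occurred
      with \<open>b i > Suc a\<close>, the same step would by induction carry the larger label
      \<open>b i - 1\<close>.\<close>
    have step: "\<exists>i<n. l i = a \<and> b i = Suc a" if "k < a" "a \<le> n" for a
      using that
    proof (induction "n - a" arbitrary: a rule: less_induct)
      case less
      obtain i where i: "i < n" "l i = a" using ex less.prems by blast
      have "b i = Suc a"
      proof (rule ccontr)
        assume "b i \<noteq> Suc a"
        then have bi: "Suc a < b i" "b i \<le> n + 1" using l[OF i(1)] i range[OF i(1)] by auto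
        obtain j where j: "j < n" "l j = b i - 1" "b j = Suc (b i - 1)"
          using less.hyps[of "b i - 1"] less.prems bi by force
        then have "j = i" using inj[OF j(1) i(1)] bi by simp
        then show False using j i bi by simp
      qed
      then show ?case using i by blast
    qed
    show ?R
    proof (intro allI impI conjI)
      fix i assume i: "i < n"
      show "Suc (l i) = b i" if "k + 2 \<le> b i"
      proof -
        have bi: "b i \<le> n + 1" using range[OF i] by simp
        have "k < b i - 1" "b i - 1 \<le> n" using that bi by linarith+
        then obtain j where j: "j < n" "l j = b i - 1" "b j = Suc (b i - 1)"
          using step[of "b i - 1"] by blast
        then have "j = i" using inj[OF j(1) i] that by simp
        then show ?thesis using j by simp
      qed
      show "l i \<noteq> k" using nk i by blast
    qed
  next
    assume R: ?R
    have "l i \<noteq> k" if i: "i < n" for i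
    proof (cases "k + 2 \<le> b i")
      case True
      then have "Suc (l i) = b i" using R i by blast
      then show ?thesis using True by simp
    next
      case False
      show ?thesis
      proof (cases "b i = k + 1")
        case True
        then show ?thesis using R i by blast
      next
        case False
        then have "b i \<le> k" using \<open>\<not> k + 2 \<le> b i\<close> by simp
        then show ?thesis using l[OF i] by simp
      qed
    qed
    moreover have "\<exists>i<n. l i = a" if "a \<in> {Suc k..n}" for a
    proof -
      have "Suc a \<in> b ` {..<n}" using b that k by (auto simp: bij_betw_def)
      then obtain i where i: "i < n" "b i = Suc a" by auto
      then have "Suc (l i) = b i" using R that by simp
      then show ?thesis using i by auto
    qed
    ultimately show ?L unfolding L by blast
  qed
qed

text \<open>The admissible covers. By \<open>class_pred_eq_iff\<close>, the pair
  \<open>(b - 1, b)\<close> lies in the upper relation exactly when the label of the cover is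
  \<open>b - 1\<close>.\<close>

definition PF_cover :: "nat \<Rightarrow> nat \<Rightarrow> nat set set \<Rightarrow> nat set set \<Rightarrow> bool" where
  "PF_cover n k P Q \<longleftrightarrow>
     P \<in> noncrossing_partitions (n + 1) \<and> Q \<in> noncrossing_partitions (n + 1) \<and>
     (\<exists>b. cover {1..n + 1} (brel P) (brel Q) b \<and>
        (k + 2 \<le> b \<longrightarrow> (b - 1, b) \<in> brel Q) \<and> (b = k + 1 \<longrightarrow> (k, b) \<notin> brel Q))"

text \<open>By \<open>parking_function_k_iff\<close> the global condition on the label sequence
  splits into conditions on single covers, which is what makes a description by paths
  possible.\<close>

lemma PF_chains_iff:
  assumes k: "1 \<le> k" "k \<le> n"
  shows "c \<in> PF_chains n k \<longleftrightarrow>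
     c \<noteq> [] \<and> set c \<subseteq> noncrossing_partitions (n + 1) \<and> hd c = NC_bot (n + 1) \<and>
     last c = NC_top (n + 1) \<and> successively (PF_cover n k) c"
proof -
  let ?A = "{1..n + 1}"
  have main: "chain_labels c \<in> parking_functions_k n k \<longleftrightarrow> successively (PF_cover n k) c"
    if c: "c \<noteq> []" "set c \<subseteq> noncrossing_partitions (n + 1)" "hd c = NC_bot (n + 1)"
      "last c = NC_top (n + 1)" "successively (NC_cover (n + 1)) c"
  proof -
    have "\<forall>i. \<exists>b. Suc i < length c \<longrightarrow> cover ?A (brel (c ! i)) (brel (c ! Suc i)) b"
      using c(5) unfolding successively_nth NC_cover_def by blast
    then obtain b where cov: "\<And>i. Suc i < length c \<Longrightarrow> cover ?A (brel (c ! i)) (brel (c ! Suc i)) (b i)"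
      by metis
    have bij: "bij_betw b {..<length c - 1} {2..n + 1}"
      by (rule chain_class_mins[OF c(1,3,4) cov])
    then have len: "length c - 1 = n" using bij_betw_same_card by fastforce
    then have lc: "length c = Suc n" using c(1) by (cases c) auto
    define l where "l i = class_pred (brel (c ! Suc i)) (b i)" for i
    have part: "partition_on ?A (c ! i)" "c ! i \<in> noncrossing_partitions (n + 1)" if "i < length c" for i
    proof -
      show "c ! i \<in> noncrossing_partitions (n + 1)" using nth_mem[OF that] c(2) by blast
      then show "partition_on ?A (c ! i)" unfolding noncrossing_partitions_iff by blast
    qed
    have "chain_labels c = map l [0..<n]"
    proof (rule nth_equalityI)
      show "length (chain_labels c) = length (map l [0..<n])"
        using lc by (simp add: chain_labels_def)
      fix i assume "i < length (chain_labels c)"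
      then have i: "i < n" using lc by (simp add: chain_labels_def)
      then have "chain_labels c ! i = cover_label (c ! i) (c ! Suc i)"
        using lc by (simp add: chain_labels_def nth_tl)
      also have "\<dots> = l i" unfolding l_def
        using i lc part by (intro cover_label_eq[OF _ _ _ cov]) auto
      finally show "chain_labels c ! i = map l [0..<n] ! i" using i by simp
    qed
    moreover have less: "1 \<le> l i \<and> l i < b i" if "i < n" for i
    proof -
      note C = coverD[OF cov[of i]]
      have i: "Suc i < length c" using that lc by simp
      show ?thesis
        using class_pred[OF C(6)[OF i]] nceq_dom(1)[OF C(2)[OF i]] unfolding l_def by fastforce
    qed
    ultimately have "chain_labels c \<in> parking_functions_k n k \<longleftrightarrow>
      (\<forall>i<n. (k + 2 \<le> b i \<longrightarrow> Suc (l i) = b i) \<and> (b i = k + 1 \<longrightarrow> l i \<noteq> k))"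
      using parking_function_k_iff[OF bij[unfolded len] less k] by simp
    also have "\<dots> \<longleftrightarrow> (\<forall>i. Suc i < length c \<longrightarrow> PF_cover n k (c ! i) (c ! Suc i))"
    proof -
      have "(k + 2 \<le> b i \<longrightarrow> Suc (l i) = b i) \<and> (b i = k + 1 \<longrightarrow> l i \<noteq> k) \<longleftrightarrow> PF_cover n k (c ! i) (c ! Suc i)"
        if i: "Suc i < length c" for i
      proof -
        note nm = coverD(6)[OF cov[OF i]]
        have bpos: "Suc (b i - 1) = b i" using coverD(4)[OF cov[OF i]] by simp
        have "Suc (l i) = b i \<longleftrightarrow> (b i - 1, b i) \<in> brel (c ! Suc i)"
          using class_pred_eq_iff[OF nm bpos] bpos unfolding l_def by auto
        moreover have "l i \<noteq> k \<longleftrightarrow> (k, b i) \<notin> brel (c ! Suc i)" if "b i = k + 1"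
          using class_pred_eq_iff[OF nm, of k] that unfolding l_def by auto
        moreover have "PF_cover n k (c ! i) (c ! Suc i) \<longleftrightarrow>
          (k + 2 \<le> b i \<longrightarrow> (b i - 1, b i) \<in> brel (c ! Suc i)) \<and> (b i = k + 1 \<longrightarrow> (k, b i) \<notin> brel (c ! Suc i))"
          unfolding PF_cover_def using part[of i] part[of "Suc i"] i cov[OF i] cover_unique[OF cov[OF i]]
          by (metis Suc_lessD)
        ultimately show ?thesis by blast
      qed
      then show ?thesis using lc by simp
    qed
    finally show ?thesis unfolding successively_nth .
  qed
  have weak: "successively (NC_cover (n + 1)) c" if "successively (PF_cover n k) c"
    using that by (rule successively_mono) (auto simp: PF_cover_def NC_cover_def)
  show ?thesis
    using main weak unfolding PF_chains_def NC_maximal_chains_iff by blast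
qed

section \<open>Admissible chains as paths\<close>

lemma successively_rtrancl:
  assumes "successively R c" "x \<in> set c"
  shows "(hd c, x) \<in> {(x, y). R x y}\<^sup>* \<and> (x, last c) \<in> {(x, y). R x y}\<^sup>*"
  using assms
proof (induction c arbitrary: x)
  case (Cons a c)
  let ?R = "{(x, y). R x y}"
  show ?case
  proof (cases "c = []")
    case True
    then show ?thesis using Cons.prems by simp
  next
    case False
    then have ac: "(a, hd c) \<in> ?R" and c: "successively R c"
      using Cons.prems(1) by (auto simp: successively_Cons)
    have IH: "(hd c, x) \<in> ?R\<^sup>* \<and> (x, last c) \<in> ?R\<^sup>*" if "x \<in> set c" for x
      using Cons.IH[OF c that] .
    have hd: "hd c \<in> set c" using False by simp
    show ?thesis
    proof (cases "x \<in> set c")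
      case True
      then show ?thesis using IH[OF True] converse_rtrancl_into_rtrancl[OF ac] False by simp
    next
      case x: False
      then show ?thesis
        using Cons.prems(2) IH[OF hd] converse_rtrancl_into_rtrancl[OF ac] False by simp
    qed
  qed
qed simp

lemma rtrancl_successively:
  assumes "(x, y) \<in> {(x, y). R x y}\<^sup>*"
  obtains c where "c \<noteq> []" "hd c = x" "last c = y" "successively R c"
proof -
  have "\<exists>c. c \<noteq> [] \<and> hd c = x \<and> last c = y \<and> successively R c"
    using assms
  proof (induction rule: converse_rtrancl_induct)
    case base
    show ?case by (intro exI[of _ "[y]"]) simp
  next
    case (step x z)
    then obtain c where "c \<noteq> []" "hd c = z" "last c = y" "successively R c" by blast
    then show ?case using step(1) by (intro exI[of _ "x # c"]) (auto simp: successively_Cons)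
  qed
  then show ?thesis using that by blast
qed

definition PF_steps :: "nat \<Rightarrow> nat \<Rightarrow> nat set set rel" where
  "PF_steps n k = {(P, Q). PF_cover n k P Q}"

lemma set_zip_tl: "(P, Q) \<in> set (zip c (tl c)) \<longleftrightarrow> (\<exists>xs ys. c = xs @ P # Q # ys)"
proof
  assume "(P, Q) \<in> set (zip c (tl c))"
  then obtain i where i: "Suc i < length c" "P = c ! i" "Q = c ! Suc i"
    by (auto simp: set_zip nth_tl less_diff_conv)
  then have "c = take i c @ P # Q # drop (i + 2) c"
    by (metis Cons_nth_drop_Suc Suc_lessD add_2_eq_Suc' id_take_nth_drop)
  then show "\<exists>xs ys. c = xs @ P # Q # ys" by blast
next
  assume "\<exists>xs ys. c = xs @ P # Q # ys"
  then obtain xs ys where "c = xs @ P # Q # ys" by blast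
  then have "Suc (length xs) < length c" "c ! length xs = P" "c ! Suc (length xs) = Q"
    by (auto simp: nth_append)
  then show "(P, Q) \<in> set (zip c (tl c))"
    by (auto simp: set_zip nth_tl intro!: exI[of _ "length xs"])
qed

text \<open>A step whose source is reachable from the bottom and whose target reaches the top
  extends to a complete admissible chain by concatenation, so steps of chains and admissible covers
  generate the same order on such vertices.\<close>

lemma PF_poset_iff:
  assumes k: "1 \<le> k" "k \<le> n"
  shows "(P, Q) \<in> PF_poset n k \<longleftrightarrow>
    (NC_bot (n + 1), P) \<in> (PF_steps n k)\<^sup>* \<and> (P, Q) \<in> (PF_steps n k)\<^sup>* \<and>
    (Q, NC_top (n + 1)) \<in> (PF_steps n k)\<^sup>*"
proof -
  let ?E = "\<Union>c\<in>PF_chains n k. set (zip c (tl c))" and ?V = "\<Union>c\<in>PF_chains n k. set c"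
  let ?S = "PF_steps n k" and ?b = "NC_bot (n + 1)" and ?t = "NC_top (n + 1)"
  have ES: "?E \<subseteq> ?S"
  proof
    fix e assume "e \<in> ?E"
    then obtain c where c0: "c \<in> PF_chains n k" "e \<in> set (zip c (tl c))" by blast
    obtain P Q where e: "e = (P, Q)" by (cases e)
    with c0 have c: "c \<in> PF_chains n k" "(P, Q) \<in> set (zip c (tl c))" "e = (P, Q)" by simp_all
    then obtain xs ys where "c = xs @ P # Q # ys" unfolding set_zip_tl by blast
    moreover have "successively (PF_cover n k) c" using c PF_chains_iff[OF k] by blast
    ultimately show "e \<in> ?S" using c by (auto simp: PF_steps_def successively_append_iff)
  qed
  have V: "(?b, P) \<in> ?S\<^sup>* \<and> (P, ?t) \<in> ?S\<^sup>*" if PV: "P \<in> ?V" for P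
  proof -
    obtain c where c: "c \<in> PF_chains n k" "P \<in> set c" using PV by blast
    then have "successively (PF_cover n k) c" "hd c = ?b" "last c = ?t"
      using PF_chains_iff[OF k, of c] by blast+
    then show ?thesis
      using successively_rtrancl[OF _ c(2), of "PF_cover n k"] unfolding PF_steps_def by simp
  qed
  have ncp: "Q \<in> noncrossing_partitions (n + 1)" if "(?b, Q) \<in> ?S\<^sup>*" for Q
    using that NC_bot(1) by (induction rule: rtrancl_induct) (auto simp: PF_steps_def PF_cover_def)
  have path: "\<exists>c\<in>PF_chains n k. P \<in> set c \<and> (Q = P \<or> (P, Q) \<in> set (zip c (tl c)))"
    if PQ: "(?b, P) \<in> ?S\<^sup>*" "Q = P \<or> (P, Q) \<in> ?S" "(Q, ?t) \<in> ?S\<^sup>*" for P Q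
  proof -
    obtain c1 where c1: "c1 \<noteq> []" "hd c1 = ?b" "last c1 = P" "successively (PF_cover n k) c1"
      using rtrancl_successively PQ(1) unfolding PF_steps_def by metis
    obtain c2 where c2: "c2 \<noteq> []" "hd c2 = Q" "last c2 = ?t" "successively (PF_cover n k) c2"
      using rtrancl_successively PQ(3) unfolding PF_steps_def by metis
    \<comment> \<open>\<open>c1\<close> ends in \<open>P\<close> and \<open>c2\<close> begins with
      \<open>Q\<close>; when they coincide the common vertex must not be repeated.\<close>
    define c where "c = (if Q = P then c1 @ tl c2 else c1 @ c2)"
    have "successively (PF_cover n k) c"
    proof (cases "Q = P")
      case True
      have "successively (PF_cover n k) (c1 @ tl c2)"
        using c1 c2 True by (cases c2) (auto simp: successively_append_iff successively_Cons)
      then show ?thesis using True by (simp add: c_def)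
    next
      case False
      then show ?thesis using c1 c2 PQ(2) by (simp add: c_def successively_append_iff PF_steps_def)
    qed
    moreover have "c \<noteq> []" "hd c = ?b" "last c = ?t"
      using c1 c2 unfolding c_def by (auto simp: last_append last_tl neq_Nil_conv)
    moreover have "set c \<subseteq> noncrossing_partitions (n + 1)"
      using ncp successively_rtrancl[OF \<open>successively (PF_cover n k) c\<close>] \<open>hd c = ?b\<close>
      unfolding PF_steps_def by auto
    ultimately have "c \<in> PF_chains n k" using PF_chains_iff[OF k] by blast
    moreover have "P \<in> set c" using c1 last_in_set[OF c1(1)] by (simp add: c_def)
    moreover have "Q = P \<or> (P, Q) \<in> set (zip c (tl c))"
    proof (cases "Q = P")
      case False
      have "c = butlast c1 @ P # Q # tl c2"
        using False c1 c2 by (metis append.assoc append_Cons append_Nil append_butlast_last_id c_def list.collapse)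
      then show ?thesis unfolding set_zip_tl by blast
    qed simp
    ultimately show ?thesis by blast
  qed
  have S_E: "(P, Q) \<in> ?E\<^sup>*" if "(P, Q) \<in> ?S\<^sup>*" "(?b, P) \<in> ?S\<^sup>*" "(Q, ?t) \<in> ?S\<^sup>*"
    using that
  proof (induction rule: converse_rtrancl_induct)
    case (step P R)
    have "(?b, R) \<in> ?S\<^sup>*" using step by (meson rtrancl.rtrancl_into_rtrancl)
    then have "(R, Q) \<in> ?E\<^sup>*" using step by blast
    have "(R, ?t) \<in> ?S\<^sup>*" using step by (meson rtrancl_trans)
    then have "R = P \<or> (P, R) \<in> ?E" using path[of P R] step by blast
    then show ?case
    proof
      assume "(P, R) \<in> ?E"
      then show ?case using \<open>(R, Q) \<in> ?E\<^sup>*\<close> by (rule converse_rtrancl_into_rtrancl)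
    qed (use \<open>(R, Q) \<in> ?E\<^sup>*\<close> in simp)
  qed simp
  show ?thesis
  proof
    assume "(P, Q) \<in> PF_poset n k"
    then have "(P, Q) \<in> ?E\<^sup>*" "P \<in> ?V" "Q \<in> ?V" by (auto simp: PF_poset_def)
    then show "(?b, P) \<in> ?S\<^sup>* \<and> (P, Q) \<in> ?S\<^sup>* \<and> (Q, ?t) \<in> ?S\<^sup>*"
      using V rtrancl_mono[OF ES] by blast
  next
    assume R: "(?b, P) \<in> ?S\<^sup>* \<and> (P, Q) \<in> ?S\<^sup>* \<and> (Q, ?t) \<in> ?S\<^sup>*"
    then have "(P, ?t) \<in> ?S\<^sup>*" "(?b, Q) \<in> ?S\<^sup>*" by (auto intro: rtrancl_trans)
    then have "P \<in> ?V" "Q \<in> ?V" using path[of P P] path[of Q Q] R by blast+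
    then show "(P, Q) \<in> PF_poset n k" using S_E R by (auto simp: PF_poset_def)
  qed
qed

section \<open>Order of the parking function poset\<close>

text \<open>An invariant of admissible paths: an element \<open>x > k + 1\<close> stops being a
  class minimum only through a cover that puts it into the block of \<open>x - 1\<close>.\<close>

definition tail_joined :: "nat \<Rightarrow> nat rel \<Rightarrow> bool" where
  "tail_joined k r \<longleftrightarrow> (\<forall>x>k + 1. \<not> class_min r x \<longrightarrow> (x - 1, x) \<in> r)"

text \<open>For \<open>b = k + 1\<close> and \<open>a = k\<close>: every chain from \<open>r\<close> to \<open>s\<close> then uses the label \<open>k\<close>, because the block of
  \<open>k\<close> in \<open>r\<close> already reaches down to the minimum of the final block and shields \<open>k + 1\<close> from all others.\<close>

definition blocked :: "nat \<Rightarrow> nat \<Rightarrow> nat rel \<Rightarrow> nat rel \<Rightarrow> bool" where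
  "blocked a b r s \<longleftrightarrow> class_min r b \<and> (a, b) \<in> s \<and> (\<exists>m. (m, b) \<in> s \<and> class_min s m \<and> (a, m) \<in> r)"

lemma tail_joined_cover:
  assumes "tail_joined k r" "cover A r s b" "k + 2 \<le> b \<longrightarrow> (b - 1, b) \<in> s"
  shows "tail_joined k s"
  unfolding tail_joined_def
proof (intro allI impI)
  fix x assume x: "k + 1 < x" "\<not> class_min s x"
  note C = coverD[OF assms(2)]
  show "(x - 1, x) \<in> s"
  proof (cases "class_min r x")
    case True
    have "x \<in> A" using x(2) nceq_dom[OF C(2)] unfolding class_min_def by blast
    then have "x = b" using C(7) True x by blast
    then show ?thesis using assms(3) x by simp
  qed (use assms(1) x C(3) in \<open>auto simp: tail_joined_def\<close>)
qed

text \<open>If some \<open>x > k + 1\<close> has to be joined, join it to \<open>x - 1\<close>; otherwise, if \<open>k + 1\<close> has to be joined to \<open>k\<close>,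
  join it to the minimum of its final block first; otherwise any cover will do.\<close>

lemma ex_cover_avoiding:
  assumes r: "nceq A r" and s: "nceq A s" and rs: "r \<subset> s" and kA: "k + 1 \<in> A"
    and tr: "tail_joined k r" and ts: "tail_joined k s" and nb: "\<not> blocked k (k + 1) r s"
  shows "\<exists>t b. cover A r t b \<and> t \<subseteq> s \<and> \<not> blocked k (k + 1) t s \<and>
    (k + 2 \<le> b \<longrightarrow> (b - 1, b) \<in> t) \<and> (b = k + 1 \<longrightarrow> (k, b) \<notin> t)"
proof -
  have rs': "r \<subseteq> s" using rs by blast
  consider x where "k + 1 < x" "class_min r x" "\<not> class_min s x"
    | "\<And>x. k + 1 < x \<Longrightarrow> class_min r x \<Longrightarrow> class_min s x" "class_min r (k + 1)" "(k, k + 1) \<in> s"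
    | "\<And>x. k + 1 < x \<Longrightarrow> class_min r x \<Longrightarrow> class_min s x" "\<not> (class_min r (k + 1) \<and> (k, k + 1) \<in> s)"
    by blast
  then show ?thesis
  proof cases
    case 1
    have xs: "(x - 1, x) \<in> s" using ts 1 by (simp add: tail_joined_def)
    have xA: "x - 1 \<in> A" "x \<in> A" using nceq_dom[OF s xs] by blast+
    have nr: "(u, x) \<notin> r" if "u < x" for u using 1(2) that by (auto simp: class_min_def)
    have xr: "(x - 1, x) \<notin> r" using nr 1 by simp
    define t where "t = join r (x - 1) x"
    have t: "nceq A t"
      unfolding t_def
    proof (rule nceq_join_within[OF r s rs' xs])
      fix f f' assume f: "(f, f') \<in> r" "(f, x) \<in> s" "(f, x - 1) \<notin> r" "(f, x) \<notin> r"
      have "f \<noteq> x - 1" "f \<noteq> x" "f' \<noteq> x - 1" "f' \<noteq> x"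
        using f nceq_refl[OF r xA(1)] nceq_refl[OF r xA(2)] by blast+
      then have "(x - 1 < f) = (x < f)" "(x - 1 < f') = (x < f')" using 1(1) by linarith+
      then show "nsep f f' (x - 1) x" by (simp add: nsep_def)
    qed
    obtain a where a: "(a, x - 1) \<in> r" "class_min r a" "a \<le> x - 1" using ex_class_min[OF r xA(1)] by metis
    have cov: "cover A r t x" unfolding t_def
    proof (rule cover_join[OF r t[unfolded t_def] xA xr a(2) 1(2) a(1)])
      show "(x, x) \<in> r" using nceq_refl[OF r xA(2)] .
      show "a < x" using a(3) 1(1) by simp
    qed
    have ts': "t \<subseteq> s" unfolding t_def using join_subset[OF r s rs' xs] .
    \<comment> \<open>Both \<open>k\<close> and \<open>m\<close> lie below \<open>x\<close>, hence
      outside its class in \<open>r\<close>; if the join relates them, \<open>r\<close> already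
      does, so \<open>r\<close> would be blocked as well.\<close>
    have "\<not> blocked k (k + 1) t s"
    proof
      assume "blocked k (k + 1) t s"
      then obtain m where m: "class_min t (k + 1)" "(k, k + 1) \<in> s" "(m, k + 1) \<in> s" "class_min s m" "(k, m) \<in> t"
        by (auto simp: blocked_def)
      have "m \<le> k + 1" using class_min_le[OF s m(3,4)] .
      then have "(m, x) \<notin> r" "(k, x) \<notin> r" using nr 1(1) by auto
      then have "(k, m) \<in> r" using m(5) nceq_sym[OF r] unfolding t_def join_iff[OF r] by blast
      moreover have "class_min r (k + 1)" using class_min_mono[OF _ m(1), of r] subset_join unfolding t_def by blast
      ultimately show False using nb m unfolding blocked_def by blast
    qed
    moreover have "(x - 1, x) \<in> t" unfolding t_def using join_self[OF r xA] .
    ultimately show ?thesis using cov ts' 1(1) by (intro exI[of _ t] exI[of _ x]) auto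
  next
    case 2
    obtain m where m: "(m, k + 1) \<in> s" "class_min s m" "\<And>w. (w, k + 1) \<in> s \<Longrightarrow> m \<le> w"
      using ex_class_min[OF s kA] by metis
    have mk: "m < k + 1" using m(3)[OF 2(3)] by simp
    have km: "(k, m) \<notin> r" using nb 2 m by (auto simp: blocked_def)
    have mA: "m \<in> A" using nceq_dom[OF s m(1)] by blast
    have nr: "(u, k + 1) \<notin> r" if "u < k + 1" for u using 2(2) that by (auto simp: class_min_def)
    \<comment> \<open>No element above \<open>k + 1\<close> is left to be removed, so by
      \<open>tail_joined\<close> those in the final block of \<open>k + 1\<close> are linked to it
      in \<open>r\<close> one by one. Every other class in the block, apart from that of
      \<open>m\<close>, therefore lies strictly between \<open>m\<close> and \<open>k + 1\<close>
      and cannot separate them.\<close>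
    have desc: "(f, k + 1) \<in> r" if "k + 1 \<le> f" "(f, k + 1) \<in> s" for f
      using that
    proof (induction f rule: dec_induct)
      case base
      then show ?case using nceq_refl[OF r kA] by simp
    next
      case (step f)
      have "\<not> class_min s (Suc f)"
        using step nceq_sym[OF s] unfolding class_min_def by (meson le_imp_less_Suc)
      then have "\<not> class_min r (Suc f)" using 2(1)[of "Suc f"] step by auto
      then have ff: "(f, Suc f) \<in> r" using tr step unfolding tail_joined_def by (metis diff_Suc_1 le_imp_less_Suc)
      then have "(f, k + 1) \<in> s" using step rs' nceq_trans[OF s] by blast
      then show ?case using step ff nceq_sym[OF r] nceq_trans[OF r] by blast
    qed
    define t where "t = join r m (k + 1)"
    have t: "nceq A t"
      unfolding t_def
    proof (rule nceq_join_within[OF r s rs' m(1)])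
      fix f f' assume f: "(f, f') \<in> r" "(f, k + 1) \<in> s" "(f, m) \<notin> r" "(f, k + 1) \<notin> r"
      have f': "(f', k + 1) \<in> s" "(f', k + 1) \<notin> r"
        using f rs' nceq_sym[OF s] nceq_trans[OF s] nceq_trans[OF r] by blast+
      have "f < k + 1" "f' < k + 1" using desc f f' by (meson not_le)+
      moreover have "f \<noteq> m" "f' \<noteq> m" using f nceq_refl[OF r mA] by blast+
      then have "m < f" "m < f'" using m(3)[OF f(2)] m(3)[OF f'(1)] by simp_all
      ultimately show "nsep f f' m (k + 1)" by (simp add: nsep_def)
    qed
    have cov: "cover A r t (k + 1)" unfolding t_def
      using cover_join[OF r t[unfolded t_def] mA kA nr[OF mk] class_min_mono[OF rs' m(2)] 2(2)
          nceq_refl[OF r mA] nceq_refl[OF r kA] mk] .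
    have "(k, k + 1) \<notin> t" unfolding t_def join_iff[OF r] using nr[of k] km by auto
    moreover have "t \<subseteq> s" unfolding t_def using join_subset[OF r s rs' m(1)] .
    moreover have "\<not> blocked k (k + 1) t s" using coverD(6)[OF cov] by (simp add: blocked_def)
    ultimately show ?thesis using cov by (intro exI[of _ t] exI[of _ "k + 1"]) auto
  next
    case 3
    obtain x y where xy: "(x, y) \<in> s" "(x, y) \<notin> r" "nceq A (join r x y)"
      using ex_join_within[OF r s rs] by blast
    define t where "t = join r x y"
    obtain b where cov: "cover A r t b"
      unfolding t_def using ex_cover_join[OF r xy(3)] xy(2) nceq_dom[OF s xy(1)] by blast
    have ts': "t \<subseteq> s" unfolding t_def using join_subset[OF r s rs' xy(1)] .
    have "\<not> k + 2 \<le> b"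
      using 3(1)[of b] coverD(5,6)[OF cov] class_min_mono[OF ts'] by auto
    moreover have "b = k + 1 \<longrightarrow> (k, b) \<notin> t" using 3(2) coverD(5)[OF cov] ts' by auto
    moreover have "\<not> blocked k (k + 1) t s"
      using 3(2) class_min_mono[OF coverD(3)[OF cov]] by (auto simp: blocked_def)
    ultimately show ?thesis using cov ts' by blast
  qed
qed

lemma PF_path_if:
  assumes k: "k \<le> n" and P: "P \<in> noncrossing_partitions (n + 1)" and Q: "Q \<in> noncrossing_partitions (n + 1)"
    and sub: "brel P \<subseteq> brel Q" and tP: "tail_joined k (brel P)" and tQ: "tail_joined k (brel Q)"
    and nb: "\<not> blocked k (k + 1) (brel P) (brel Q)"
  shows "(P, Q) \<in> (PF_steps n k)\<^sup>*"
  using P sub tP nb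
proof (induction "card (brel Q - brel P)" arbitrary: P rule: less_induct)
  case (less P)
  let ?A = "{1..n + 1}"
  show ?case
  proof (cases "brel P = brel Q")
    case True
    then show ?thesis using noncrossing_eqI less.prems(1) Q by blast
  next
    case False
    then have rs: "brel P \<subset> brel Q" using less.prems by blast
    have r: "nceq ?A (brel P)" and s: "nceq ?A (brel Q)" using less.prems(1) Q noncrossing_nceq by blast+
    have "k + 1 \<in> ?A" using k by simp
    then obtain t b where t: "cover ?A (brel P) t b" "t \<subseteq> brel Q" "\<not> blocked k (k + 1) t (brel Q)"
        "k + 2 \<le> b \<longrightarrow> (b - 1, b) \<in> t" "b = k + 1 \<longrightarrow> (k, b) \<notin> t"
      using ex_cover_avoiding[OF r s rs _ less.prems(3) tQ less.prems(4)] by blast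
    define R where "R = ?A // t"
    note C = coverD[OF t(1)]
    have R: "R \<in> noncrossing_partitions (n + 1)" unfolding R_def by (rule quotient_noncrossing[OF C(2)])
    have bR: "brel R = t" unfolding R_def using brel_quotient C(2) nceq_def by blast
    have "PF_cover n k P R" using less.prems(1) R t unfolding PF_cover_def bR by blast
    then have PR: "(P, R) \<in> PF_steps n k" by (simp add: PF_steps_def)
    have "brel P \<subset> t" using C by blast
    moreover have "finite (brel Q)" using nceq_bounds(2)[OF s] finite_subset by blast
    ultimately have "card (brel Q - brel R) < card (brel Q - brel P)"
      unfolding bR using t(2) by (intro psubset_card_mono) auto
    then have "(R, Q) \<in> (PF_steps n k)\<^sup>*"
      using less.hyps[of R] R t tail_joined_cover[OF less.prems(3) t(1,4)] unfolding bR by blast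
    then show ?thesis using PR by (rule converse_rtrancl_into_rtrancl[rotated])
  qed
qed

text \<open>The induction records the relation \<open>t\<close> reached when \<open>k + 1\<close> is
  absorbed: its block of \<open>k + 1\<close> avoids \<open>k\<close> but contains some smaller
  \<open>x\<close>. If the ends were blocked, \<open>k\<close> would be equivalent to
  \<open>m\<close>, and the pairs \<open>m\<close>, \<open>k\<close> and \<open>x\<close>,
  \<open>k + 1\<close> with \<open>m < x < k\<close> would cross in \<open>t\<close>.\<close>

lemma PF_path_imp:
  assumes k: "k \<le> n" and P: "P \<in> noncrossing_partitions (n + 1)" and tP: "tail_joined k (brel P)"
    and path: "(P, Q) \<in> (PF_steps n k)\<^sup>*"
  shows "Q \<in> noncrossing_partitions (n + 1)" "brel P \<subseteq> brel Q" "tail_joined k (brel Q)"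
    "\<not> blocked k (k + 1) (brel P) (brel Q)"
proof -
  let ?A = "{1..n + 1}"
  have all: "Q \<in> noncrossing_partitions (n + 1) \<and> brel P \<subseteq> brel Q \<and> tail_joined k (brel Q) \<and>
    (class_min (brel P) (k + 1) \<longrightarrow> \<not> class_min (brel Q) (k + 1) \<longrightarrow>
      (\<exists>t. nceq ?A t \<and> brel P \<subseteq> t \<and> t \<subseteq> brel Q \<and> \<not> class_min t (k + 1) \<and> (k, k + 1) \<notin> t))"
    using path
  proof (induction rule: rtrancl_induct)
    case base
    then show ?case using P tP by blast
  next
    case (step Q R)
    obtain b where b: "R \<in> noncrossing_partitions (n + 1)" "cover ?A (brel Q) (brel R) b"
        "k + 2 \<le> b \<longrightarrow> (b - 1, b) \<in> brel R" "b = k + 1 \<longrightarrow> (k, b) \<notin> brel R"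
      using step(2) by (auto simp: PF_steps_def PF_cover_def)
    note C = coverD[OF b(2)]
    have tR: "tail_joined k (brel R)" using tail_joined_cover step b by blast
    have "\<exists>t. nceq ?A t \<and> brel P \<subseteq> t \<and> t \<subseteq> brel R \<and> \<not> class_min t (k + 1) \<and> (k, k + 1) \<notin> t"
      if c: "class_min (brel P) (k + 1)" "\<not> class_min (brel R) (k + 1)"
    proof (cases "class_min (brel Q) (k + 1)")
      case True
      have "k + 1 \<in> ?A" using k by simp
      then have "b = k + 1" using C(7)[of "k + 1"] True c by blast
      then show ?thesis using b C step c by blast
    next
      case False
      then show ?thesis using step c C(3) by (meson order_trans)
    qed
    then show ?case using b(1) tR step C(3) by blast
  qed
  then show "Q \<in> noncrossing_partitions (n + 1)" "brel P \<subseteq> brel Q" "tail_joined k (brel Q)" by blast+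
  show "\<not> blocked k (k + 1) (brel P) (brel Q)"
  proof
    assume "blocked k (k + 1) (brel P) (brel Q)"
    then obtain m where m: "class_min (brel P) (k + 1)" "(k, k + 1) \<in> brel Q" "(m, k + 1) \<in> brel Q"
        "class_min (brel Q) m" "(k, m) \<in> brel P"
      by (auto simp: blocked_def)
    have Q: "nceq ?A (brel Q)" using all noncrossing_nceq by blast
    have "\<not> class_min (brel Q) (k + 1)" using m(2) by (auto simp: class_min_def)
    then obtain t where t: "nceq ?A t" "brel P \<subseteq> t" "t \<subseteq> brel Q" "\<not> class_min t (k + 1)" "(k, k + 1) \<notin> t"
      using all m(1) by blast
    obtain x where x: "x < k + 1" "(x, k + 1) \<in> t" using t(4) by (auto simp: class_min_def)
    have mk: "(m, k) \<in> t" using m(5) t nceq_sym[OF t(1)] by blast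
    have mx: "(m, x) \<notin> t"
      using t(5) x(2) mk nceq_sym[OF t(1)] nceq_trans[OF t(1)] by blast
    have "(m, x) \<in> brel Q" using m(3) x(2) t(3) nceq_sym[OF Q] nceq_trans[OF Q] by blast
    then have "m \<le> x" using class_min_le[OF Q _ m(4)] by blast
    moreover have "m \<noteq> x" using mx nceq_refl[OF t(1) nceq_dom(1)[OF t(1) x(2)]] by blast
    moreover have "nsep x (k + 1) m k" using nceq_nsep[OF t(1) mk x(2) mx] .
    ultimately show False using x(1) unfolding nsep_def by linarith
  qed
qed

lemma PF_path_iff:
  assumes "k \<le> n" "P \<in> noncrossing_partitions (n + 1)" "tail_joined k (brel P)"
  shows "(P, Q) \<in> (PF_steps n k)\<^sup>* \<longleftrightarrow> Q \<in> noncrossing_partitions (n + 1) \<and> brel P \<subseteq> brel Q \<and>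
    tail_joined k (brel Q) \<and> \<not> blocked k (k + 1) (brel P) (brel Q)"
  using PF_path_if[OF assms(1,2)] PF_path_imp[OF assms] assms(3) by blast

section \<open>Restriction to the head and its last pocket\<close>

text \<open>The minimum \<open>m\<close> may lie outside the pocket of the maximum \<open>b\<close>,
  but the last element \<open>\<mu>\<close> of its class in \<open>s\<close> does not: since this
  class starts at the least element of the block, no chord of \<open>s\<close> inside the block
  passes over the gap after \<open>\<mu>\<close>. Elements from \<open>m\<close> up to before
  \<open>\<mu>\<close> are cut off from \<open>b\<close> by the chord
  \<open>m \<mu>\<close>.\<close>

lemma pocket_max_of_least_block:
  assumes H: "finite H" and s: "nceq H s" and p: "nceq H p" and sp: "s \<subseteq> p"
    and bmax: "\<And>x. x \<in> H \<Longrightarrow> x \<le> b"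
    and m: "(m, b) \<in> p" "class_min p m"
  obtains \<mu> where "(\<mu>, b) \<in> pocket s p" "(\<mu>, m) \<in> s"
    "\<And>z. z \<in> H \<Longrightarrow> (z, b) \<in> p \<Longrightarrow> (\<And>w w'. (w, w') \<in> s \<Longrightarrow> nsep w w' z b) \<Longrightarrow> \<mu> \<le> z"
proof -
  have mH: "m \<in> H" using m nceq_dom[OF p] by blast
  define \<mu> where "\<mu> = Max (s `` {m})"
  have fin: "finite (s `` {m})" using H nceq_dom[OF s] by (meson Image_singleton_iff finite_subset subsetI)
  have \<mu>: "(m, \<mu>) \<in> s" using Max_in[OF fin] nceq_refl[OF s mH] unfolding \<mu>_def by blast
  have \<mu>max: "z \<le> \<mu>" if "(m, z) \<in> s" for z using Max_ge[OF fin] that unfolding \<mu>_def by blast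
  have \<mu>b: "(\<mu>, b) \<in> p" using \<mu> m sp nceq_sym[OF p] nceq_trans[OF p] by blast
  have mleast: "m \<le> z" if "(z, b) \<in> p" for z
    using class_min_le[OF p _ m(2)] m(1) that nceq_sym[OF p] nceq_trans[OF p] by blast
  have "nsep w w' \<mu> b" if w: "(w, w') \<in> s" for w w'
  proof (cases "(w, b) \<in> p")
    case False
    then have "(\<mu>, w) \<notin> p" using \<mu>b nceq_sym[OF p] nceq_trans[OF p] by blast
    then show ?thesis using nceq_nsep[OF p \<mu>b, of w w'] w sp by blast
  next
    case True
    have w'b: "(w', b) \<in> p" using True w sp nceq_sym[OF p] nceq_trans[OF p] by blast
    have "\<not> b < w" "\<not> b < w'" using bmax nceq_dom[OF s w] by (auto simp: not_less)
    moreover have "(\<mu> < w) = (\<mu> < w')"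
    proof (cases "(m, w) \<in> s")
      case True
      then have "(m, w') \<in> s" using w nceq_trans[OF s] by blast
      then show ?thesis using True \<mu>max by (simp add: leD)
    next
      case mw: False
      then have "(m, w') \<notin> s" using w nceq_sym[OF s] nceq_trans[OF s] by blast
      then have "m \<noteq> w" "m \<noteq> w'" using mw nceq_refl[OF s mH] by blast+
      then have "m < w" "m < w'" using mleast True w'b le_neq_implies_less by blast+
      then show ?thesis using nceq_nsep[OF s \<mu> w mw] by (simp add: nsep_def)
    qed
    ultimately show ?thesis by (auto simp: nsep_def)
  qed
  then have 1: "(\<mu>, b) \<in> pocket s p" using \<mu>b by (auto simp: pocket_def)
  have 2: "\<mu> \<le> z" if z: "z \<in> H" "(z, b) \<in> p" "\<And>w w'. (w, w') \<in> s \<Longrightarrow> nsep w w' z b" for z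
  proof (rule ccontr)
    assume "\<not> \<mu> \<le> z"
    moreover have "m \<le> z" using mleast z(2) .
    moreover have "\<not> b < m" "\<not> b < \<mu>" using bmax nceq_dom[OF s \<mu>] by (auto simp: not_less)
    ultimately show False using z(3)[OF \<mu>] unfolding nsep_def by auto
  qed
  show ?thesis using that[OF 1 nceq_sym[OF s \<mu>] 2] by blast
qed

lemma singleton_if_class_min_max:
  assumes s: "nceq H s" and bmax: "\<And>x. x \<in> H \<Longrightarrow> x \<le> b" and sb: "class_min s b" and ub: "(u, b) \<in> s"
  shows "u = b"
  using sb ub bmax[of u] nceq_dom[OF s ub] unfolding class_min_def by (metis le_neq_implies_less)

text \<open>Apart from the singleton class of \<open>b\<close>, all chords of \<open>s\<close> end
  at elements up to \<open>a\<close>, so none separates the gaps after \<open>a\<close> and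
  \<open>b\<close>.\<close>

lemma pred_pocket_max:
  assumes s: "nceq H s" and bmax: "\<And>x. x \<in> H \<Longrightarrow> x \<le> b" and amax: "\<And>x. x \<in> H \<Longrightarrow> x < b \<Longrightarrow> x \<le> a"
    and ab: "a < b" and sb: "class_min s b" and tab: "(a, b) \<in> t"
  shows "(a, b) \<in> pocket s t"
proof -
  have "nsep w w' a b" if w: "(w, w') \<in> s" for w w'
  proof (cases "w = b \<or> w' = b")
    case True
    then have "w = w'" using singleton_if_class_min_max[OF s bmax sb] w nceq_sym[OF s] by blast
    then show ?thesis by simp
  next
    case False
    have "w \<le> b" "w' \<le> b" using bmax nceq_dom[OF s w] by blast+
    then have "w \<le> a" "w' \<le> a" using False amax nceq_dom[OF s w] by simp_all
    then show ?thesis using ab by (auto simp: nsep_def)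
  qed
  then show ?thesis using tab by (auto simp: pocket_def)
qed

text \<open>The representative \<open>\<mu>\<close> inside the pocket stands in for a block minimum
  \<open>m\<close> outside it, both in testing whether \<open>b\<close> is minimal and as witness of
  \<open>blocked\<close>; since \<open>\<mu>\<close> and \<open>m\<close> are related in
  \<open>s\<close>, relations above \<open>s\<close> do not distinguish them.\<close>

lemma blocked_pocket_iff:
  assumes H: "finite H" and s: "nceq H s" and t: "nceq H t" 
    and p: "nceq H p" "s \<subseteq> p" "p \<subseteq> t" and q: "nceq H q" "s \<subseteq> q" "q \<subseteq> t"
    and bmax: "\<And>x. x \<in> H \<Longrightarrow> x \<le> b" and amax: "\<And>x. x \<in> H \<Longrightarrow> x < b \<Longrightarrow> x \<le> a" and ab: "a < b"
    and sb: "class_min s b" and tab: "(a, b) \<in> t"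
    and K: "K = pocket s t `` {b}"
  shows "blocked a b p q \<longleftrightarrow> blocked a b (p \<inter> K \<times> K) (q \<inter> K \<times> K)"
proof -
  have bH: "b \<in> H" "a \<in> H" using nceq_dom[OF t tab] by blast+
  note sing = singleton_if_class_min_max[OF s bmax sb]
  have Kiff: "z \<in> K \<longleftrightarrow> (z, b) \<in> pocket s t" for z
    using pocket_sym[OF t] K by blast
  have aK: "a \<in> K" unfolding Kiff by (rule pred_pocket_max[OF s bmax amax ab sb tab])
  have bK: "b \<in> K" unfolding Kiff pocket_def using nceq_refl[OF t bH(1)] by simp
  have one: "class_min p b \<longleftrightarrow> class_min (p \<inter> K \<times> K) b"
  proof
    show "class_min (p \<inter> K \<times> K) b" if "class_min p b" using that class_min_mono by blast
    show "class_min p b" if c: "class_min (p \<inter> K \<times> K) b"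
    proof (rule ccontr)
      assume nb: "\<not> class_min p b"
      obtain m where m: "(m, b) \<in> p" "class_min p m" "m \<le> b" using ex_class_min[OF p(1) bH(1)] by metis
      have mb: "m \<noteq> b" using m nb by blast
      obtain \<mu> where \<mu>: "(\<mu>, b) \<in> pocket s p" "(\<mu>, m) \<in> s"
        using pocket_max_of_least_block[OF H s p(1,2) bmax m(1,2)] by metis
      have "\<mu> \<noteq> b" using \<mu>(2) sing nceq_sym[OF s] mb by blast
      then have "\<mu> < b" using bmax nceq_dom[OF s \<mu>(2)] by (simp add: le_neq_implies_less)
      moreover have "(\<mu>, b) \<in> p" using pocketD(1)[OF \<mu>(1)] .
      moreover have "\<mu> \<in> K" unfolding Kiff using \<mu>(1) pocket_mono[OF p(3)] by blast
      ultimately show False using c bK unfolding class_min_def by blast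
    qed
  qed
  have two: "(\<exists>m. (m, b) \<in> q \<and> class_min q m \<and> (a, m) \<in> p) \<longleftrightarrow>
    (\<exists>m. (m, b) \<in> q \<inter> K \<times> K \<and> class_min (q \<inter> K \<times> K) m \<and> (a, m) \<in> p \<inter> K \<times> K)"
  proof -
    obtain m where m: "(m, b) \<in> q" "class_min q m" using ex_class_min[OF q(1) bH(1)] by metis
    obtain \<mu> where \<mu>: "(\<mu>, b) \<in> pocket s q" "(\<mu>, m) \<in> s"
        "\<And>z. z \<in> H \<Longrightarrow> (z, b) \<in> q \<Longrightarrow> (\<And>w w'. (w, w') \<in> s \<Longrightarrow> nsep w w' z b) \<Longrightarrow> \<mu> \<le> z"
      using pocket_max_of_least_block[OF H s q(1,2) bmax m] by metis
    have \<mu>K: "\<mu> \<in> K" unfolding Kiff using \<mu>(1) pocket_mono[OF q(3)] by blast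
    have \<mu>q: "(\<mu>, b) \<in> q" using pocketD(1)[OF \<mu>(1)] .
    have "K \<subseteq> H" using Kiff pocketD(1)[of _ b s t] nceq_dom(1)[OF t, of _ b] by blast
    then have KH: "nceq K (q \<inter> K \<times> K)"
      by (rule nceq_restrict[OF q(1)])
    have \<mu>min: "class_min (q \<inter> K \<times> K) \<mu>"
      unfolding class_min_def
    proof (intro allI impI notI)
      fix z assume z: "z < \<mu>" "(z, \<mu>) \<in> q \<inter> K \<times> K"
      then have "(z, b) \<in> q" using \<mu>q nceq_trans[OF q(1)] by blast
      moreover have "z \<in> H" using z nceq_dom[OF q(1)] by blast
      ultimately have "\<mu> \<le> z" using \<mu>(3)[of z] z Kiff[of z] pocketD(2) by blast
      then show False using z by simp
    qed
    have "(a, m) \<in> p \<longleftrightarrow> (a, \<mu>) \<in> p" using \<mu>(2) p(2) nceq_sym[OF p(1)] nceq_trans[OF p(1)] by blast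
    moreover have "m' = m" if "(m', b) \<in> q" "class_min q m'" for m'
      using class_min_unique[OF q(1) _ that(2) m(2)] that m nceq_sym[OF q(1)] nceq_trans[OF q(1)] by blast
    moreover have "m' = \<mu>" if "(m', b) \<in> q \<inter> K \<times> K" "class_min (q \<inter> K \<times> K) m'" for m'
    proof (rule class_min_unique[OF KH _ that(2) \<mu>min])
      show "(m', \<mu>) \<in> q \<inter> K \<times> K" using that \<mu>q \<mu>K nceq_sym[OF q(1)] nceq_trans[OF q(1)] by blast
    qed
    ultimately show ?thesis using m \<mu>min \<mu>q \<mu>K aK bK by blast
  qed
  show ?thesis unfolding blocked_def one two using aK bK by blast
qed

text \<open>Besides \<open>a\<close> and \<open>b\<close> the pocket contains \<open>\<mu>\<close>.
  It is not \<open>a\<close>, since otherwise \<open>a\<close> would be joined to the minimum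
  \<open>m\<close> in \<open>s\<close> and the pair would be blocked; it is not \<open>b\<close>,
  since \<open>b\<close> is alone in its class of \<open>s\<close>.\<close>

lemma card_pocket_not_blocked:
  assumes H: "finite H" and s: "nceq H s" and t: "nceq H t" and st: "s \<subseteq> t"
    and bmax: "\<And>x. x \<in> H \<Longrightarrow> x \<le> b" and amax: "\<And>x. x \<in> H \<Longrightarrow> x < b \<Longrightarrow> x \<le> a" and ab: "a < b"
    and sb: "class_min s b" and tab: "(a, b) \<in> t" and nb: "\<not> blocked a b s t"
    and K: "K = pocket s t `` {b}"
  shows "3 \<le> card K" "a \<in> K" "b \<in> K" "K \<subseteq> H"
proof -
  have bH: "b \<in> H" "a \<in> H" using nceq_dom[OF t tab] by blast+
  note sing = singleton_if_class_min_max[OF s bmax sb]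
  have Kiff: "z \<in> K \<longleftrightarrow> (z, b) \<in> pocket s t" for z
    using pocket_sym[OF t] K by blast
  show aK: "a \<in> K" unfolding Kiff by (rule pred_pocket_max[OF s bmax amax ab sb tab])
  show bK: "b \<in> K" unfolding Kiff pocket_def using nceq_refl[OF t bH(1)] by simp
  show KH: "K \<subseteq> H" using Kiff pocketD(1) nceq_dom[OF t] by blast
  obtain m where m: "(m, b) \<in> t" "class_min t m" using ex_class_min[OF t bH(1)] by metis
  obtain \<mu> where \<mu>: "(\<mu>, b) \<in> pocket s t" "(\<mu>, m) \<in> s"
    using pocket_max_of_least_block[OF H s t st bmax m] by metis
  have "(a, m) \<notin> s" using nb sb tab m by (auto simp: blocked_def)
  then have "\<mu> \<noteq> a" using \<mu> by blast
  moreover have "m \<noteq> b" using m(2) tab ab by (auto simp: class_min_def)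
  then have "\<mu> \<noteq> b" using \<mu>(2) sing nceq_sym[OF s] by blast
  ultimately have "card {\<mu>, a, b} = 3" using ab by simp
  moreover have "{\<mu>, a, b} \<subseteq> K" using Kiff \<mu> aK bK by blast
  ultimately show "3 \<le> card K" using card_mono[of K] KH H finite_subset by metis
qed

text \<open>Being a class minimum only concerns smaller elements, and the minimum of the block of
  \<open>b\<close> does not exceed \<open>b\<close>.\<close>

lemma blocked_restrict:
  assumes p: "nceq A p" and q: "nceq A q" and H: "H = A \<inter> {..b}" and ab: "a < b"
  shows "blocked a b p q \<longleftrightarrow> blocked a b (p \<inter> H \<times> H) (q \<inter> H \<times> H)"
proof -
  have cm: "class_min r m \<longleftrightarrow> class_min (r \<inter> H \<times> H) m" if "m \<le> b" "nceq A r" for r m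
    using that nceq_dom[OF that(2)] unfolding class_min_def H by fastforce
  have "class_min (q \<inter> H \<times> H) m \<longleftrightarrow> class_min q m" if "(m, b) \<in> q \<inter> H \<times> H" for m
    using cm[OF _ q, of m] that H by auto
  moreover have "(m, b) \<in> q \<longleftrightarrow> (m, b) \<in> q \<inter> H \<times> H" if "class_min q m" for m
    using class_min_le[OF q _ that] nceq_dom[OF q] H by auto
  moreover have "(a, m) \<in> p \<longleftrightarrow> (a, m) \<in> p \<inter> H \<times> H" if "m \<le> b" for m
    using nceq_dom[OF p] that ab H by auto
  moreover have "(a, b) \<in> q \<longleftrightarrow> (a, b) \<in> q \<inter> H \<times> H" using nceq_dom[OF q] ab H by auto
  moreover have "class_min p b \<longleftrightarrow> class_min (p \<inter> H \<times> H) b" using cm[OF _ p] by simp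
  moreover have "m \<le> b" if "(m, b) \<in> q \<inter> H \<times> H" for m using that H by auto
  ultimately show ?thesis unfolding blocked_def by meson
qed

text \<open>A pair whose larger element \<open>v\<close> exceeds \<open>k + 1\<close> factors
  through \<open>v - 1\<close> by \<open>tail_joined\<close>, so the induction descends to the
  head.\<close>

lemma subset_if_head_subset:
  assumes p: "nceq A p" and q: "nceq A q" and tp: "tail_joined k p"
    and head: "\<And>u v. u \<le> k + 1 \<Longrightarrow> v \<le> k + 1 \<Longrightarrow> (u, v) \<in> p \<Longrightarrow> (u, v) \<in> q"
    and tail: "\<And>x. k + 1 < x \<Longrightarrow> (x - 1, x) \<in> p \<Longrightarrow> (x - 1, x) \<in> q"
  shows "p \<subseteq> q"
proof -
  have less: "(u, v) \<in> q" if "u < v" "(u, v) \<in> p" for u v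
    using that
  proof (induction v arbitrary: u rule: less_induct)
    case (less v)
    show ?case
    proof (cases "v \<le> k + 1")
      case True
      then show ?thesis using head less.prems by simp
    next
      case False
      moreover have "\<not> class_min p v" using less.prems by (auto simp: class_min_def)
      ultimately have vp: "(v - 1, v) \<in> p" using tp by (simp add: tail_joined_def)
      then have vq: "(v - 1, v) \<in> q" using tail False by simp
      show ?thesis
      proof (cases "u = v - 1")
        case False
        have "(u, v - 1) \<in> p" using less.prems(2) vp nceq_sym[OF p] nceq_trans[OF p] by blast
        then have "(u, v - 1) \<in> q" using less.IH[of "v - 1" u] False less.prems(1) by simp
        then show ?thesis using vq nceq_trans[OF q] by blast
      qed (use vq in simp)
    qed
  qed
  show ?thesis
  proof (rule subrelI)
    fix u v assume uv: "(u, v) \<in> p"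
    consider "u < v" | "v < u" | "u = v" by linarith
    then show "(u, v) \<in> q"
    proof cases
      case 1
      then show ?thesis using less uv by blast
    next
      case 2
      then show ?thesis using less[of v u] uv nceq_sym[OF p] nceq_sym[OF q] by blast
    next
      case 3
      then show ?thesis using nceq_refl[OF q] nceq_dom[OF p uv] by blast
    qed
  qed
qed

text \<open>With \<open>J x\<close> read as gluing \<open>x\<close> to \<open>x - 1\<close>, this is
  the weakly increasing retraction that collapses each run of glued elements to its first
  one.\<close>

primrec run_start :: "(nat \<Rightarrow> bool) \<Rightarrow> nat \<Rightarrow> nat" where
  "run_start J 0 = 0"
| "run_start J (Suc x) = (if J (Suc x) then run_start J x else Suc x)"

lemma run_start_le: "run_start J x \<le> x"
  by (induction x) auto

lemma run_start_mono: "x \<le> y \<Longrightarrow> run_start J x \<le> run_start J y"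
proof (induction y rule: dec_induct)
  case (step y)
  then show ?case using run_start_le[of J x] by auto
qed simp

lemma run_start_eq: "\<not> J x \<Longrightarrow> run_start J x = x"
  by (cases x) auto

lemma run_start_pred: "J x \<Longrightarrow> 0 < x \<Longrightarrow> run_start J x = run_start J (x - 1)"
  by (cases x) auto

text \<open>The extension is the pullback along \<open>run_start J\<close> of \<open>p1\<close> with
  singletons added above the head. Pullback along a weakly increasing map preserves noncrossing, as
  points of different classes have different images.\<close>

lemma ex_tail_extension:
  assumes A: "A = {1..n + 1}" and H: "H = {1..k + 1}" and k: "k \<le> n" and p1: "nceq H p1"
    and J: "\<And>x. J x \<Longrightarrow> k + 1 < x"
  obtains p where "nceq A p" "tail_joined k p" "p \<inter> H \<times> H = p1"
    "\<And>x. x \<in> A \<Longrightarrow> k + 1 < x \<Longrightarrow> (x - 1, x) \<in> p \<longleftrightarrow> J x"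
proof -
  define g where "g = run_start J"
  have gH: "g x = x" if "x \<in> H" for x
    using that run_start_eq[of J x] J[of x] H unfolding g_def by force
  have gmono: "(x < y) = (g x < g y)" if "g x \<noteq> g y" for x y
    using run_start_mono[of x y J] run_start_mono[of y x J] that unfolding g_def by linarith
  define p where "p = {(u, v). u \<in> A \<and> v \<in> A \<and> ((g u, g v) \<in> p1 \<or> g u = g v)}"
  have nJ: "g x = x" "x \<notin> H" if "k + 1 < x" "\<not> J x" for x
    using run_start_eq that H unfolding g_def by auto
  have p: "nceq A p"
  proof (rule nceqI)
    show "(x, z) \<in> p" if "(x, y) \<in> p" "(y, z) \<in> p" for x y z
      using that nceq_trans[OF p1] unfolding p_def by auto
    show "(y, x) \<in> p" if "(x, y) \<in> p" for x y
      using that nceq_sym[OF p1] unfolding p_def by auto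
    fix a b c d assume ac: "(a, c) \<in> p" and bd: "(b, d) \<in> p" and ab: "(a, b) \<notin> p"
    have A': "a \<in> A" "b \<in> A" using ac bd by (auto simp: p_def)
    have gab: "(g a, g b) \<notin> p1" "g a \<noteq> g b" using ab A' by (auto simp: p_def)
    have gac: "(g a, g c) \<in> p1 \<or> g a = g c" and gbd: "(g b, g d) \<in> p1 \<or> g b = g d"
      using ac bd by (auto simp: p_def)
    have neq: "g a \<noteq> g d" "g c \<noteq> g b" "g c \<noteq> g d"
      using gab gac gbd nceq_sym[OF p1] nceq_trans[OF p1] by metis+
    have "nsep (g b) (g d) (g a) (g c)"
      using gac gbd nceq_nsep[OF p1 _ _ gab(1)] by auto
    then show "nsep b d a c"
      unfolding nsep_def using gmono neq gab(2) by metis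
  qed (auto simp: p_def)
  have HA: "H \<subseteq> A" using H A k by auto
  have "p \<inter> H \<times> H = p1"
    using gH HA nceq_refl[OF p1] nceq_dom[OF p1] unfolding p_def by auto
  moreover have iff: "(x - 1, x) \<in> p \<longleftrightarrow> J x" if x: "x \<in> A" "k + 1 < x" for x
  proof
    assume "J x"
    then have "g x = g (x - 1)" using run_start_pred x unfolding g_def by simp
    then show "(x - 1, x) \<in> p" using x A unfolding p_def by auto
  next
    assume px: "(x - 1, x) \<in> p"
    show "J x"
    proof (rule ccontr)
      assume "\<not> J x"
      then have "g (x - 1) = x" using nJ[of x] px x nceq_dom[OF p1] unfolding p_def by auto
      then show False using run_start_le[of J "x - 1"] x unfolding g_def by simp
    qed
  qed
  moreover have "tail_joined k p"
    unfolding tail_joined_def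
  proof (intro allI impI)
    fix x assume x: "k + 1 < x" "\<not> class_min p x"
    then obtain u where u: "u < x" "(u, x) \<in> p" by (auto simp: class_min_def)
    have "J x"
    proof (rule ccontr)
      assume "\<not> J x"
      then have "g u = x" using nJ[of x] u x nceq_dom[OF p1] unfolding p_def by auto
      then show False using run_start_le[of J u] u unfolding g_def by simp
    qed
    then show "(x - 1, x) \<in> p" using iff[OF _ x(1)] nceq_dom[OF p u(2)] by blast
  qed
  ultimately show ?thesis using that p by blast
qed

section \<open>Decomposition of intervals into cells\<close>

text \<open>A relation satisfying \<open>tail_joined k\<close> is determined by its restriction to \<open>{1..k + 1}\<close> and the set of
  \<open>x > k + 1\<close> joined to \<open>x - 1\<close>; each undecided such \<open>x\<close> contributes a factor \<open>NC_poset 2\<close>.\<close>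

definition head_cells :: "nat \<Rightarrow> nat rel \<Rightarrow> nat rel \<Rightarrow> nat set set" where
  "head_cells k s t = (let H = {1..k + 1} in H // pocket (s \<inter> H \<times> H) (t \<inter> H \<times> H))"

definition tail_cells :: "nat \<Rightarrow> nat rel \<Rightarrow> nat rel \<Rightarrow> nat set set" where
  "tail_cells k s t = (\<lambda>x. {x - 1, x}) ` {x. k + 1 < x \<and> (x - 1, x) \<in> t \<and> (x - 1, x) \<notin> s}"

definition cells :: "nat \<Rightarrow> nat rel \<Rightarrow> nat rel \<Rightarrow> nat set set" where
  "cells k s t = head_cells k s t \<union> tail_cells k s t"

lemma cells_subset:
  assumes A: "A = {1..n + 1}" "k \<le> n" and t: "nceq A t" and K: "K \<in> cells k s t"
  shows "K \<subseteq> A" "K \<noteq> {}"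
proof -
  let ?H = "{1..k + 1}"
  have HA: "?H \<subseteq> A" using A by auto
  have e: "equiv ?H (pocket (s \<inter> ?H \<times> ?H) (t \<inter> ?H \<times> ?H))"
    by (rule equiv_pocket[OF nceq_restrict[OF t HA]])
  have "K \<subseteq> A \<and> K \<noteq> {}"
  proof (cases "K \<in> head_cells k s t")
    case True
    then have K: "K \<in> ?H // pocket (s \<inter> ?H \<times> ?H) (t \<inter> ?H \<times> ?H)" by (simp add: head_cells_def Let_def)
    show ?thesis using in_quotient_imp_subset[OF e K] in_quotient_imp_non_empty[OF e K] HA by blast
  next
    case False
    then obtain x where "K = {x - 1, x}" "(x - 1, x) \<in> t" using K by (auto simp: cells_def tail_cells_def)
    then show ?thesis using nceq_dom[OF t] by blast
  qed
  then show "K \<subseteq> A" "K \<noteq> {}" by blast+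
qed

text \<open>The head is recovered pocket by pocket, the tail from its pairs
  \<open>(x - 1, x)\<close>; a tail pair in \<open>s\<close> lies in both relations anyway and so
  gets no cell.\<close>

lemma subset_iff_cells:
  assumes A: "A = {1..n + 1}" "k \<le> n" and s: "nceq A s" and p: "nceq A p" "tail_joined k p" and q: "nceq A q"
    and sub: "s \<subseteq> p" "s \<subseteq> q" "p \<subseteq> t"
  shows "p \<subseteq> q \<longleftrightarrow> (\<forall>K\<in>cells k s t. p \<inter> K \<times> K \<subseteq> q \<inter> K \<times> K)"
proof (intro iffI)
  assume cell: "\<forall>K\<in>cells k s t. p \<inter> K \<times> K \<subseteq> q \<inter> K \<times> K"
  let ?H = "{1..k + 1}"
  let ?r = "\<lambda>r. r \<inter> ?H \<times> ?H"
  have HA: "?H \<subseteq> A" using A by auto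
  show "p \<subseteq> q"
  proof (rule subset_if_head_subset[OF p(1) q p(2)])
    have "?r p \<subseteq> ?r q"
    proof (rule subset_if_pocket_subset[of ?H "?r s" _ _ "?r t"])
      show "?r p \<inter> pocket (?r s) (?r t) \<subseteq> ?r q"
      proof (rule subrelI)
        fix u v assume uv: "(u, v) \<in> ?r p \<inter> pocket (?r s) (?r t)"
        define K where "K = pocket (?r s) (?r t) `` {u}"
        have "K \<in> ?H // pocket (?r s) (?r t)" using uv unfolding K_def by (intro quotientI) blast
        then have "K \<in> cells k s t" by (simp add: cells_def head_cells_def Let_def)
        moreover have "(u, u) \<in> pocket (?r s) (?r t)"
        proof -
          have "(u, u) \<in> ?r p" using uv nceq_refl[OF p(1)] HA by blast
          then have "(u, u) \<in> ?r t" using sub(3) by blast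
          then show ?thesis by (simp add: pocket_def)
        qed
        then have "u \<in> K" "v \<in> K" using uv unfolding K_def by blast+
        ultimately show "(u, v) \<in> ?r q" using cell uv by blast
      qed
    qed (use nceq_restrict[OF s HA] nceq_restrict[OF p(1) HA] nceq_restrict[OF q HA] sub in auto)
    then show "(u, v) \<in> q" if "u \<le> k + 1" "v \<le> k + 1" "(u, v) \<in> p" for u v
      using that nceq_dom[OF p(1) that(3)] A by auto
    show "(x - 1, x) \<in> q" if x: "k + 1 < x" "(x - 1, x) \<in> p" for x
    proof (cases "(x - 1, x) \<in> s")
      case False
      then have "{x - 1, x} \<in> cells k s t" using x sub by (auto simp: cells_def tail_cells_def)
      then show ?thesis using cell x by blast
    qed (use sub in blast)
  qed
qed blast

lemma nceq_pair_eq: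
  assumes "nceq {x, y} r" "nceq {x, y} r'" "(x, y) \<in> r \<longleftrightarrow> (x, y) \<in> r'"
  shows "r = r'"
proof -
  have "(u, v) \<in> r \<longleftrightarrow> (u, v) \<in> r'" for u v
  proof (cases "u \<in> {x, y} \<and> v \<in> {x, y}")
    case True
    have "(y, x) \<in> r \<longleftrightarrow> (y, x) \<in> r'"
      using assms(3) nceq_sym[OF assms(1)] nceq_sym[OF assms(2)] by blast
    moreover have "(x, x) \<in> r" "(y, y) \<in> r" "(x, x) \<in> r'" "(y, y) \<in> r'"
      using nceq_refl[OF assms(1)] nceq_refl[OF assms(2)] by blast+
    ultimately show ?thesis using True assms(3) by blast
  next
    case False
    then show ?thesis using nceq_dom[OF assms(1)] nceq_dom[OF assms(2)] by blast
  qed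
  then show ?thesis by auto
qed

text \<open>The choices in the cells are independent: those in the pockets glue to a relation on the
  head, to which the tail is attached as prescribed by \<open>J\<close>.\<close>

lemma ex_nceq_cells:
  assumes A: "A = {1..n + 1}" "k \<le> n" and s: "nceq A s" "tail_joined k s" and t: "nceq A t" and st: "s \<subseteq> t"
    and \<rho>: "\<And>K. K \<in> cells k s t \<Longrightarrow> nceq K (\<rho> K)"
  obtains p where "nceq A p" "tail_joined k p" "s \<subseteq> p" "p \<subseteq> t" "\<And>K. K \<in> cells k s t \<Longrightarrow> p \<inter> K \<times> K = \<rho> K"
proof -
  define H where "H = {1..k + 1}"
  define s1 t1 where "s1 = s \<inter> H \<times> H" and "t1 = t \<inter> H \<times> H"
  let ?E = "pocket s1 t1"
  have HA: "H \<subseteq> A" using A by (auto simp: H_def)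
  have s1: "nceq H s1" and t1: "nceq H t1" unfolding s1_def t1_def using nceq_restrict s t HA by blast+
  have st1: "s1 \<subseteq> t1" using st by (auto simp: s1_def t1_def)
  note E = equiv_pocket[OF t1, of s1]
  have hc: "K \<in> H // ?E \<Longrightarrow> K \<in> cells k s t" for K
    by (simp add: cells_def head_cells_def Let_def H_def s1_def t1_def)
  define \<rho>1 where "\<rho>1 = (\<Union>K\<in>H // ?E. \<rho> K)"
  have \<rho>1: "(u, v) \<in> \<rho>1 \<longleftrightarrow> (u, v) \<in> \<rho> K" if "K \<in> H // ?E" "u \<in> K \<or> v \<in> K" for u v K
  proof
    assume "(u, v) \<in> \<rho>1"
    then obtain K' where K': "K' \<in> H // ?E" "(u, v) \<in> \<rho> K'" by (auto simp: \<rho>1_def)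
    then have "u \<in> K'" "v \<in> K'" using nceq_dom[OF \<rho>[OF hc]] by blast+
    then have "K' = K" using quotient_disj[OF E K'(1) that(1)] that(2) by blast
    then show "(u, v) \<in> \<rho> K" using K' by simp
  qed (use that in \<open>auto simp: \<rho>1_def\<close>)
  have cls: "\<exists>K\<in>H // ?E. u \<in> K \<and> v \<in> K \<and> (u, v) \<in> \<rho> K" if uv: "(u, v) \<in> \<rho>1" for u v
  proof -
    obtain K where K: "K \<in> H // ?E" "(u, v) \<in> \<rho> K" using uv by (auto simp: \<rho>1_def)
    then show ?thesis using nceq_dom[OF \<rho>[OF hc[OF K(1)]] K(2)] by blast
  qed
  have e1: "equiv H \<rho>1"
  proof (intro equivI refl_onI symI transI)
    show "\<rho>1 \<subseteq> H \<times> H" using cls in_quotient_imp_subset[OF E] by fastforce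
    show "(x, x) \<in> \<rho>1" if "x \<in> H" for x
    proof -
      have "?E `` {x} \<in> H // ?E" "x \<in> ?E `` {x}" using quotientI that equiv_class_self[OF E] by fast+
      then show ?thesis using \<rho>1 nceq_refl[OF \<rho>[OF hc]] by blast
    qed
    show "(y, x) \<in> \<rho>1" if "(x, y) \<in> \<rho>1" for x y
      using cls[OF that] nceq_sym[OF \<rho>[OF hc]] unfolding \<rho>1_def by blast
    show "(x, z) \<in> \<rho>1" if xy: "(x, y) \<in> \<rho>1" and yz: "(y, z) \<in> \<rho>1" for x y z
    proof -
      obtain K where K: "K \<in> H // ?E" "x \<in> K" "y \<in> K" "(x, y) \<in> \<rho> K" using cls[OF xy] by blast
      have "(y, z) \<in> \<rho> K" using \<rho>1[OF K(1)] K(3) yz by blast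
      then show ?thesis using nceq_trans[OF \<rho>[OF hc[OF K(1)]] K(4)] K(1) unfolding \<rho>1_def by blast
    qed
  qed
  have sub1: "\<rho>1 \<subseteq> ?E"
  proof (rule subrelI)
    fix u v assume "(u, v) \<in> \<rho>1"
    then show "(u, v) \<in> ?E" using cls in_quotient_imp_in_rel[OF E] by fastforce
  qed
  have res: "\<rho>1 \<inter> K \<times> K = \<rho> K" if "K \<in> H // ?E" for K
    using \<rho>1[OF that] nceq_dom[OF \<rho>[OF hc[OF that]]] by auto
  have nc1: "nceq K (\<rho>1 \<inter> K \<times> K)" if "K \<in> H // ?E" for K
    using \<rho>[OF hc[OF that]] res[OF that] by simp
  have finH: "finite H" by (simp add: H_def)
  obtain p1 where p1: "nceq H p1" "s1 \<subseteq> p1" "p1 \<subseteq> t1" "p1 \<inter> ?E = \<rho>1"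
    using ex_nceq_pocket[OF finH s1 t1 st1 e1 sub1 nc1] by blast
  \<comment> \<open>Tail pairs in \<open>s\<close> must be kept and those outside \<open>t\<close>
    avoided; \<open>\<rho>\<close> decides exactly on the tail cells.\<close>
  define J where "J x \<longleftrightarrow> k + 1 < x \<and> (x - 1, x) \<in> t \<and> ((x - 1, x) \<in> s \<or> (x - 1, x) \<in> \<rho> {x - 1, x})" for x
  obtain p where p: "nceq A p" "tail_joined k p" "p \<inter> H \<times> H = p1"
    "\<And>x. x \<in> A \<Longrightarrow> k + 1 < x \<Longrightarrow> (x - 1, x) \<in> p \<longleftrightarrow> J x"
    using ex_tail_extension[OF A(1) H_def A(2) p1(1), of J] unfolding J_def by blast
  have inH: "u \<in> H" if "u \<in> A" "u \<le> k + 1" for u using that A by (auto simp: H_def)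
  have sp: "s \<subseteq> p"
  proof (rule subset_if_head_subset[OF s(1) p(1) s(2)])
    show "(u, v) \<in> p" if "u \<le> k + 1" "v \<le> k + 1" "(u, v) \<in> s" for u v
      using that inH nceq_dom[OF s(1)] p(3) p1(2) unfolding s1_def by blast
    show "(x - 1, x) \<in> p" if "k + 1 < x" "(x - 1, x) \<in> s" for x
      using p(4)[of x] that nceq_dom[OF s(1)] st unfolding J_def by blast
  qed
  have pt: "p \<subseteq> t"
  proof (rule subset_if_head_subset[OF p(1) t p(2)])
    show "(u, v) \<in> t" if "u \<le> k + 1" "v \<le> k + 1" "(u, v) \<in> p" for u v
      using that inH nceq_dom[OF p(1)] p(3) p1(3) unfolding t1_def by blast
    show "(x - 1, x) \<in> t" if "k + 1 < x" "(x - 1, x) \<in> p" for x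
      using p(4)[of x] that nceq_dom[OF p(1)] unfolding J_def by blast
  qed
  have cell: "p \<inter> K \<times> K = \<rho> K" if K: "K \<in> cells k s t" for K
  proof (cases "K \<in> H // ?E")
    case True
    have "K \<subseteq> H" using in_quotient_imp_subset[OF E True] .
    moreover have "K \<times> K \<subseteq> ?E" using in_quotient_imp_in_rel[OF E True] by blast
    ultimately have "p \<inter> K \<times> K = \<rho>1 \<inter> K \<times> K" using p(3) p1(4) by blast
    then show ?thesis using res[OF True] by simp
  next
    case False
    then have "K \<in> tail_cells k s t"
      using K by (simp add: cells_def head_cells_def Let_def H_def s1_def t1_def)
    then obtain x where x: "K = {x - 1, x}" "k + 1 < x" "(x - 1, x) \<in> t" "(x - 1, x) \<notin> s"
      by (auto simp: tail_cells_def)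
    have xA: "x \<in> A" "{x - 1, x} \<subseteq> A" using nceq_dom[OF t x(3)] by blast+
    have "(x - 1, x) \<in> p \<longleftrightarrow> (x - 1, x) \<in> \<rho> K" using p(4)[OF xA(1) x(2)] x unfolding J_def by blast
    then show ?thesis
      using nceq_pair_eq[of "x - 1" x "p \<inter> K \<times> K" "\<rho> K"] nceq_restrict[OF p(1) xA(2)] \<rho>[OF K] x(1) by auto
  qed
  show ?thesis by (rule that[OF p(1,2) sp pt cell])
qed

section \<open>Transport of cells to initial segments\<close>

definition relabel :: "(nat \<Rightarrow> nat) \<Rightarrow> nat \<Rightarrow> nat rel \<Rightarrow> nat set set" where
  "relabel e m r = {1..m} // {(i, j). i \<in> {1..m} \<and> j \<in> {1..m} \<and> (e i, e j) \<in> r}"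

definition enumerates :: "(nat \<Rightarrow> nat) \<Rightarrow> nat \<Rightarrow> nat set \<Rightarrow> bool" where
  "enumerates e m K \<longleftrightarrow> bij_betw e {1..m} K \<and> strict_mono_on {1..m} e"

lemma ex_enumerates:
  assumes "finite K"
  obtains e where "enumerates e (card K) K"
proof -
  obtain h where h: "bij_betw h {..<card K} K" "strict_mono_on {..<card K} h"
    using ex_bij_betw_strict_mono_card[OF assms] .
  have b: "bij_betw (\<lambda>i. i - 1) {1..card K} {..<card K}"
    by (rule bij_betwI[where g = Suc]) auto
  have "bij_betw (h \<circ> (\<lambda>i. i - 1)) {1..card K} K" by (rule bij_betw_trans[OF b h(1)])
  moreover have "strict_mono_on {1..card K} (h \<circ> (\<lambda>i. i - 1))"
  proof (rule strict_mono_onI)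
    fix i j assume "i \<in> {1..card K}" "j \<in> {1..card K}" "i < j"
    then have "i - 1 \<in> {..<card K}" "j - 1 \<in> {..<card K}" "i - 1 < j - 1" by auto
    then show "(h \<circ> (\<lambda>i. i - 1)) i < (h \<circ> (\<lambda>i. i - 1)) j"
      using strict_mono_onD[OF h(2)] by simp
  qed
  ultimately show ?thesis using that unfolding enumerates_def by blast
qed

lemma enumerates_less_iff:
  assumes "enumerates e m K" "i \<in> {1..m}" "j \<in> {1..m}"
  shows "e i < e j \<longleftrightarrow> i < j" "e i = e j \<longleftrightarrow> i = j"
  using assms strict_mono_on_less[of "{1..m}" e i j] strict_mono_on_eq[of "{1..m}" e i j]
  unfolding enumerates_def by blast+

lemma enumerates_image:
  assumes "enumerates e m K"
  shows "i \<in> {1..m} \<Longrightarrow> e i \<in> K" "x \<in> K \<Longrightarrow> \<exists>i\<in>{1..m}. e i = x"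
  using assms unfolding enumerates_def bij_betw_def by blast+

lemma nceq_relabel:
  assumes e: "enumerates e m K" and r: "nceq K (r \<inter> K \<times> K)"
  shows "nceq {1..m} {(i, j). i \<in> {1..m} \<and> j \<in> {1..m} \<and> (e i, e j) \<in> r}" (is "nceq _ ?R")
proof -
  have iff: "(i, j) \<in> ?R \<longleftrightarrow> i \<in> {1..m} \<and> j \<in> {1..m} \<and> (e i, e j) \<in> r \<inter> K \<times> K" for i j
    using enumerates_image(1)[OF e] by blast
  show ?thesis
  proof (rule nceqI)
    show "(x, x) \<in> ?R" if "x \<in> {1..m}" for x
      using that nceq_refl[OF r] enumerates_image(1)[OF e] unfolding iff by blast
    show "(y, x) \<in> ?R" if "(x, y) \<in> ?R" for x y
      using that nceq_sym[OF r] unfolding iff by blast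
    show "(x, z) \<in> ?R" if "(x, y) \<in> ?R" "(y, z) \<in> ?R" for x y z
      using that nceq_trans[OF r] unfolding iff by blast
    show "x \<in> {1..m}" if "(x, y) \<in> ?R" for x y using that unfolding iff by blast
    fix a b c d assume R: "(a, c) \<in> ?R" "(b, d) \<in> ?R" "(a, b) \<notin> ?R"
    then have m: "a \<in> {1..m}" "b \<in> {1..m}" "c \<in> {1..m}" "d \<in> {1..m}" unfolding iff by blast+
    have "nsep (e b) (e d) (e a) (e c)"
      using R m nceq_nsep[OF r, of "e a" "e c" "e b" "e d"] unfolding iff by blast
    then show "nsep b d a c" unfolding nsep_def using enumerates_less_iff(1)[OF e] m by simp
  qed
qed

lemma relabel_noncrossing:
  assumes e: "enumerates e m K" and r: "nceq K (r \<inter> K \<times> K)"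
  shows "relabel e m r \<in> noncrossing_partitions m"
    and "brel (relabel e m r) = {(i, j). i \<in> {1..m} \<and> j \<in> {1..m} \<and> (e i, e j) \<in> r}"
  using quotient_noncrossing[OF nceq_relabel[OF assms]] brel_quotient nceq_relabel[OF assms]
  unfolding relabel_def nceq_def by blast+

lemma relabel_subset_iff:
  assumes e: "enumerates e m K" and r: "nceq K (r \<inter> K \<times> K)" and r': "nceq K (r' \<inter> K \<times> K)"
  shows "brel (relabel e m r) \<subseteq> brel (relabel e m r') \<longleftrightarrow> r \<inter> K \<times> K \<subseteq> r' \<inter> K \<times> K"
proof
  assume L: "brel (relabel e m r) \<subseteq> brel (relabel e m r')"
  show "r \<inter> K \<times> K \<subseteq> r' \<inter> K \<times> K"
  proof (rule subrelI)
    fix x y assume xy: "(x, y) \<in> r \<inter> K \<times> K"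
    then obtain i j where "i \<in> {1..m}" "j \<in> {1..m}" "e i = x" "e j = y"
      using enumerates_image(2)[OF e] by blast
    then show "(x, y) \<in> r' \<inter> K \<times> K"
      using L xy unfolding relabel_noncrossing(2)[OF e r] relabel_noncrossing(2)[OF e r'] by blast
  qed
next
  assume R: "r \<inter> K \<times> K \<subseteq> r' \<inter> K \<times> K"
  then show "brel (relabel e m r) \<subseteq> brel (relabel e m r')"
    using enumerates_image(1)[OF e]
    unfolding relabel_noncrossing(2)[OF e r] relabel_noncrossing(2)[OF e r'] by blast
qed

lemma ex_relabel:
  assumes e: "enumerates e m K" and P: "P \<in> noncrossing_partitions m"
  shows "\<exists>\<rho>. nceq K \<rho> \<and> (\<forall>r. r \<inter> K \<times> K = \<rho> \<longrightarrow> relabel e m r = P)"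
proof -
  note Pn = noncrossing_nceq[OF P]
  define \<rho> where "\<rho> = {(e i, e j) | i j. (i, j) \<in> brel P}"
  have iff: "(e i, e j) \<in> \<rho> \<longleftrightarrow> (i, j) \<in> brel P" if "i \<in> {1..m}" "j \<in> {1..m}" for i j
  proof
    assume "(e i, e j) \<in> \<rho>"
    then obtain i' j' where ij: "e i = e i'" "e j = e j'" "(i', j') \<in> brel P" by (auto simp: \<rho>_def)
    have "i = i'" "j = j'" using ij nceq_dom[OF Pn ij(3)] that enumerates_less_iff(2)[OF e] by blast+
    then show "(i, j) \<in> brel P" using ij by simp
  qed (auto simp: \<rho>_def)
  have K: "\<exists>i\<in>{1..m}. x = e i" if "x \<in> K" for x using enumerates_image(2)[OF e that] by blast
  have \<rho>e: "\<exists>i\<in>{1..m}. \<exists>j\<in>{1..m}. x = e i \<and> y = e j \<and> (i, j) \<in> brel P" if "(x, y) \<in> \<rho>" for x y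
    using that nceq_dom[OF Pn] unfolding \<rho>_def by blast
  have "nceq K \<rho>"
  proof (rule nceqI)
    show "(x, x) \<in> \<rho>" if "x \<in> K" for x using K[OF that] nceq_refl[OF Pn] unfolding \<rho>_def by blast
    show "(y, x) \<in> \<rho>" if "(x, y) \<in> \<rho>" for x y using \<rho>e[OF that] nceq_sym[OF Pn] unfolding \<rho>_def by blast
    show "x \<in> K" if "(x, y) \<in> \<rho>" for x y using \<rho>e[OF that] enumerates_image(1)[OF e] by blast
    show "(x, z) \<in> \<rho>" if xy: "(x, y) \<in> \<rho>" and yz: "(y, z) \<in> \<rho>" for x y z
    proof -
      obtain i j where ij: "i \<in> {1..m}" "j \<in> {1..m}" "x = e i" "y = e j" "(i, j) \<in> brel P" using \<rho>e[OF xy] by blast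
      obtain l h where lh: "l \<in> {1..m}" "h \<in> {1..m}" "y = e l" "z = e h" "(l, h) \<in> brel P" using \<rho>e[OF yz] by blast
      have "j = l" using ij lh enumerates_less_iff(2)[OF e] by metis
      then show ?thesis using ij lh nceq_trans[OF Pn] unfolding \<rho>_def by blast
    qed
    fix a b c d assume ac: "(a, c) \<in> \<rho>" and bd: "(b, d) \<in> \<rho>" and ab: "(a, b) \<notin> \<rho>"
    obtain i j where ij: "i \<in> {1..m}" "j \<in> {1..m}" "a = e i" "c = e j" "(i, j) \<in> brel P" using \<rho>e[OF ac] by blast
    obtain l h where lh: "l \<in> {1..m}" "h \<in> {1..m}" "b = e l" "d = e h" "(l, h) \<in> brel P" using \<rho>e[OF bd] by blast
    have "nsep l h i j" using nceq_nsep[OF Pn ij(5) lh(5)] ab iff ij lh by blast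
    then show "nsep b d a c" unfolding nsep_def using enumerates_less_iff(1)[OF e] ij lh by simp
  qed
  moreover have "relabel e m r = P" if r: "r \<inter> K \<times> K = \<rho>" for r
  proof -
    have "{(i, j). i \<in> {1..m} \<and> j \<in> {1..m} \<and> (e i, e j) \<in> r} = brel P"
      using iff r enumerates_image(1)[OF e] nceq_dom[OF Pn] by blast
    then show ?thesis unfolding relabel_def using quotient_brel P noncrossing_partitions_iff by simp
  qed
  ultimately show ?thesis by blast
qed

lemma blocked_relabel:
  assumes e: "enumerates e m K" and r: "nceq K (r \<inter> K \<times> K)" and r': "nceq K (r' \<inter> K \<times> K)"
    and ab: "a \<in> {1..m}" "b \<in> {1..m}"
  shows "blocked a b (brel (relabel e m r)) (brel (relabel e m r')) \<longleftrightarrow>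
    blocked (e a) (e b) (r \<inter> K \<times> K) (r' \<inter> K \<times> K)"
proof -
  have rel: "(i, j) \<in> brel (relabel e m u) \<longleftrightarrow> i \<in> {1..m} \<and> j \<in> {1..m} \<and> (e i, e j) \<in> u \<inter> K \<times> K"
    if "nceq K (u \<inter> K \<times> K)" for u i j
    using relabel_noncrossing(2)[OF e that] enumerates_image(1)[OF e] by blast
  have cm: "class_min (brel (relabel e m u)) i \<longleftrightarrow> class_min (u \<inter> K \<times> K) (e i)"
    if u: "nceq K (u \<inter> K \<times> K)" and i: "i \<in> {1..m}" for u i
  proof
    assume L: "class_min (brel (relabel e m u)) i"
    show "class_min (u \<inter> K \<times> K) (e i)" unfolding class_min_def
    proof (intro allI impI notI)
      fix x assume x: "x < e i" "(x, e i) \<in> u \<inter> K \<times> K"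
      then obtain j where j: "j \<in> {1..m}" "x = e j" using enumerates_image(2)[OF e] by blast
      then have "j < i" using x enumerates_less_iff(1)[OF e] i by blast
      then show False using L x j i unfolding class_min_def rel[OF u] by blast
    qed
  next
    assume R: "class_min (u \<inter> K \<times> K) (e i)"
    show "class_min (brel (relabel e m u)) i" unfolding class_min_def rel[OF u]
      using R enumerates_less_iff(1)[OF e] unfolding class_min_def by blast
  qed
  have "(\<exists>h. (h, b) \<in> brel (relabel e m r') \<and> class_min (brel (relabel e m r')) h \<and> (a, h) \<in> brel (relabel e m r)) \<longleftrightarrow>
    (\<exists>x. (x, e b) \<in> r' \<inter> K \<times> K \<and> class_min (r' \<inter> K \<times> K) x \<and> (e a, x) \<in> r \<inter> K \<times> K)" (is "?L \<longleftrightarrow> ?R")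
  proof
    assume ?L
    then show ?R unfolding rel[OF r] rel[OF r'] using cm[OF r'] by blast
  next
    assume ?R
    then obtain x where x: "(x, e b) \<in> r' \<inter> K \<times> K" "class_min (r' \<inter> K \<times> K) x" "(e a, x) \<in> r \<inter> K \<times> K" by blast
    then obtain h where "h \<in> {1..m}" "x = e h" using enumerates_image(2)[OF e] by blast
    then show ?L unfolding rel[OF r] rel[OF r'] using x cm[OF r'] ab by blast
  qed
  then show ?thesis unfolding blocked_def using rel[OF r'] cm[OF r] ab by simp
qed

section \<open>Products of posets and coordinates\<close>

lemma Field_NC_poset: "Field (NC_poset m) = noncrossing_partitions m"
  by (auto simp: Field_def NC_poset_iff)

lemma Field_PiE_poset:
  assumes "\<And>i x. i \<in> I \<Longrightarrow> x \<in> Field (S i) \<Longrightarrow> (x, x) \<in> S i"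
  shows "Field (PiE_poset I S) = (\<Pi>\<^sub>E i\<in>I. Field (S i))"
proof (intro set_eqI iffI)
  fix f assume "f \<in> (\<Pi>\<^sub>E i\<in>I. Field (S i))"
  then have "(f, f) \<in> PiE_poset I S" using assms by (auto simp: PiE_poset_def)
  then show "f \<in> Field (PiE_poset I S)" by (rule FieldI1)
qed (auto simp: Field_def PiE_poset_def)

lemma Field_prod_poset:
  assumes "\<And>x. x \<in> Field r \<Longrightarrow> (x, x) \<in> r" "\<And>x. x \<in> Field s \<Longrightarrow> (x, x) \<in> s"
  shows "Field (prod_poset r s) = Field r \<times> Field s"
  using assms by (fastforce simp: Field_def prod_poset_def)

lemma poset_isomorphicI:
  assumes anti: "antisym r" and refl: "\<And>x. x \<in> Field s \<Longrightarrow> (x, x) \<in> s"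
    and f: "\<And>x. x \<in> Field r \<Longrightarrow> f x \<in> Field s"
    and emb: "\<And>x y. x \<in> Field r \<Longrightarrow> y \<in> Field r \<Longrightarrow> (x, y) \<in> r \<longleftrightarrow> (f x, f y) \<in> s"
    and surj: "\<And>z. z \<in> Field s \<Longrightarrow> \<exists>x\<in>Field r. f x = z"
  shows "poset_isomorphic r s"
proof -
  have "inj_on f (Field r)"
  proof (rule inj_onI)
    fix x y assume xy: "x \<in> Field r" "y \<in> Field r" "f x = f y"
    then have "(x, y) \<in> r" "(y, x) \<in> r" using emb refl f by metis+
    then show "x = y" using anti by (auto dest: antisymD)
  qed
  moreover have "f ` Field r = Field s" using f surj by blast
  ultimately show ?thesis using emb unfolding poset_isomorphic_def bij_betw_def by blast
qed

text \<open>The map \<open>G\<close> sends a relation to its restrictions to the cells in \<open>C\<close>, relabelled. Index sets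
  \<open>{1..j}\<close> have to be nonempty although \<open>C\<close> may be empty, hence \<open>ex_cell_coordinates\<close> adds a trivial factor.\<close>

definition cell_coordinates ::
  "nat set set \<Rightarrow> nat \<Rightarrow> (nat \<Rightarrow> nat) \<Rightarrow> (nat rel \<Rightarrow> nat \<Rightarrow> nat set set) \<Rightarrow> bool" where
  "cell_coordinates C j m G \<longleftrightarrow> 1 \<le> j \<and> (\<forall>i\<in>{1..j}. 1 \<le> m i) \<and>
     (\<forall>p. (\<forall>K\<in>C. nceq K (p \<inter> K \<times> K)) \<longrightarrow> G p \<in> Field (PiE_poset {1..j} (\<lambda>i. NC_poset (m i)))) \<and>
     (\<forall>p q. (\<forall>K\<in>C. nceq K (p \<inter> K \<times> K)) \<longrightarrow> (\<forall>K\<in>C. nceq K (q \<inter> K \<times> K)) \<longrightarrow>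
        (G p, G q) \<in> PiE_poset {1..j} (\<lambda>i. NC_poset (m i)) \<longleftrightarrow> (\<forall>K\<in>C. p \<inter> K \<times> K \<subseteq> q \<inter> K \<times> K)) \<and>
     (\<forall>z\<in>Field (PiE_poset {1..j} (\<lambda>i. NC_poset (m i))).
        \<exists>\<rho>. (\<forall>K\<in>C. nceq K (\<rho> K)) \<and> (\<forall>p. (\<forall>K\<in>C. p \<inter> K \<times> K = \<rho> K) \<longrightarrow> G p = z))"

lemma cell_coordinatesD:
  assumes "cell_coordinates C j m G"
  shows "1 \<le> j" "\<forall>i\<in>{1..j}. 1 \<le> m i"
    and "(\<And>K. K \<in> C \<Longrightarrow> nceq K (p \<inter> K \<times> K)) \<Longrightarrow> G p \<in> Field (PiE_poset {1..j} (\<lambda>i. NC_poset (m i)))"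
    and "(\<And>K. K \<in> C \<Longrightarrow> nceq K (p \<inter> K \<times> K)) \<Longrightarrow> (\<And>K. K \<in> C \<Longrightarrow> nceq K (q \<inter> K \<times> K)) \<Longrightarrow>
      (G p, G q) \<in> PiE_poset {1..j} (\<lambda>i. NC_poset (m i)) \<longleftrightarrow> (\<forall>K\<in>C. p \<inter> K \<times> K \<subseteq> q \<inter> K \<times> K)"
    and "z \<in> Field (PiE_poset {1..j} (\<lambda>i. NC_poset (m i))) \<Longrightarrow>
      \<exists>\<rho>. (\<forall>K\<in>C. nceq K (\<rho> K)) \<and> (\<forall>p. (\<forall>K\<in>C. p \<inter> K \<times> K = \<rho> K) \<longrightarrow> G p = z)"
proof -
  note D = assms[unfolded cell_coordinates_def]
  note D2 = D[THEN conjunct2, THEN conjunct2]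
  show "1 \<le> j" using D by (rule conjunct1)
  show "\<forall>i\<in>{1..j}. 1 \<le> m i" by (rule D[THEN conjunct2, THEN conjunct1])
  show "G p \<in> Field (PiE_poset {1..j} (\<lambda>i. NC_poset (m i)))"
    if "\<And>K. K \<in> C \<Longrightarrow> nceq K (p \<inter> K \<times> K)"
    by (rule D2[THEN conjunct1, THEN spec, THEN mp]) (rule ballI, rule that)
  show "(G p, G q) \<in> PiE_poset {1..j} (\<lambda>i. NC_poset (m i)) \<longleftrightarrow> (\<forall>K\<in>C. p \<inter> K \<times> K \<subseteq> q \<inter> K \<times> K)"
    if "\<And>K. K \<in> C \<Longrightarrow> nceq K (p \<inter> K \<times> K)" "\<And>K. K \<in> C \<Longrightarrow> nceq K (q \<inter> K \<times> K)"
    by (rule D2[THEN conjunct2, THEN conjunct1, THEN spec, THEN spec, THEN mp, THEN mp]) (rule ballI, rule that, assumption)+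
  show "\<exists>\<rho>. (\<forall>K\<in>C. nceq K (\<rho> K)) \<and> (\<forall>p. (\<forall>K\<in>C. p \<inter> K \<times> K = \<rho> K) \<longrightarrow> G p = z)"
    if "z \<in> Field (PiE_poset {1..j} (\<lambda>i. NC_poset (m i)))"
    using D2[THEN conjunct2, THEN conjunct2] that by (rule bspec)
qed

lemma ex_cell_coordinates:
  assumes fin: "finite C" and cell: "\<And>K. K \<in> C \<Longrightarrow> finite K \<and> K \<noteq> {}"
  shows "\<exists>j m G. cell_coordinates C j m G"
proof -
  define j where "j = Suc (card C)"
  obtain h where "bij_betw h {0..<card C} C" using ex_bij_betw_nat_finite[OF fin] by blast
  then have h: "bij_betw h {..<card C} C" by (simp add: atLeast0LessThan)
  define N where "N i = h (i - 1)" for i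
  have N: "N i \<in> C" if "i \<in> {1..card C}" for i
  proof -
    have "i - 1 \<in> {..<card C}" using that by auto
    then show ?thesis unfolding N_def by (rule bij_betwE[OF h, rule_format])
  qed
  have N_ex: "\<exists>i\<in>{1..card C}. N i = K" if "K \<in> C" for K
  proof -
    have "K \<in> h ` {..<card C}" using h that by (simp add: bij_betw_def)
    then obtain l where "l < card C" "h l = K" by blast
    then show ?thesis unfolding N_def by (intro bexI[of _ "Suc l"]) auto
  qed
  have N_inj: "i = i'" if "i \<in> {1..card C}" "i' \<in> {1..card C}" "N i = N i'" for i i'
  proof -
    have "i - 1 \<in> {..<card C}" "i' - 1 \<in> {..<card C}" "h (i - 1) = h (i' - 1)" using that N_def by auto
    then have "i - 1 = i' - 1" using h unfolding bij_betw_def by (meson inj_onD)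
    then show ?thesis using that by auto
  qed
  \<comment> \<open>The extra index \<open>j\<close> carries the one-element lattice
    \<open>NC_poset 1\<close>, whose only member is \<open>NC_bot 1\<close>.\<close>
  define m where "m i = (if i = j then 1 else card (N i))" for i
  have "\<forall>i. \<exists>e. i \<in> {1..card C} \<longrightarrow> enumerates e (card (N i)) (N i)"
    using ex_enumerates cell N by metis
  then obtain e where e: "\<And>i. i \<in> {1..card C} \<Longrightarrow> enumerates (e i) (card (N i)) (N i)" by metis
  define G where "G p = (\<lambda>i\<in>{1..j}. if i = j then NC_bot 1 else relabel (e i) (m i) p)" for p
  let ?P = "PiE_poset {1..j} (\<lambda>i. NC_poset (m i))"
  have mi: "m i = card (N i)" "i \<noteq> j" "i \<in> {1..j}" if "i \<in> {1..card C}" for i using that by (auto simp: m_def j_def)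
  have mj: "m j = 1" by (simp add: m_def)
  have ij: "i = j \<or> i \<in> {1..card C}" if "i \<in> {1..j}" for i using that by (auto simp: j_def)
  have jj: "j \<in> {1..j}" by (simp add: j_def)
  have F: "Field ?P = (\<Pi>\<^sub>E i\<in>{1..j}. noncrossing_partitions (m i))"
    by (subst Field_PiE_poset) (auto simp: Field_NC_poset NC_poset_iff)
  have single: "P = NC_bot 1" if "P \<in> noncrossing_partitions 1" for P
  proof (rule noncrossing_eqI[OF that NC_bot(1)])
    have "nceq {1} (brel P)" using noncrossing_nceq[OF that] by simp
    then show "brel P = brel (NC_bot 1)" using nceq_bounds[of "{1}" "brel P"] NC_bot(2)[of 1] by auto
  qed
  have rn: "relabel (e i) (m i) p \<in> noncrossing_partitions (m i)"
    if "i \<in> {1..card C}" "\<And>K. K \<in> C \<Longrightarrow> nceq K (p \<inter> K \<times> K)" for i p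
    using relabel_noncrossing(1)[OF e[OF that(1)]] that(2)[OF N[OF that(1)]] mi(1)[OF that(1)] by simp
  have GF: "G p \<in> Field ?P" if "\<And>K. K \<in> C \<Longrightarrow> nceq K (p \<inter> K \<times> K)" for p
    unfolding F G_def
  proof (rule restrict_PiE[THEN iffD2], rule Pi_I)
    fix i assume "i \<in> {1..j}"
    then show "(if i = j then NC_bot 1 else relabel (e i) (m i) p) \<in> noncrossing_partitions (m i)"
      using ij[of i] rn[OF _ that, of i] NC_bot(1)[of 1] mj by auto
  qed
  have Gi: "G p i = relabel (e i) (m i) p" if "i \<in> {1..card C}" for i p
    using mi[OF that] by (simp add: G_def)
  have Gj: "G p j = NC_bot 1" for p using jj by (simp add: G_def)
  have "cell_coordinates C j m G"
    unfolding cell_coordinates_def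
  proof (intro conjI allI impI ballI)
    show "1 \<le> j" by (simp add: j_def)
    show "1 \<le> m i" if "i \<in> {1..j}" for i
      using that ij[of i] mj mi(1)[of i] cell[OF N[of i]] card_gt_0_iff[of "N i"] by fastforce
    show "G p \<in> Field ?P" if "\<forall>K\<in>C. nceq K (p \<inter> K \<times> K)" for p
      using GF that by blast
    show "(G p, G q) \<in> ?P \<longleftrightarrow> (\<forall>K\<in>C. p \<inter> K \<times> K \<subseteq> q \<inter> K \<times> K)"
      if pq: "\<forall>K\<in>C. nceq K (p \<inter> K \<times> K)" "\<forall>K\<in>C. nceq K (q \<inter> K \<times> K)" for p q
    proof -
      note p = pq(1)[rule_format] and q = pq(2)[rule_format]
      have "(G p, G q) \<in> ?P \<longleftrightarrow> (\<forall>i\<in>{1..j}. (G p i, G q i) \<in> NC_poset (m i))"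
        using GF[OF p] GF[OF q] unfolding F by (simp add: PiE_poset_def Field_NC_poset)
      also have "\<dots> \<longleftrightarrow> (\<forall>i\<in>{1..card C}. (G p i, G q i) \<in> NC_poset (m i))"
        using ij mi(3) Gj NC_bot(1)[of 1] mj unfolding NC_poset_iff by (metis order_refl)
      also have "\<dots> \<longleftrightarrow> (\<forall>i\<in>{1..card C}. p \<inter> N i \<times> N i \<subseteq> q \<inter> N i \<times> N i)"
      proof (rule ball_cong[OF refl])
        fix i assume i: "i \<in> {1..card C}"
        show "(G p i, G q i) \<in> NC_poset (m i) \<longleftrightarrow> p \<inter> N i \<times> N i \<subseteq> q \<inter> N i \<times> N i"
          unfolding NC_poset_iff Gi[OF i] using rn[OF i p] rn[OF i q]
            relabel_subset_iff[OF e[OF i] p[OF N[OF i]] q[OF N[OF i]]] mi(1)[OF i] by simp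
      qed
      also have "\<dots> \<longleftrightarrow> (\<forall>K\<in>C. p \<inter> K \<times> K \<subseteq> q \<inter> K \<times> K)" using N N_ex by metis
      finally show ?thesis .
    qed
    show "\<exists>\<rho>. (\<forall>K\<in>C. nceq K (\<rho> K)) \<and> (\<forall>p. (\<forall>K\<in>C. p \<inter> K \<times> K = \<rho> K) \<longrightarrow> G p = z)"
      if z: "z \<in> Field ?P" for z
    proof -
      have zi: "z i \<in> noncrossing_partitions (m i)" if "i \<in> {1..j}" for i using z that unfolding F by blast
      have "\<exists>\<rho>. nceq K \<rho> \<and> (\<forall>p i. p \<inter> K \<times> K = \<rho> \<longrightarrow> i \<in> {1..card C} \<longrightarrow> N i = K \<longrightarrow> relabel (e i) (m i) p = z i)"
        if K: "K \<in> C" for K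
      proof -
        obtain i where i: "i \<in> {1..card C}" "N i = K" using N_ex[OF K] by blast
        obtain \<rho> where "nceq K \<rho>" "\<forall>p. p \<inter> K \<times> K = \<rho> \<longrightarrow> relabel (e i) (m i) p = z i"
          using ex_relabel[OF e[OF i(1)], of "z i"] zi[OF mi(3)[OF i(1)]] mi(1)[OF i(1)] i(2) by auto
        then show ?thesis using N_inj[OF _ i(1)] i(2) by metis
      qed
      then obtain \<rho> where \<rho>: "\<And>K. K \<in> C \<Longrightarrow> nceq K (\<rho> K)"
        "\<And>K p i. K \<in> C \<Longrightarrow> p \<inter> K \<times> K = \<rho> K \<Longrightarrow> i \<in> {1..card C} \<Longrightarrow> N i = K \<Longrightarrow> relabel (e i) (m i) p = z i"
        by metis
      have "G p = z" if p: "\<forall>K\<in>C. p \<inter> K \<times> K = \<rho> K" for p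
      proof
        fix i
        show "G p i = z i"
        proof (cases "i \<in> {1..j}")
          case False
          then show ?thesis using z unfolding F G_def PiE_def extensional_def by auto
        next
          case True
          then consider "i = j" | "i \<in> {1..card C}" using ij by blast
          then show ?thesis
          proof cases
            case 1
            then show ?thesis using Gj single zi[OF jj] mj by simp
          next
            case 2
            then show ?thesis using Gi[OF 2] \<rho>(2)[OF N[OF 2] _ 2 refl] p N[OF 2] by simp
          qed
        qed
      qed
      then show ?thesis using \<rho>(1) by blast
    qed
  qed
  then show ?thesis by blast
qed

text \<open>With \<open>k = n = r\<close> no element exceeds \<open>r + 1\<close>, so
  \<open>tail_joined\<close> is automatic and \<open>blocked\<close> alone governs the order;
  reachability from the bottom and of the top yield the two conditions in \<open>F\<close>.\<close>

lemma PF_diagonal_poset_iff: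
  assumes r: "1 \<le> r"
  defines "F \<equiv> {P \<in> noncrossing_partitions (r + 1). \<not> blocked r (r + 1) (Id_on {1..r + 1}) (brel P) \<and>
    \<not> blocked r (r + 1) (brel P) ({1..r + 1} \<times> {1..r + 1})}"
  shows "(P, Q) \<in> PF_poset r r \<longleftrightarrow>
      P \<in> F \<and> Q \<in> F \<and> brel P \<subseteq> brel Q \<and> \<not> blocked r (r + 1) (brel P) (brel Q)"
    and "Field (PF_poset r r) = F"
    and "P \<in> F \<Longrightarrow> (P, P) \<in> PF_poset r r"
proof -
  have tj: "tail_joined r (brel P)" if "P \<in> noncrossing_partitions (r + 1)" for P
    using nceq_dom[OF noncrossing_nceq[OF that]] unfolding tail_joined_def class_min_def by force
  note path = PF_path_iff[OF le_refl _ tj]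
  have bot: "(NC_bot (r + 1), P) \<in> (PF_steps r r)\<^sup>* \<longleftrightarrow>
      P \<in> noncrossing_partitions (r + 1) \<and> \<not> blocked r (r + 1) (Id_on {1..r + 1}) (brel P)" for P
    using path[OF NC_bot(1) NC_bot(1)] tj nceq_bounds(1)[OF noncrossing_nceq, of P "r + 1"]
    unfolding NC_bot(2) by blast
  have top: "(P, NC_top (r + 1)) \<in> (PF_steps r r)\<^sup>* \<longleftrightarrow> \<not> blocked r (r + 1) (brel P) ({1..r + 1} \<times> {1..r + 1})"
    if "P \<in> noncrossing_partitions (r + 1)" for P
    using path[OF that that, of "NC_top (r + 1)"] tj[OF NC_top(1)] NC_top(1) nceq_bounds(2)[OF noncrossing_nceq, OF that]
    unfolding NC_top(2) by blast
  show iff: "(P, Q) \<in> PF_poset r r \<longleftrightarrow>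
      P \<in> F \<and> Q \<in> F \<and> brel P \<subseteq> brel Q \<and> \<not> blocked r (r + 1) (brel P) (brel Q)" for P Q
  proof
    assume "(P, Q) \<in> PF_poset r r"
    then have b: "(NC_bot (r + 1), P) \<in> (PF_steps r r)\<^sup>*" and pq: "(P, Q) \<in> (PF_steps r r)\<^sup>*"
      and t: "(Q, NC_top (r + 1)) \<in> (PF_steps r r)\<^sup>*" using PF_poset_iff[OF r le_refl] by blast+
    have bq: "(NC_bot (r + 1), Q) \<in> (PF_steps r r)\<^sup>*" using b pq by (rule rtrancl_trans)
    have pt: "(P, NC_top (r + 1)) \<in> (PF_steps r r)\<^sup>*" using pq t by (rule rtrancl_trans)
    have P: "P \<in> noncrossing_partitions (r + 1)" and Q: "Q \<in> noncrossing_partitions (r + 1)" using b bq bot by blast+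
    show "P \<in> F \<and> Q \<in> F \<and> brel P \<subseteq> brel Q \<and> \<not> blocked r (r + 1) (brel P) (brel Q)"
      using b bq pt t pq bot top[OF P] top[OF Q] path[OF P P, of Q] unfolding F_def by blast
  next
    assume R: "P \<in> F \<and> Q \<in> F \<and> brel P \<subseteq> brel Q \<and> \<not> blocked r (r + 1) (brel P) (brel Q)"
    then have P: "P \<in> noncrossing_partitions (r + 1)" and Q: "Q \<in> noncrossing_partitions (r + 1)" by (auto simp: F_def)
    show "(P, Q) \<in> PF_poset r r"
      using R bot top[OF P] top[OF Q] path[OF P P, of Q] tj[OF Q] Q unfolding F_def PF_poset_iff[OF r le_refl] by blast
  qed
  have nb: "\<not> blocked r (r + 1) (brel P) (brel P)" for P
    by (auto simp: blocked_def class_min_def)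
  show F: "(P, P) \<in> PF_poset r r" if "P \<in> F" for P using that nb iff by blast
  show "Field (PF_poset r r) = F" using F iff unfolding Field_def by blast
qed

theorem theorem1:
  fixes n k :: nat and \<sigma> \<tau> :: "nat set set"
  assumes "1 < k" and "k \<le> n"
    and "(\<sigma>, \<tau>) \<in> PF_poset n k"
  shows "(\<exists>(r::nat) (j::nat) (m::nat \<Rightarrow> nat). 2 \<le> r \<and> 1 \<le> j \<and> (\<forall>i\<in>{1..j}. 1 \<le> m i) \<and>
            poset_isomorphic (interval_poset (PF_poset n k) \<sigma> \<tau>)
              (prod_poset (PF_poset r r) (PiE_poset {1..j} (\<lambda>i. NC_poset (m i)))))
       \<or> (\<exists>(j::nat) (m::nat \<Rightarrow> nat). 1 \<le> j \<and> (\<forall>i\<in>{1..j}. 1 \<le> m i) \<and>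
            poset_isomorphic (interval_poset (PF_poset n k) \<sigma> \<tau>)
              (PiE_poset {1..j} (\<lambda>i. NC_poset (m i))))"
proof -
  define A H where "A = {1..n + 1}" and "H = {1..k + 1}"
  define s t where "s = brel \<sigma>" and "t = brel \<tau>"
  let ?S = "(PF_steps n k)\<^sup>*" and ?N = "noncrossing_partitions (n + 1)" and ?I = "interval_poset (PF_poset n k) \<sigma> \<tau>"
  have k1: "1 \<le> k" using assms(1) by simp
  note PF = PF_poset_iff[OF k1 assms(2)]
  have bs: "(NC_bot (n + 1), \<sigma>) \<in> ?S" and st: "(\<sigma>, \<tau>) \<in> ?S" and tt: "(\<tau>, NC_top (n + 1)) \<in> ?S"
    using assms(3) PF by blast+
  have tail_bot: "tail_joined k (brel (NC_bot (n + 1)))"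
    unfolding NC_bot(2) by (auto simp: tail_joined_def class_min_def)
  note \<sigma> = PF_path_imp[OF assms(2) NC_bot(1) tail_bot bs]
  note \<tau> = PF_path_imp[OF assms(2) \<sigma>(1,3) st, folded s_def t_def]
  have s: "nceq A s" and t: "nceq A t" and ts: "tail_joined k s"
    using noncrossing_nceq \<sigma> \<tau>(1) unfolding s_def t_def A_def by blast+
  define X where "X = {x \<in> ?N. s \<subseteq> brel x \<and> brel x \<subseteq> t \<and> tail_joined k (brel x) \<and>
      \<not> blocked k (k + 1) s (brel x) \<and> \<not> blocked k (k + 1) (brel x) t}"
  have X: "x \<in> X \<longleftrightarrow> (\<sigma>, x) \<in> ?S \<and> (x, \<tau>) \<in> ?S" for x
    using PF_path_iff[OF assms(2) \<sigma>(1,3), of x] PF_path_iff[OF assms(2), of x \<tau>] \<tau>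
    unfolding X_def s_def t_def by blast
  have path: "(x, y) \<in> ?S \<longleftrightarrow> brel x \<subseteq> brel y \<and> \<not> blocked k (k + 1) (brel x) (brel y)"
    if "x \<in> X" "y \<in> X" for x y
    using PF_path_iff[OF assms(2), of x y] that unfolding X_def by blast
  \<comment> \<open>Vertices on paths from \<open>\<sigma>\<close> to \<open>\<tau>\<close> inherit
    reachability from the bottom and of the top through \<open>bs\<close> and
    \<open>tt\<close>.\<close>
  have I: "(x, y) \<in> ?I \<longleftrightarrow> x \<in> X \<and> y \<in> X \<and> (x, y) \<in> ?S" for x y
  proof -
    have "(\<sigma>, z) \<in> PF_poset n k \<and> (z, \<tau>) \<in> PF_poset n k \<longleftrightarrow> z \<in> X" for z
      using bs tt rtrancl_trans[of _ _ "PF_steps n k"] unfolding PF X by blast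
    moreover have "(x, y) \<in> PF_poset n k \<longleftrightarrow> (x, y) \<in> ?S" if "x \<in> X" "y \<in> X"
      using that bs tt rtrancl_trans[of _ _ "PF_steps n k"] unfolding PF X by blast
    ultimately show ?thesis unfolding interval_poset_def by blast
  qed
  have Field: "Field ?I = X" using I unfolding Field_def by blast
  have anti: "antisym ?I"
  proof (rule antisymI)
    fix x y assume "(x, y) \<in> ?I" "(y, x) \<in> ?I"
    then have "x \<in> ?N" "y \<in> ?N" "brel x = brel y" using path[of x y] path[of y x] unfolding I X_def by blast+
    then show "x = y" by (rule noncrossing_eqI)
  qed
  have Xn: "nceq A (brel x)" if "x \<in> X" for x
    using that noncrossing_nceq unfolding X_def A_def by blast
  let ?C = "cells k s t"
  have C: "K \<subseteq> A \<and> K \<noteq> {}" if "K \<in> ?C" for K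
    using cells_subset[OF A_def assms(2) t that] by blast
  have finA: "finite A" by (simp add: A_def)
  have finC: "finite ?C" using finite_subset[of ?C "Pow A"] C finA by blast
  have finK: "finite K \<and> K \<noteq> {}" if "K \<in> ?C" for K using C[OF that] finA finite_subset by blast
  have Kn: "nceq K (brel x \<inter> K \<times> K)" if "x \<in> X" "K \<in> ?C" for x K
    using nceq_restrict[OF Xn[OF that(1)]] C[OF that(2)] by blast
  have sub_iff: "brel x \<subseteq> brel y \<longleftrightarrow> (\<forall>K\<in>?C. brel x \<inter> K \<times> K \<subseteq> brel y \<inter> K \<times> K)"
    if x: "x \<in> X" and y: "y \<in> X" for x y
  proof (rule subset_iff_cells[OF A_def assms(2) s Xn[OF x] _ Xn[OF y]])
    show "tail_joined k (brel x)" "s \<subseteq> brel x" "s \<subseteq> brel y" "brel x \<subseteq> t" using x y by (auto simp: X_def)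
  qed
  have build: "\<exists>x\<in>?N. s \<subseteq> brel x \<and> brel x \<subseteq> t \<and> tail_joined k (brel x) \<and> (\<forall>K\<in>?C. brel x \<inter> K \<times> K = \<rho> K)"
    if \<rho>: "\<And>K. K \<in> ?C \<Longrightarrow> nceq K (\<rho> K)" for \<rho>
  proof -
    obtain p where p: "nceq A p" "tail_joined k p" "s \<subseteq> p" "p \<subseteq> t" "\<And>K. K \<in> ?C \<Longrightarrow> p \<inter> K \<times> K = \<rho> K"
      using ex_nceq_cells[OF A_def assms(2) s ts t \<tau>(2) \<rho>] by blast
    have "brel (A // p) = p" using brel_quotient p(1) nceq_def by blast
    moreover have "A // p \<in> ?N" using quotient_noncrossing p(1) unfolding A_def by blast
    ultimately show ?thesis using p by (intro bexI[of _ "A // p"]) auto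
  qed
  show ?thesis
  proof (cases "class_min s (k + 1) \<and> (k, k + 1) \<in> t")
    case False
    \<comment> \<open>Enlarging the lower relation or shrinking the upper one cannot make the
      condition of the case split true, so no pair inside the interval is blocked and the order is
      plain inclusion.\<close>
    have free: "\<not> blocked k (k + 1) u v" if "s \<subseteq> u" "v \<subseteq> t" for u v
      using False that class_min_mono[OF that(1)] unfolding blocked_def by blast
    obtain j m G where G: "cell_coordinates ?C j m G" using ex_cell_coordinates[OF finC finK] by blast
    note j = cell_coordinatesD(1,2)[OF G] and G1 = cell_coordinatesD(3)[OF G]
      and G2 = cell_coordinatesD(4)[OF G] and G3 = cell_coordinatesD(5)[OF G]
    have "poset_isomorphic ?I (PiE_poset {1..j} (\<lambda>i. NC_poset (m i)))"
    proof (rule poset_isomorphicI[OF anti, of _ "\<lambda>x. G (brel x)", unfolded Field])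
      show "(z, z) \<in> PiE_poset {1..j} (\<lambda>i. NC_poset (m i))"
        if "z \<in> Field (PiE_poset {1..j} (\<lambda>i. NC_poset (m i)))" for z
        using that by (auto simp: Field_def PiE_poset_def PiE_iff NC_poset_iff)
      show "G (brel x) \<in> Field (PiE_poset {1..j} (\<lambda>i. NC_poset (m i)))" if "x \<in> X" for x
        using G1[OF Kn[OF that]] .
      show "(x, y) \<in> ?I \<longleftrightarrow> (G (brel x), G (brel y)) \<in> PiE_poset {1..j} (\<lambda>i. NC_poset (m i))"
        if x: "x \<in> X" and y: "y \<in> X" for x y
      proof -
        have "\<not> blocked k (k + 1) (brel x) (brel y)" using free x y by (simp add: X_def)
        then show ?thesis using G2[OF Kn[OF x] Kn[OF y]] sub_iff[OF x y] path[OF x y] x y unfolding I by blast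
      qed
      show "\<exists>x\<in>X. G (brel x) = z" if z: "z \<in> Field (PiE_poset {1..j} (\<lambda>i. NC_poset (m i)))" for z
      proof -
        obtain \<rho> where \<rho>: "\<And>K. K \<in> ?C \<Longrightarrow> nceq K (\<rho> K)" "\<And>p. \<forall>K\<in>?C. p \<inter> K \<times> K = \<rho> K \<Longrightarrow> G p = z"
          using G3[OF z] by blast
        obtain x where x: "x \<in> ?N" "s \<subseteq> brel x" "brel x \<subseteq> t" "tail_joined k (brel x)" "\<forall>K\<in>?C. brel x \<inter> K \<times> K = \<rho> K"
          using build[OF \<rho>(1)] by blast
        have "x \<in> X" using x free[of s "brel x"] free[of "brel x" t] by (simp add: X_def)
        then show ?thesis using \<rho>(2)[OF x(5)] by blast
      qed
    qed
    then show ?thesis using j by blast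
  next
    case True
    define s1 t1 where "s1 = s \<inter> H \<times> H" and "t1 = t \<inter> H \<times> H"
    define K where "K = pocket s1 t1 `` {k + 1}"
    have HA: "H \<subseteq> A" "H = A \<inter> {..k + 1}" using assms(2) by (auto simp: A_def H_def)
    have s1: "nceq H s1" and t1: "nceq H t1" unfolding s1_def t1_def using nceq_restrict s t HA by blast+
    have st1: "s1 \<subseteq> t1" using \<tau>(2) unfolding s1_def t1_def by blast
    have finH: "finite H" by (simp add: H_def)
    have H: "x \<le> k + 1" "x < k + 1 \<Longrightarrow> x \<le> k" if "x \<in> H" for x using that by (auto simp: H_def)
    have cs: "class_min s1 (k + 1)" using True class_min_mono[of s1 s] by (auto simp: s1_def)
    have kt: "(k, k + 1) \<in> t1" using True k1 by (simp add: t1_def H_def)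
    have nb1: "\<not> blocked k (k + 1) s1 t1"
      using \<tau>(4) blocked_restrict[OF s t HA(2), of k] unfolding s1_def t1_def by simp
    have kk: "k < k + 1" by simp
    note card = card_pocket_not_blocked[OF finH s1 t1 st1 H(1) H(2) kk cs kt nb1 K_def]
    have KC: "K \<in> ?C"
      using quotientI[of "k + 1" H "pocket s1 t1"] kt nceq_dom[OF t1]
      unfolding cells_def head_cells_def Let_def K_def s1_def t1_def H_def by blast
    \<comment> \<open>\<open>PF_poset r r\<close> consists of partitions of \<open>r + 1\<close>
      points, so \<open>K\<close> must have that many elements.\<close>
    define r where "r = card K - 1"
    have r: "2 \<le> r" "card K = r + 1" using card(1) by (auto simp: r_def)
    have finKK: "finite K" using finK[OF KC] by blast
    obtain e where e: "enumerates e (r + 1) K" using ex_enumerates[OF finKK] r(2) by metis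
    \<comment> \<open>\<open>k + 1\<close> and \<open>k\<close> are the two largest elements of
      \<open>K\<close>, so the increasing enumeration takes \<open>r + 1\<close> and
      \<open>r\<close> to them and matches \<open>blocked k (k + 1)\<close> with
      \<open>blocked r (r + 1)\<close>.\<close>
    have e1: "e (r + 1) = k + 1"
    proof -
      obtain i where i: "i \<in> {1..r + 1}" "e i = k + 1" using enumerates_image(2)[OF e card(3)] by blast
      have "e (r + 1) \<le> k + 1" using enumerates_image(1)[OF e, of "r + 1"] card(4) H by auto
      then have "\<not> i < r + 1" using enumerates_less_iff(1)[OF e i(1), of "r + 1"] i by auto
      then show ?thesis using i by simp
    qed
    have e2: "e r = k"
    proof -
      obtain i where i: "i \<in> {1..r + 1}" "e i = k" using enumerates_image(2)[OF e card(2)] by blast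
      have "i \<noteq> r + 1" using i(2) e1 by auto
      moreover have "e r < e (r + 1)" using enumerates_less_iff(1)[OF e, of r "r + 1"] r by simp
      then have "\<not> i < r" using enumerates_less_iff(1)[OF e i(1), of r] i(2) e1 r by auto
      ultimately show ?thesis using i by (cases "i = r") auto
    qed
    define Q where "Q = relabel e (r + 1)"
    have Kn': "nceq K (u \<inter> K \<times> K)" if "nceq A u" for u
      using nceq_restrict[OF that] C[OF KC] by blast
    have blocked: "blocked k (k + 1) u v \<longleftrightarrow> blocked r (r + 1) (brel (Q u)) (brel (Q v))"
      if u: "nceq A u" "s \<subseteq> u" "u \<subseteq> t" and v: "nceq A v" "s \<subseteq> v" "v \<subseteq> t" for u v
    proof -
      have res: "(w \<inter> H \<times> H) \<inter> K \<times> K = w \<inter> K \<times> K" for w using card(4) by blast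
      have uH: "nceq H (u \<inter> H \<times> H)" "s1 \<subseteq> u \<inter> H \<times> H" "u \<inter> H \<times> H \<subseteq> t1"
        and vH: "nceq H (v \<inter> H \<times> H)" "s1 \<subseteq> v \<inter> H \<times> H" "v \<inter> H \<times> H \<subseteq> t1"
        using nceq_restrict[OF u(1) HA(1)] nceq_restrict[OF v(1) HA(1)] u v unfolding s1_def t1_def by blast+
      have "blocked k (k + 1) u v \<longleftrightarrow> blocked k (k + 1) (u \<inter> H \<times> H) (v \<inter> H \<times> H)"
        by (rule blocked_restrict[OF u(1) v(1) HA(2)]) simp
      also have "\<dots> \<longleftrightarrow> blocked k (k + 1) (u \<inter> K \<times> K) (v \<inter> K \<times> K)"
        using blocked_pocket_iff[OF finH s1 t1 uH vH H(1) H(2) kk cs kt K_def] unfolding res by simp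
      also have "\<dots> \<longleftrightarrow> blocked r (r + 1) (brel (Q u)) (brel (Q v))"
        using blocked_relabel[OF e Kn'[OF u(1)] Kn'[OF v(1)], of r "r + 1"] r unfolding Q_def e1 e2 by simp
      finally show ?thesis .
    qed
    have Kpocket: "(x, y) \<in> pocket s1 t1" if "x \<in> K" "y \<in> K" for x y
      using that pocket_sym[OF t1] pocket_trans[OF t1] unfolding K_def by blast
    \<comment> \<open>\<open>s\<close> becomes discrete on the pocket and \<open>t\<close> full, so
      that being blocked against an end of the interval turns into the conditions of
      \<open>PF_diagonal_poset_iff\<close>.\<close>
    have Qs: "brel (Q s) = Id_on {1..r + 1}"
    proof -
      have "i = i'" if i: "i \<in> {1..r + 1}" "i' \<in> {1..r + 1}" "(e i, e i') \<in> s" for i i'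
      proof -
        have eK: "e i \<in> K" "e i' \<in> K" using enumerates_image(1)[OF e] i by blast+
        then have "(e i, e i') \<in> s1" using i(3) card(4) unfolding s1_def by blast
        then have "e i = e i'" using pocket_bottom[OF s1 Kpocket[OF eK]] by blast
        then show ?thesis using enumerates_less_iff(2)[OF e i(1,2)] by blast
      qed
      then have "brel (Q s) \<subseteq> Id_on {1..r + 1}"
        unfolding Q_def relabel_noncrossing(2)[OF e Kn'[OF s]] by (auto simp: Id_on_iff)
      then show ?thesis
        using nceq_bounds(1)[OF noncrossing_nceq[OF relabel_noncrossing(1)[OF e Kn'[OF s]]]] unfolding Q_def by blast
    qed
    have Qt: "brel (Q t) = {1..r + 1} \<times> {1..r + 1}"
    proof -
      have "(e i, e i') \<in> t" if "i \<in> {1..r + 1}" "i' \<in> {1..r + 1}" for i i'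
        using Kpocket[of "e i" "e i'"] enumerates_image(1)[OF e] that pocketD(1) unfolding t1_def by blast
      then show ?thesis unfolding Q_def relabel_noncrossing(2)[OF e Kn'[OF t]] by blast
    qed
    have r1: "1 \<le> r" using r by simp
    note D = PF_diagonal_poset_iff[OF r1]
    \<comment> \<open>\<open>blocked\<close> depends on the restriction to \<open>K\<close> alone,
      so the remaining cells are unconstrained and contribute full noncrossing partition
      lattices.\<close>
    let ?D = "?C - {K}"
    have finD: "finite ?D" using finC by simp
    have finDK: "finite L \<and> L \<noteq> {}" if "L \<in> ?D" for L using finK that by blast
    obtain j m G where G: "cell_coordinates ?D j m G" using ex_cell_coordinates[OF finD finDK] by blast
    note j = cell_coordinatesD(1,2)[OF G] and G1 = cell_coordinatesD(3)[OF G]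
      and G2 = cell_coordinatesD(4)[OF G] and G3 = cell_coordinatesD(5)[OF G]
    let ?P = "PiE_poset {1..j} (\<lambda>i. NC_poset (m i))" and ?R = "PF_poset r r"
    have Prefl: "(z, z) \<in> ?P" if "z \<in> Field ?P" for z
      using that by (auto simp: Field_def PiE_poset_def PiE_iff NC_poset_iff)
    have Rrefl: "(z, z) \<in> ?R" if "z \<in> Field ?R" for z using that D(2,3) by blast
    have FRP: "Field (prod_poset ?R ?P) = Field ?R \<times> Field ?P" by (rule Field_prod_poset[OF Rrefl Prefl])
    have Kn2: "nceq L (brel x \<inter> L \<times> L)" if "x \<in> X" "L \<in> ?D" for x L using Kn that by blast
    have bounds: "s \<subseteq> brel x" "brel x \<subseteq> t" if "x \<in> X" for x using that by (auto simp: X_def)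
    have QF: "Q (brel x) \<in> Field ?R \<longleftrightarrow> \<not> blocked k (k + 1) s (brel x) \<and> \<not> blocked k (k + 1) (brel x) t"
      if x: "nceq A (brel x)" "s \<subseteq> brel x" "brel x \<subseteq> t" for x
      using relabel_noncrossing(1)[OF e Kn'[OF x(1)], folded Q_def]
        blocked[OF s order_refl \<tau>(2) x, unfolded Qs] blocked[OF x t \<tau>(2) order_refl, unfolded Qt]
      unfolding D(2) by blast
    have "poset_isomorphic ?I (prod_poset ?R ?P)"
    proof (rule poset_isomorphicI[OF anti, where s = "prod_poset ?R ?P" and
          f = "\<lambda>x. (Q (brel x), G (brel x))", unfolded Field FRP])
      show "(z, z) \<in> prod_poset ?R ?P" if "z \<in> Field ?R \<times> Field ?P" for z
        using that Rrefl Prefl by (auto simp: prod_poset_def)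
      show "(Q (brel x), G (brel x)) \<in> Field ?R \<times> Field ?P" if x: "x \<in> X" for x
        using QF[OF Xn[OF x] bounds[OF x]] G1[OF Kn2[OF x]] x by (simp add: X_def)
      show "(x, y) \<in> ?I \<longleftrightarrow> ((Q (brel x), G (brel x)), (Q (brel y), G (brel y))) \<in> prod_poset ?R ?P"
        if x: "x \<in> X" and y: "y \<in> X" for x y
      proof -
        have "Q (brel x) \<in> Field ?R" "Q (brel y) \<in> Field ?R"
          using QF[OF Xn[OF x] bounds[OF x]] QF[OF Xn[OF y] bounds[OF y]] x y by (simp_all add: X_def)
        then have "(Q (brel x), Q (brel y)) \<in> ?R \<longleftrightarrow>
            brel x \<inter> K \<times> K \<subseteq> brel y \<inter> K \<times> K \<and> \<not> blocked k (k + 1) (brel x) (brel y)"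
          using D(1)[of "Q (brel x)" "Q (brel y)"] relabel_subset_iff[OF e Kn'[OF Xn[OF x]] Kn'[OF Xn[OF y]]]
            blocked[OF Xn[OF x] bounds[OF x] Xn[OF y] bounds[OF y]]
          unfolding D(2) Q_def by blast
        moreover have "(\<forall>L\<in>?C. brel x \<inter> L \<times> L \<subseteq> brel y \<inter> L \<times> L) \<longleftrightarrow>
            brel x \<inter> K \<times> K \<subseteq> brel y \<inter> K \<times> K \<and> (\<forall>L\<in>?D. brel x \<inter> L \<times> L \<subseteq> brel y \<inter> L \<times> L)"
          using KC by blast
        ultimately show ?thesis
          using G2[OF Kn2[OF x] Kn2[OF y]] sub_iff[OF x y] path[OF x y] x y unfolding I prod_poset_def by blast
      qed
      show "\<exists>x\<in>X. (Q (brel x), G (brel x)) = z" if wz: "z \<in> Field ?R \<times> Field ?P" for z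
      proof -
        obtain P z' where z: "z = (P, z')" "P \<in> Field ?R" "z' \<in> Field ?P" using wz by blast
        obtain \<rho> where \<rho>: "\<And>L. L \<in> ?D \<Longrightarrow> nceq L (\<rho> L)" "\<And>p. \<forall>L\<in>?D. p \<inter> L \<times> L = \<rho> L \<Longrightarrow> G p = z'"
          using G3[OF z(3)] by blast
        have "P \<in> noncrossing_partitions (r + 1)" using z(2) unfolding D(2) by blast
        then obtain \<rho>0 where \<rho>0: "nceq K \<rho>0" "\<And>p. p \<inter> K \<times> K = \<rho>0 \<Longrightarrow> Q p = P"
          using ex_relabel[OF e] unfolding Q_def by blast
        \<comment> \<open>The vertex \<open>P\<close> of the first factor prescribes the restriction
          to \<open>K\<close>, and \<open>z'\<close> prescribes those to the other cells.\<close>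
        have "nceq L ((\<rho>(K := \<rho>0)) L)" if "L \<in> ?C" for L using \<rho>(1)[of L] \<rho>0(1) that by simp
        then obtain x where x: "x \<in> ?N" "s \<subseteq> brel x" "brel x \<subseteq> t" "tail_joined k (brel x)"
            "\<forall>L\<in>?C. brel x \<inter> L \<times> L = (\<rho>(K := \<rho>0)) L"
          using build[of "\<rho>(K := \<rho>0)"] by blast
        have "Q (brel x) = P" using \<rho>0(2) x(5) KC by simp
        moreover have "G (brel x) = z'" using \<rho>(2) x(5) by simp
        moreover have "nceq A (brel x)" using noncrossing_nceq[OF x(1)] by (simp add: A_def)
        then have "x \<in> X" using QF[OF _ x(2,3)] \<open>Q (brel x) = P\<close> z(2) x by (simp add: X_def)
        ultimately show ?thesis using z(1) by blast
      qed
    qed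
    then show ?thesis using j r(1) by blast
  qed
qed

end
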